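(* The mapping $F\in\mathcal S_{fin}(\mathcal H)\mapsto\varphi_F\in\mathcal A(\mathcal H_\Lambda)$, $\varphi_F(\zeta)=\langle\exp\zeta\mid F\rangle$, is a homomorphism of the algebras $\mathcal S_{fin}(\mathcal H)$ (with the graded tensor product $\odot$) and $\mathcal A(\mathcal H_\Lambda)$ (with pointwise multiplication), i.e. $$\varphi_{F\odot G}(\zeta)=\varphi_F(\zeta)\,\varphi_G(\zeta)\qquad\text{if }F,G\in\mathcal S_{fin}(\mathcal H).$$
   Context: Fock space. $\mathcal H=\mathcal H_{\bar0}\oplus\mathcal H_{\bar1}$ is a $\mathbb Z_2$-graded complex separable Hilbert space (inner product antilinear in the first argument), $\mathcal H_{\bar k}=\mathcal E_{\bar k}\oplus\mathcal E_{\bar k}^*$, with an antiunitary involution $f\mapsto f^*$, $f^{**}=f$, exchanging $\mathcal E_{\bar k}$ and its dual $\mathcal E_{\bar k}^*$, $k=0,1$. Parity: $\pi(f)=k$ for $0\ne f\in\mathcal H_{\bar k}$. On products of vectors of definite parity let $P^{(n)}f_1\otimes\cdots\otimes f_n=\frac1{n!}\sum_\sigma\chi_\sigma f_{\sigma(1)}\otimes\cdots\otimes f_{\sigma(n)}$ (sum over permutations), where $\chi_\sigma=(-1)^{N_\sigma}$ and $N_\sigma$ is the number of pairs $i<j$ with $\sigma(i)>\sigma(j)$ and $\pi(f_{\sigma(i)})=\pi(f_{\sigma(j)})=1$; $P^{(n)}$ extends to a projection. $\mathcal H^{\odot n}=P^{(n)}\mathcal H^{\otimes n}$ (algebraic tensor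 powers), $\mathcal S_{fin}(\mathcal H)=\bigoplus_n\mathcal H^{\odot n}$ (algebraic sum) with product $F\odot G=\sqrt{\frac{(p+q)!}{p!q!}}\,P^{(p+q)}F\otimes G$ for $F\in\mathcal H^{\odot p}$, $G\in\mathcal H^{\odot q}$. The norm is inherited from the tensor norm $\|f_1\otimes\cdots\otimes f_n\|_n=\prod\|f_a\|$, with $\|F\|^2=\sum_n\|F_n\|_n^2$; the completion is the Fock space $\mathcal S(\mathcal H)$. The involution extends to an isometric antilinear involution of $\mathcal S(\mathcal H)$ with $(F\odot G)^*=G^*\odot F^*$, and $\langle F\mid G\rangle:=(F^*\mid G)$ (bilinear). Grassmann extension. $\Lambda$ is the completion of the antisymmetric tensor algebra over a separable infinite-dimensional complex Hilbert space $\Lambda_1$, graded by degree, $\Lambda=\bigoplus_p\Lambda_p$, with unit $\kappa_0$, product $\lambda\mu=\sqrt{\frac{(p+q)!}{p!q!}}\,\mathrm{Alt}(\lambda\otimes\mu)$ for $\lambda\in\Lambda_p,\mu\in\Lambda_q$ ($\mathrm{Alt}$ = antisymmetrizing projection) and norm $\|\lambda\|_\Lambda^2=\sum_p(p!)^{-2}\|\lambda_p\|_p^2$ (the product is then continuous). $\Lambda_{\bar0}$, $\Lambda_{\bar1}$ are the even and odd parts. $\mathcal S^\Lambda(\mathcal H)=\Lambda\widehat\otimes\mathcal S(\mathcal H)$ (Hilbert tensor product), with $(\lambda_1\otimes F_1)(\lambda_2\otimes F_2)=\lambda_1\lambda_2\otimes(F_1\odot F_2)$ where defined, and with the $\Lambda$-valued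 continuous bilinear form determined by $\langle\lambda_1\otimes F_1\mid\lambda_2\otimes F_2\rangle=\lambda_1\lambda_2\langle F_1\mid F_2\rangle$. $F\in\mathcal S(\mathcal H)$ is identified with $\kappa_0\otimes F$. The superspace is $\mathcal H_\Lambda=(\Lambda_{\bar0}\widehat\otimes\mathcal H_{\bar0})\oplus(\Lambda_{\bar1}\widehat\otimes\mathcal H_{\bar1})$; for $\zeta\in\mathcal H_\Lambda$, $\exp\zeta=\sum_p\frac1{p!}\zeta^p\in\mathcal S^\Lambda(\mathcal H)$ converges. $\mathcal A(\mathcal H_\Lambda)$ is the algebra (pointwise multiplication in $\Lambda$) of entire analytic functions $\mathcal H_\Lambda\to\Lambda$.
   Formalization: The involution on the Fock space is taken order-preserving, (F⊙G)* = F*⊙G*, instead of (F⊙G)* = G*⊙F*; with the latter the identity fails by a sign for two odd vectors (φ would be an antihomomorphism). The two agree when the odd part of H is zero. *)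

theory Defs
  imports "HOL-Analysis.Analysis" "HOL-Combinatorics.Permutations"
begin

section \<open>Complex and graded Hilbert spaces\<close>

class complex_hilbert_space = banach +
  fixes scaleC :: "complex \<Rightarrow> 'a \<Rightarrow> 'a" (infixr "*\<^sub>C" 75)
    and cinner :: "'a \<Rightarrow> 'a \<Rightarrow> complex"
  assumes scaleC_add_right: "c *\<^sub>C (x + y) = c *\<^sub>C x + c *\<^sub>C y"
    and scaleC_add_left: "(c + d) *\<^sub>C x = c *\<^sub>C x + d *\<^sub>C x"
    and scaleC_scaleC: "c *\<^sub>C d *\<^sub>C x = (c * d) *\<^sub>C x"
    and scaleR_scaleC: "r *\<^sub>R x = complex_of_real r *\<^sub>C x"
    and cinner_commute: "cinner x y = cnj (cinner y x)"
    and cinner_add_right: "cinner x (y + z) = cinner x y + cinner x z"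
    and cinner_scaleC_right: "cinner x (c *\<^sub>C y) = c * cinner x y"
    and cinner_self: "cinner x x = complex_of_real ((norm x)\<^sup>2)"

text \<open>
  \<open>creation False\<close> and \<open>creation True\<close> are the spaces \<open>E\<^sub>0\<close> (even) and \<open>E\<^sub>1\<close> (odd);
  their duals are the images under the antiunitary involution \<open>star\<close>.
\<close>

class graded_hilbert_space = complex_hilbert_space + second_countable_topology +
  fixes creation :: "bool \<Rightarrow> 'a set"
    and star :: "'a \<Rightarrow> 'a"
  assumes creation_zero: "0 \<in> creation k"
    and creation_add: "x \<in> creation k \<Longrightarrow> y \<in> creation k \<Longrightarrow> x + y \<in> creation k"
    and creation_scaleC: "x \<in> creation k \<Longrightarrow> c *\<^sub>C x \<in> creation k"
    and creation_closed: "closed (creation k)"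
    and star_add: "star (x + y) = star x + star y"
    and star_scaleC: "star (c *\<^sub>C x) = cnj c *\<^sub>C star x"
    and star_cinner: "cinner (star x) (star y) = cinner y x"
    and star_star: "star (star x) = x"
    and creation_orthogonal:
      "x \<in> creation False \<Longrightarrow> y \<in> creation True \<Longrightarrow> cinner x y = 0"
    and creation_star_orthogonal:
      "x \<in> creation k \<Longrightarrow> y \<in> creation m \<Longrightarrow> cinner x (star y) = 0"
    and creation_total:
      "\<exists>a\<in>creation False. \<exists>b\<in>creation False. \<exists>c\<in>creation True. \<exists>d\<in>creation True.
         x = (a + star b) + (c + star d)"

definition graded_part :: "bool \<Rightarrow> 'h::graded_hilbert_space set" where
  "graded_part k = {x + star y | x y. x \<in> creation k \<and> y \<in> creation k}"

definition odd_vec :: "'h::graded_hilbert_space \<Rightarrow> bool" where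
  "odd_vec f \<longleftrightarrow> f \<in> graded_part True"

definition homogeneous :: "'h::graded_hilbert_space \<Rightarrow> bool" where
  "homogeneous f \<longleftrightarrow> f \<noteq> 0 \<and> (\<exists>k. f \<in> graded_part k)"


section \<open>Orthonormal bases\<close>

text \<open>A Hilbert basis of \<open>S\<close> is a maximal orthonormal subset of \<open>S\<close>.\<close>

definition is_onb :: "'a::complex_hilbert_space set \<Rightarrow> 'a set \<Rightarrow> bool" where
  "is_onb S B \<longleftrightarrow> B \<subseteq> S \<and> (\<forall>x\<in>B. cinner x x = 1) \<and>
     (\<forall>x\<in>B. \<forall>y\<in>B. x \<noteq> y \<longrightarrow> cinner x y = 0) \<and>
     (\<forall>x\<in>S. (\<forall>b\<in>B. cinner b x = 0) \<longrightarrow> x = 0)"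

definition onb :: "'a::complex_hilbert_space set \<Rightarrow> 'a set" where
  "onb S = (SOME B. is_onb S B)"

text \<open>An orthonormal basis of the graded space adapted to the four orthogonal summands.\<close>

definition hbasis :: "'h::graded_hilbert_space set" where
  "hbasis = (\<Union>k. onb (creation k) \<union> star ` onb (creation k))"

lemma ex_onb:
  fixes S :: "'a::complex_hilbert_space set"
  assumes sc: "\<And>c x. x \<in> S \<Longrightarrow> c *\<^sub>C x \<in> S"
  shows "\<exists>B. is_onb S B"
proof -
  define Q where "Q = {B. B \<subseteq> S \<and> (\<forall>x\<in>B. cinner x x = 1) \<and>
    (\<forall>x\<in>B. \<forall>y\<in>B. x \<noteq> y \<longrightarrow> cinner x y = 0)}"
  have QD: "B \<subseteq> S" "x \<in> B \<Longrightarrow> cinner x x = 1"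
    "x \<in> B \<Longrightarrow> y \<in> B \<Longrightarrow> x \<noteq> y \<Longrightarrow> cinner x y = 0" if "B \<in> Q" for B x y
    using that by (simp_all add: Q_def)
  have QI: "B \<in> Q" if "\<And>x. x \<in> B \<Longrightarrow> x \<in> S" "\<And>x. x \<in> B \<Longrightarrow> cinner x x = 1"
    "\<And>x y. x \<in> B \<Longrightarrow> y \<in> B \<Longrightarrow> x \<noteq> y \<Longrightarrow> cinner x y = 0" for B
    using that by (simp add: Q_def subset_iff)
  have "\<exists>M\<in>Q. \<forall>X\<in>Q. M \<subseteq> X \<longrightarrow> X = M"
  proof (rule subset_Zorn')
    fix C assume "subset.chain Q C"
    then have CQ: "X \<in> C \<Longrightarrow> X \<in> Q" and lin: "X \<in> C \<Longrightarrow> Y \<in> C \<Longrightarrow> X \<subseteq> Y \<or> Y \<subseteq> X" for X Y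
      unfolding subset_chain_def by blast+
    show "\<Union>C \<in> Q"
    proof (rule QI)
      fix x assume "x \<in> \<Union>C"
      then obtain X where X: "X \<in> C" "x \<in> X" by (rule UnionE)
      show "x \<in> S" using QD(1)[OF CQ[OF X(1)]] X(2) by (rule subsetD)
      show "cinner x x = 1" by (rule QD(2)[OF CQ[OF X(1)] X(2)])
      fix y assume "y \<in> \<Union>C" and ne: "x \<noteq> y"
      then obtain Y where Y: "Y \<in> C" "y \<in> Y" by (elim UnionE)
      obtain Z where "Z \<in> C" "x \<in> Z" "y \<in> Z" using lin[OF X(1) Y(1)] X Y by blast
      then show "cinner x y = 0" using QD(3)[OF CQ] ne by blast
    qed
  qed
  then obtain M where M: "M \<in> Q" and max: "\<forall>X\<in>Q. M \<subseteq> X \<longrightarrow> X = M" by (rule bexE)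
  have "x = 0" if x: "x \<in> S" and orth: "\<forall>b\<in>M. cinner b x = 0" for x
  proof (rule ccontr)
    assume nz: "x \<noteq> 0"
    define u where "u = complex_of_real (1 / norm x) *\<^sub>C x"
    have "norm u = 1"
      unfolding u_def scaleR_scaleC[symmetric] using nz by simp
    then have u1: "cinner u u = 1" by (simp add: cinner_self)
    have bu: "cinner b u = 0" if "b \<in> M" for b
      using bspec[OF orth that] by (simp add: u_def cinner_scaleC_right)
    have ub: "cinner u b = 0" if "b \<in> M" for b
      using bu[OF that] cinner_commute[of u b] by simp
    have uS: "u \<in> S" unfolding u_def by (rule sc[OF x])
    have "insert u M \<in> Q"
    proof (rule QI)
      show "z \<in> S" if "z \<in> insert u M" for z
        using that uS QD(1)[OF M] by blast
      show "cinner z z = 1" if "z \<in> insert u M" for z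
        using that u1 QD(2)[OF M] by blast
      show "cinner z z' = 0" if "z \<in> insert u M" "z' \<in> insert u M" "z \<noteq> z'" for z z'
        using that bu ub QD(3)[OF M] by blast
    qed
    with max have "insert u M = M" by blast
    then have "u \<in> M" by blast
    from bu[OF this] u1 show False by simp
  qed
  then have "is_onb S M"
    unfolding is_onb_def using QD[OF M] by blast
  then show ?thesis ..
qed


section \<open>Tensors in coordinates\<close>

text \<open>
  The completed tensor algebra over a Hilbert space with orthonormal basis \<open>B\<close> has the orthonormal
  basis \<open>b\<^sub>1 \<otimes> \<dots> \<otimes> b\<^sub>n\<close>; a tensor is represented by its coefficients, a function on words
  that vanishes outside \<open>lists B\<close>.
\<close>

definition tensor :: "'h::graded_hilbert_space list \<Rightarrow> 'h list \<Rightarrow> complex" where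
  "tensor fs w = (if w \<in> lists hbasis \<and> length w = length fs
                  then \<Prod>i<length fs. cinner (w ! i) (fs ! i) else 0)"

definition koszul :: "('a \<Rightarrow> bool) \<Rightarrow> (nat \<Rightarrow> nat) \<Rightarrow> 'a list \<Rightarrow> complex" where
  "koszul odd_letter s fs =
     (-1) ^ card {(i, j). i < j \<and> j < length fs \<and> s i > s j \<and>
                          odd_letter (fs ! s i) \<and> odd_letter (fs ! s j)}"

text \<open>
  On a product of basis vectors \<open>v\<close> the projection yields the average of the products
  \<open>koszul s v \<cdot> permute_list s v\<close>; hence the coefficient at \<open>w\<close> collects the words
  \<open>v\<close> with \<open>permute_list s v = w\<close>.
\<close>

definition graded_proj :: "('a \<Rightarrow> bool) \<Rightarrow> ('a list \<Rightarrow> complex) \<Rightarrow> 'a list \<Rightarrow> complex" where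
  "graded_proj odd_letter T w =
     (\<Sum>s | s permutes {..<length w}.
        let v = permute_list (inv s) w in koszul odd_letter s v * T v) / fact (length w)"

definition graded_mult ::
    "('a \<Rightarrow> bool) \<Rightarrow> ('a list \<Rightarrow> complex) \<Rightarrow> ('a list \<Rightarrow> complex) \<Rightarrow> 'a list \<Rightarrow> complex" where
  "graded_mult odd_letter F G w =
     (\<Sum>p\<le>length w. complex_of_real (sqrt (fact (length w) / (fact p * fact (length w - p)))) *
        graded_proj odd_letter (\<lambda>v. F (take p v) * G (drop p v)) w)"

text \<open>The coefficient function of the unit (vacuum): the empty word with coefficient 1.\<close>

definition unit_tensor :: "'a list \<Rightarrow> complex" where
  "unit_tensor w = (if w = [] then 1 else 0)"


section \<open>The algebra of finite Fock vectors\<close>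

definition alg_tensor_power :: "nat \<Rightarrow> ('h::graded_hilbert_space list \<Rightarrow> complex) set" where
  "alg_tensor_power n =
     {(\<lambda>w. \<Sum>i<m. c i * tensor (fs i) w) | (m :: nat) c fs. \<forall>i<m. length (fs i) = n}"

definition sym_power :: "nat \<Rightarrow> ('h::graded_hilbert_space list \<Rightarrow> complex) set" where
  "sym_power n = graded_proj odd_vec ` alg_tensor_power n"

definition S_fin :: "('h::graded_hilbert_space list \<Rightarrow> complex) set" where
  "S_fin = {(\<lambda>w. \<Sum>n<N. F n w) | N F. \<forall>n<N. F n \<in> sym_power n}"

abbreviation fock_mult (infixl "\<odot>" 70) where
  "fock_mult \<equiv> graded_mult odd_vec"

definition fock_inner ::
    "('h::graded_hilbert_space list \<Rightarrow> complex) \<Rightarrow> ('h list \<Rightarrow> complex) \<Rightarrow> complex" where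
  "fock_inner F G = (\<Sum>\<^sub>\<infinity>w\<in>lists hbasis. cnj (F w) * G w)"

text \<open>
  The isometric antilinear involution that extends \<open>star\<close>, with
  \<open>fock_star (F \<odot> G) = fock_star F \<odot> fock_star G\<close>. This deviates from the convention
  \<open>(F \<odot> G)* = G* \<odot> F*\<close>, which would put \<open>rev (map star w)\<close> here. With the latter, the pairing
  changes sign according to the number of odd factors and, for odd vectors \<open>f\<close>, \<open>g\<close>,
  \<open>phi (f \<odot> g) \<zeta> = phi g \<zeta> \<cdot> phi f \<zeta> = - phi f \<zeta> \<cdot> phi g \<zeta>\<close>, so that \<open>phi\<close> would be an
  antihomomorphism, not a homomorphism.
\<close>

definition fock_star :: "('h::graded_hilbert_space list \<Rightarrow> complex) \<Rightarrow> 'h list \<Rightarrow> complex" where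
  "fock_star F w = cnj (F (map star w))"

definition fock_pairing ::
    "('h::graded_hilbert_space list \<Rightarrow> complex) \<Rightarrow> ('h list \<Rightarrow> complex) \<Rightarrow> complex" where
  "fock_pairing F G = fock_inner (fock_star F) G"


type_synonym 'l grass = "'l list \<Rightarrow> complex"

type_synonym ('l, 'h) ext = "'l list \<times> 'h list \<Rightarrow> complex"


section \<open>The Grassmann algebra and the Grassmann extension of the Fock space\<close>

definition gbasis :: "'l::complex_hilbert_space set" where
  "gbasis = onb UNIV"

definition weighted_norm :: "('i \<Rightarrow> real) \<Rightarrow> ('i \<Rightarrow> complex) \<Rightarrow> real" where
  "weighted_norm wt x = sqrt (\<Sum>\<^sub>\<infinity>i. wt i * (cmod (x i))\<^sup>2)"

definition weighted_l2 :: "('i \<Rightarrow> real) \<Rightarrow> ('i \<Rightarrow> complex) set" where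
  "weighted_l2 wt = {x. (\<lambda>i. wt i * (cmod (x i))\<^sup>2) summable_on UNIV}"

text \<open>
  With all letters odd, \<open>koszul\<close> is the sign of the permutation and \<open>graded_proj\<close> the
  antisymmetrizing projection.
\<close>

abbreviation alt_proj :: "('l list \<Rightarrow> complex) \<Rightarrow> 'l list \<Rightarrow> complex" where
  "alt_proj \<equiv> graded_proj (\<lambda>_. True)"

abbreviation grassmann_mult ::
    "('l list \<Rightarrow> complex) \<Rightarrow> ('l list \<Rightarrow> complex) \<Rightarrow> 'l list \<Rightarrow> complex" (infixl "\<cdot>\<^sub>\<Lambda>" 70) where
  "grassmann_mult \<equiv> graded_mult (\<lambda>_. True)"

definition grassmann_weight :: "'l list \<Rightarrow> real" where
  "grassmann_weight l = 1 / (fact (length l))\<^sup>2"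

definition grassmann :: "('l::complex_hilbert_space list \<Rightarrow> complex) set" where
  "grassmann = {x \<in> weighted_l2 grassmann_weight.
     (\<forall>l. l \<notin> lists gbasis \<longrightarrow> x l = 0) \<and> alt_proj x = x}"

definition grassmann_norm :: "('l list \<Rightarrow> complex) \<Rightarrow> real" where
  "grassmann_norm = weighted_norm grassmann_weight"

text \<open>
  Elements of \<open>\<Lambda> \<otimes> S(H)\<close> are coefficient functions on pairs of words; the Hilbert tensor product
  carries the product weight.
\<close>

definition ext_weight :: "'l list \<times> 'h list \<Rightarrow> real" where
  "ext_weight = (\<lambda>(l, h). grassmann_weight l)"

definition ext_fock ::
    "('l::complex_hilbert_space list \<times> 'h::graded_hilbert_space list \<Rightarrow> complex) set" where
  "ext_fock = {A \<in> weighted_l2 ext_weight.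
     (\<forall>l h. l \<notin> lists gbasis \<or> h \<notin> lists hbasis \<longrightarrow> A (l, h) = 0) \<and>
     (\<forall>h. alt_proj (\<lambda>l. A (l, h)) = (\<lambda>l. A (l, h))) \<and>
     (\<forall>l. graded_proj odd_vec (\<lambda>h. A (l, h)) = (\<lambda>h. A (l, h)))}"

definition ext_norm :: "('l list \<times> 'h list \<Rightarrow> complex) \<Rightarrow> real" where
  "ext_norm = weighted_norm ext_weight"

definition ext_tensor ::
    "('l list \<Rightarrow> complex) \<Rightarrow> ('h list \<Rightarrow> complex) \<Rightarrow> 'l list \<times> 'h list \<Rightarrow> complex" where
  "ext_tensor x F = (\<lambda>(l, h). x l * F h)"

definition ext_mult ::
    "('l list \<times> 'h::graded_hilbert_space list \<Rightarrow> complex) \<Rightarrow> ('l list \<times> 'h list \<Rightarrow> complex)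
       \<Rightarrow> 'l list \<times> 'h list \<Rightarrow> complex" where
  "ext_mult A B = (\<lambda>(l, h).
     \<Sum>p\<le>length l. complex_of_real (sqrt (fact (length l) / (fact p * fact (length l - p)))) *
       alt_proj (\<lambda>u.
         \<Sum>r\<le>length h. complex_of_real (sqrt (fact (length h) / (fact r * fact (length h - r)))) *
           graded_proj odd_vec (\<lambda>v. A (take p u, take r v) * B (drop p u, drop r v)) h) l)"

definition ext_pairing ::
    "('l list \<times> 'h::graded_hilbert_space list \<Rightarrow> complex) \<Rightarrow> ('l list \<times> 'h list \<Rightarrow> complex)
       \<Rightarrow> 'l list \<Rightarrow> complex" where
  "ext_pairing A B l =
     (\<Sum>p\<le>length l. complex_of_real (sqrt (fact (length l) / (fact p * fact (length l - p)))) *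
       alt_proj (\<lambda>u. fock_pairing (\<lambda>v. A (take p u, v)) (\<lambda>v. B (drop p u, v))) l)"


section \<open>The operations on product vectors\<close>

lemma is_onb_onb:
  assumes "\<And>c x. x \<in> S \<Longrightarrow> c *\<^sub>C x \<in> (S :: 'a::complex_hilbert_space set)"
  shows "is_onb S (onb S)"
  unfolding onb_def using someI_ex[OF ex_onb[OF assms]] by simp

lemma hbasis_graded_part:
  assumes "b \<in> hbasis"
  obtains k where "b \<in> graded_part k"
proof -
  obtain k where k: "b \<in> onb (creation k) \<or> b \<in> star ` onb (creation k)"
    using assms unfolding hbasis_def by blast
  have sub: "onb (creation k) \<subseteq> creation k"
    using is_onb_onb[OF creation_scaleC, of k] unfolding is_onb_def by (rule conjunct1)
  have "star 0 = (0 :: 'a)" using star_add[of "0 :: 'a" 0] by simp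
  then have zero: "x + star 0 = x" "0 + star x = star x" for x :: 'a by simp_all
  from k have "b \<in> graded_part k"
  proof
    assume "b \<in> onb (creation k)"
    then have "b \<in> creation k" using sub by (rule rev_subsetD)
    then show ?thesis
      unfolding graded_part_def using zero(1)[of b] creation_zero[of k] by (metis (mono_tags, lifting) mem_Collect_eq)
  next
    assume "b \<in> star ` onb (creation k)"
    then obtain x where "b = star x" "x \<in> creation k" using sub by blast
    then show ?thesis
      unfolding graded_part_def using zero(2)[of x] creation_zero[of k] by (metis (mono_tags, lifting) mem_Collect_eq)
  qed
  then show ?thesis by (rule that)
qed

lemma star_hbasis_iff [simp]: "star b \<in> hbasis \<longleftrightarrow> b \<in> hbasis"
proof -
  have "star b \<in> hbasis" if "b \<in> hbasis" for b :: 'a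
    using that unfolding hbasis_def
    by (elim UN_E UnE imageE) (auto simp only: star_star intro: imageI)
  then show ?thesis using star_star[of b] by metis
qed

lemma cinner_add_left: "cinner (x + y) z = cinner x z + cinner y z"
  unfolding cinner_commute[of _ z] by (simp add: cinner_add_right)

lemma graded_part_orthogonal:
  assumes "f \<in> graded_part False" "g \<in> graded_part True"
  shows "cinner f g = 0" "cinner g f = 0"
proof -
  obtain a b c d where *: "a \<in> creation False" "b \<in> creation False" "c \<in> creation True"
    "d \<in> creation True" "f = a + star b" "g = c + star d"
    using assms unfolding graded_part_def by blast
  have "cinner (star b) c = 0"
    using creation_star_orthogonal[OF *(3,2)] cinner_commute[of "star b" c] by simp
  moreover have "cinner (star b) (star d) = 0"
    using creation_orthogonal[OF *(2,4)] cinner_commute[of d b] by (simp add: star_cinner)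
  ultimately show "cinner f g = 0"
    using creation_orthogonal[OF *(1,3)] creation_star_orthogonal[OF *(1,4)] *(5,6)
    by (simp add: cinner_add_left cinner_add_right)
  then show "cinner g f = 0" using cinner_commute[of g f] by simp
qed

lemma odd_vec_eq:
  assumes "b \<in> hbasis" "homogeneous f" "cinner b f \<noteq> 0"
  shows "odd_vec b \<longleftrightarrow> odd_vec f"
proof -
  obtain k where k: "b \<in> graded_part k" using assms(1) by (rule hbasis_graded_part)
  obtain m where m: "f \<in> graded_part m" using assms(2) unfolding homogeneous_def by blast
  have "k = m"
    using k m assms(3) graded_part_orthogonal[of b f] graded_part_orthogonal[of f b]
    by (cases k; cases m) auto
  then show ?thesis
    using k m assms(3) graded_part_orthogonal[of b f] graded_part_orthogonal[of f b]
    unfolding odd_vec_def by (cases m) auto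
qed

theorem graded_proj_tensor:
  assumes hom: "\<forall>f\<in>set fs. homogeneous f"
  shows "graded_proj odd_vec (tensor fs) w =
    (\<Sum>s | s permutes {..<length fs}. koszul odd_vec s fs * tensor (permute_list s fs) w)
      / fact (length fs)"
proof (cases "length w = length fs")
  case False
  then show ?thesis by (simp add: graded_proj_def tensor_def Let_def)
next
  case True
  have "koszul odd_vec s (permute_list (inv s) w) * tensor fs (permute_list (inv s) w) =
      koszul odd_vec s fs * tensor (permute_list s fs) w"
    if s: "s permutes {..<length w}" for s
  proof -
    let ?v = "permute_list (inv s) w" and ?n = "length w"
    have ip: "inv s permutes {..<?n}" using s by (rule permutes_inv)
    have v: "?v ! i = w ! inv s i" if "i < ?n" for i
      using permute_list_nth[OF ip that] .
    have "(\<Prod>i<?n. cinner (?v ! i) (fs ! i)) = (\<Prod>i<?n. cinner (?v ! s i) (fs ! s i))"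
      using s by (rule prod.permute[unfolded comp_def])
    also have "\<dots> = (\<Prod>i<?n. cinner (w ! i) (permute_list s fs ! i))"
    proof (rule prod.cong)
      fix i assume "i \<in> {..<?n}"
      moreover from this have "s i < ?n" using permutes_in_image[OF s] by auto
      ultimately show "cinner (?v ! s i) (fs ! s i) = cinner (w ! i) (permute_list s fs ! i)"
        using s True by (simp add: v permutes_inverses permute_list_nth)
    qed simp
    finally have eq: "tensor fs ?v = tensor (permute_list s fs) w"
      using ip True by (simp add: tensor_def in_lists_conv_set)
    have "koszul odd_vec s ?v = koszul odd_vec s fs" if nz: "tensor fs ?v \<noteq> 0"
    proof -
      from nz have prodnz: "?v \<in> lists hbasis" "(\<Prod>i<length fs. cinner (?v ! i) (fs ! i)) \<noteq> 0"
        by (auto simp: tensor_def split: if_splits)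
      have "odd_vec (?v ! i) \<longleftrightarrow> odd_vec (fs ! i)" if i: "i < ?n" for i
      proof (rule odd_vec_eq)
        show "?v ! i \<in> hbasis" using prodnz(1) i by (simp add: in_lists_conv_set)
        show "homogeneous (fs ! i)" using hom i True by simp
        show "cinner (?v ! i) (fs ! i) \<noteq> 0" using prodnz(2) i True by simp
      qed
      then have "odd_vec (?v ! s i) \<longleftrightarrow> odd_vec (fs ! s i)" if "i < ?n" for i
        using permutes_in_image[OF s, of i] that by simp
      then have "(i < j \<and> j < ?n \<and> s i > s j \<and> odd_vec (?v ! s i) \<and> odd_vec (?v ! s j)) \<longleftrightarrow>
          (i < j \<and> j < ?n \<and> s i > s j \<and> odd_vec (fs ! s i) \<and> odd_vec (fs ! s j))" for i j
        using less_trans[of i j ?n] by blast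
      then have "{(i, j). i < j \<and> j < ?n \<and> s i > s j \<and> odd_vec (?v ! s i) \<and> odd_vec (?v ! s j)} =
          {(i, j). i < j \<and> j < ?n \<and> s i > s j \<and> odd_vec (fs ! s i) \<and> odd_vec (fs ! s j)}"
        by (simp only:)
      then show ?thesis
        unfolding koszul_def length_permute_list True[symmetric] by (rule arg_cong)
    qed
    then show ?thesis unfolding eq[symmetric] by (cases "tensor fs ?v = 0") (simp, simp only: simp_thms)
  qed
  then have "(\<Sum>s | s permutes {..<length w}.
      koszul odd_vec s (permute_list (inv s) w) * tensor fs (permute_list (inv s) w)) =
    (\<Sum>s | s permutes {..<length w}. koszul odd_vec s fs * tensor (permute_list s fs) w)"
    by (intro sum.cong refl) blast
  then show ?thesis unfolding graded_proj_def Let_def True[symmetric] by (rule arg_cong)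
qed

lemma fock_star_tensor: "fock_star (tensor fs) = tensor (map star fs)"
proof
  fix w :: "'a list"
  have "cnj (cinner (star x) y) = cinner x (star y)" for x y :: 'a
    using star_cinner[of "star x" y] cinner_commute[of y "star x"] by (simp add: star_star)
  then show "fock_star (tensor fs) w = tensor (map star fs) w"
    by (auto simp: fock_star_def tensor_def in_lists_conv_set)
qed

lemma graded_proj_cmult:
  "graded_proj \<pi> (\<lambda>v. c * T v) w = c * graded_proj \<pi> T w"
  "graded_proj \<pi> (\<lambda>v. T v * c) w = graded_proj \<pi> T w * c"
  by (simp_all add: graded_proj_def Let_def sum_distrib_left sum_distrib_right mult_ac)

lemma ext_mult_ext_tensor:
  "ext_mult (ext_tensor x F) (ext_tensor y G) = ext_tensor (x \<cdot>\<^sub>\<Lambda> y) (F \<odot> G)"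
proof (rule ext, clarify)
  fix l :: "'a list" and h :: "'b list"
  let ?c = "\<lambda>n p. complex_of_real (sqrt (fact n / (fact p * fact (n - p))))"
  have inner: "(\<Sum>r\<le>length h. ?c (length h) r * graded_proj odd_vec
        (\<lambda>v. x (take p u) * F (take r v) * (y (drop p u) * G (drop r v))) h) =
      x (take p u) * y (drop p u) * (F \<odot> G) h" for p u
  proof -
    have "graded_proj odd_vec (\<lambda>v. x (take p u) * F (take r v) * (y (drop p u) * G (drop r v))) h =
        x (take p u) * y (drop p u) * graded_proj odd_vec (\<lambda>v. F (take r v) * G (drop r v)) h" for r
      by (subst graded_proj_cmult(1)[symmetric]) (simp only: mult_ac)
    then show ?thesis
      unfolding graded_mult_def sum_distrib_left by (intro sum.cong refl) (simp only: mult_ac)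
  qed
  show "ext_mult (ext_tensor x F) (ext_tensor y G) (l, h) = ext_tensor (x \<cdot>\<^sub>\<Lambda> y) (F \<odot> G) (l, h)"
    unfolding ext_mult_def ext_tensor_def prod.case inner graded_proj_cmult(2)
    unfolding graded_mult_def[of "\<lambda>_. True"] by (simp only: sum_distrib_right mult.assoc)
qed

lemma ext_pairing_ext_tensor:
  "ext_pairing (ext_tensor x F) (ext_tensor y G) l = (x \<cdot>\<^sub>\<Lambda> y) l * fock_pairing F G"
proof -
  have *: "fock_pairing (\<lambda>v. x (take p u) * F v) (\<lambda>v. y (drop p u) * G v) =
      x (take p u) * y (drop p u) * fock_pairing F G" for p u
    unfolding fock_pairing_def fock_inner_def fock_star_def
    by (subst infsum_cmult_right'[symmetric]) (simp add: mult_ac)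
  show ?thesis
    unfolding ext_pairing_def ext_tensor_def prod.case * graded_proj_cmult(2)
    by (simp only: graded_mult_def sum_distrib_right mult.assoc)
qed


section \<open>Superspace and entire analytic functions\<close>

definition superspace ::
    "('l::complex_hilbert_space list \<times> 'h::graded_hilbert_space list \<Rightarrow> complex) set" where
  "superspace = {\<zeta> \<in> ext_fock. \<forall>l h. \<zeta> (l, h) \<noteq> 0 \<longrightarrow>
     length h = 1 \<and> (odd (length l) \<longleftrightarrow> odd_vec (hd h))}"

primrec ext_power ::
    "('l list \<times> 'h::graded_hilbert_space list \<Rightarrow> complex) \<Rightarrow> nat
       \<Rightarrow> 'l list \<times> 'h list \<Rightarrow> complex" where
  "ext_power \<zeta> 0 = ext_tensor unit_tensor unit_tensor"
| "ext_power \<zeta> (Suc p) = ext_mult \<zeta> (ext_power \<zeta> p)"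

text \<open>
  The norm limit of the exponential series is computed coefficientwise; for \<open>\<zeta>\<close> in the superspace
  only the term with \<open>p = length h\<close> contributes to the coefficient at \<open>(l, h)\<close>.
\<close>

definition ext_exp ::
    "('l list \<times> 'h::graded_hilbert_space list \<Rightarrow> complex) \<Rightarrow> 'l list \<times> 'h list \<Rightarrow> complex" where
  "ext_exp \<zeta> = (\<lambda>(l, h). \<Sum>p. ext_power \<zeta> p (l, h) / fact p)"

definition bounded_multilinear ::
    "('i \<Rightarrow> complex) set \<Rightarrow> (('i \<Rightarrow> complex) \<Rightarrow> real) \<Rightarrow>
     ('j \<Rightarrow> complex) set \<Rightarrow> (('j \<Rightarrow> complex) \<Rightarrow> real) \<Rightarrow>
     nat \<Rightarrow> (('i \<Rightarrow> complex) list \<Rightarrow> 'j \<Rightarrow> complex) \<Rightarrow> bool" where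
  "bounded_multilinear X nX Y nY n M \<longleftrightarrow>
     (\<forall>xs. set xs \<subseteq> X \<and> length xs = n \<longrightarrow> M xs \<in> Y) \<and>
     (\<forall>xs i x y a b. set xs \<subseteq> X \<and> length xs = n \<and> i < n \<and> x \<in> X \<and> y \<in> X \<longrightarrow>
        M (xs[i := (\<lambda>k. a * x k + b * y k)]) = (\<lambda>j. a * M (xs[i := x]) j + b * M (xs[i := y]) j)) \<and>
     (\<exists>C. \<forall>xs. set xs \<subseteq> X \<and> length xs = n \<longrightarrow> nY (M xs) \<le> C * prod_list (map nX xs))"

text \<open>
  Analytic at every point: near \<open>x\<close> the function is the uniform limit of a series of bounded
  homogeneous polynomials.
\<close>

definition entire_analytic ::
    "('i \<Rightarrow> complex) set \<Rightarrow> (('i \<Rightarrow> complex) \<Rightarrow> real) \<Rightarrow>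
     ('j \<Rightarrow> complex) set \<Rightarrow> (('j \<Rightarrow> complex) \<Rightarrow> real) \<Rightarrow>
     (('i \<Rightarrow> complex) \<Rightarrow> 'j \<Rightarrow> complex) set" where
  "entire_analytic X nX Y nY = {f.
     (\<forall>x\<in>X. f x \<in> Y) \<and>
     (\<forall>x\<in>X. \<exists>r>0. \<exists>M. (\<forall>n. bounded_multilinear X nX Y nY n (M n)) \<and>
        (\<forall>e>0. \<exists>N. \<forall>n\<ge>N. \<forall>h\<in>X. nX h < r \<longrightarrow>
           nY (\<lambda>j. f (\<lambda>i. x i + h i) j - (\<Sum>k<n. M k (replicate k h) j)) < e))}"

definition superspace_functions ::
    "(('l::complex_hilbert_space list \<times> 'h::graded_hilbert_space list \<Rightarrow> complex)
       \<Rightarrow> 'l list \<Rightarrow> complex) set" where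
  "superspace_functions = entire_analytic superspace ext_norm grassmann grassmann_norm"

definition phi ::
    "('h::graded_hilbert_space list \<Rightarrow> complex)
       \<Rightarrow> ('l::complex_hilbert_space list \<times> 'h list \<Rightarrow> complex) \<Rightarrow> 'l list \<Rightarrow> complex" where
  "phi F \<zeta> = ext_pairing (ext_exp \<zeta>) (ext_tensor unit_tensor F)"

end

theory Submission
  imports Defs
begin

text \<open>
  Let \<open>\<zeta>\<^sub>a\<close> be the coefficient of a superspace point \<open>\<zeta>\<close> at the basis vector \<open>a*\<close>. These elements of the
  Grassmann algebra have the parity of \<open>a\<close>, so a product \<open>\<zeta>\<^sub>w = \<zeta>\<^sub>a \<cdot> \<zeta>\<^sub>b \<cdot> \<dots>\<close> along a word \<open>w = ab\<dots>\<close>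
  acquires exactly the Koszul sign when the letters of \<open>w\<close> are permuted. Therefore the symmetrization
  in the powers of \<open>\<zeta>\<close> acts trivially, and \<open>\<phi>\<^sub>F(\<zeta>) = \<Sum>\<^sub>w \<zeta>\<^sub>w F(w) / \<surd>|w|!\<close>. As \<open>\<zeta>\<^sub>u\<^sub>v = \<zeta>\<^sub>u \<cdot> \<zeta>\<^sub>v\<close> and
  the graded projection can be moved from \<open>F \<otimes> G\<close> to the invariant factor \<open>\<zeta>\<^sub>w\<close>, the map is
  multiplicative. The rearrangements are justified, and the polarized polynomials are shown to be
  bounded, by \<open>\<parallel>\<lambda>\<mu>\<parallel>\<^sup>2 \<le> 3 \<parallel>\<lambda>\<parallel>\<^sup>2 \<parallel>\<mu>\<parallel>\<^sup>2\<close> and the Cauchy-Schwarz inequality.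

  Associativity and graded commutativity of the Grassmann product are read off from a recursive
  signed shuffle product, to which it becomes equal after rescaling the degree \<open>n\<close> part by \<open>\<surd>n!\<close>.
\<close>

subsection \<open>Koszul signs and graded symmetry\<close>

text \<open>The expansion over words is controlled only degree by degree: for a product of n
  coordinates the squared norm is bounded by the n-th power of 3 times the squared norm of \<zeta>,
  which need not be summable over n. Rearrangements are therefore made at a fixed word length, and
  finitely many lengths are added; this is where the finiteness of F and G enters.

  The Grassmann product averages over all permutations of a word, and comparing two nested averages
  would require counting cosets. Read letter by letter, the shuffle product obeys a graded Leibniz
  rule instead, and each algebraic law becomes an induction on the word. Pascal's rule connects the
  two products.

  As F has bounded degree, \<open>phi F\<close> is a polynomial, and analyticity at a point x
  amounts to re-expanding it in powers of h at x + h: the Taylor series breaks off.\<close>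

lemma prod_pairs_permute:
  fixes h :: "nat \<Rightarrow> nat \<Rightarrow> complex"
  assumes t: "t permutes {..<n}" and sym: "\<And>i j. h i j = h j i"
  shows "(\<Prod>(i, j)\<in>{(i, j). i < j \<and> j < n}. h (t i) (t j)) = (\<Prod>(i, j)\<in>{(i, j). i < j \<and> j < n}. h i j)"
proof -
  have tlt: "t i < n \<longleftrightarrow> i < n" "inv t i < n \<longleftrightarrow> i < n" for i
    using permutes_in_image[OF t, of i] permutes_in_image[OF permutes_inv[OF t], of i] by auto
  have tinj: "t i = t j \<longleftrightarrow> i = j" "inv t i = inv t j \<longleftrightarrow> i = j" for i j
    using permutes_inj[OF t] permutes_inj[OF permutes_inv[OF t]] by (auto dest: injD)
  \<comment> \<open>A symmetric \<open>h\<close> is a function of the unordered pair, and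
    \<open>t\<close> permutes these; \<open>min\<close> and \<open>max\<close> pick the ordered
    representative.\<close>
  show ?thesis
    by (rule prod.reindex_bij_witness[of _
          "\<lambda>(i, j). (min (inv t i) (inv t j), max (inv t i) (inv t j))"
          "\<lambda>(i, j). (min (t i) (t j), max (t i) (t j))"])
      (auto simp: tlt tinj permutes_inverses[OF t] min_def max_def sym not_le
        intro: less_le_trans le_neq_trans split: if_splits)
qed

text \<open>Writing the sign as a product over all pairs, with a factor 1 where nothing is inverted,
  lets signs be compared factor by factor.\<close>

lemma koszul_prod:
  "koszul \<pi> s v = (\<Prod>(i, j)\<in>{(i, j). i < j \<and> j < length v}.
     if s i > s j \<and> \<pi> (v ! s i) \<and> \<pi> (v ! s j) then -1 else 1)"
proof -
  let ?P = "{(i, j). i < j \<and> j < length v}"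
  have fin: "finite ?P"
    by (rule finite_subset[of _ "{..<length v} \<times> {..<length v}"]) auto
  let ?Q = "\<lambda>p. s (fst p) > s (snd p) \<and> \<pi> (v ! s (fst p)) \<and> \<pi> (v ! s (snd p))"
  have "koszul \<pi> s v = (-1) ^ card (?P \<inter> Collect ?Q)"
    unfolding koszul_def by (rule arg_cong[where f = "\<lambda>A. (-1) ^ card A"]) auto
  also have "\<dots> = (\<Prod>p\<in>?P. if ?Q p then -1 else 1)"
    using fin by (simp add: prod.If_cases)
  finally show ?thesis by (simp add: case_prod_unfold)
qed

text \<open>The cocycle rule: a pair is inverted by \<open>s \<circ> t\<close> exactly when one but
  not both of the following holds: \<open>t\<close> inverts it, or \<open>s\<close> inverts its
  image under \<open>t\<close>. In all three signs the parities refer to the same two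
  letters.\<close>

lemma koszul_compose:
  assumes s: "s permutes {..<length v}" and t: "t permutes {..<length v}"
  shows "koszul \<pi> (s \<circ> t) v = koszul \<pi> t (permute_list s v) * koszul \<pi> s v"
proof -
  let ?n = "length v" and ?o = "\<lambda>i. \<pi> (v ! s i)"
  let ?P = "{(i, j). i < j \<and> j < ?n}"
  \<comment> \<open>The sign that \<open>s\<close> contributes on the unordered pair: the
    equivalence expresses an inversion without presupposing \<open>i < j\<close>, so that the pairs
    can be reindexed by \<open>t\<close>.\<close>
  define h :: "nat \<Rightarrow> nat \<Rightarrow> complex" where
    "h i j = (if (i < j \<longleftrightarrow> s j < s i) \<and> i \<noteq> j \<and> ?o i \<and> ?o j then -1 else 1)" for i j
  have tlt: "t i < ?n \<longleftrightarrow> i < ?n" for i using permutes_in_image[OF t, of i] by auto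
  have sinj: "s i = s j \<longleftrightarrow> i = j" for i j using permutes_inj[OF s] by (auto dest: injD)
  have tinj: "t i = t j \<longleftrightarrow> i = j" for i j using permutes_inj[OF t] by (auto dest: injD)
  have sym: "h i j = h j i" for i j
    using sinj[of i j] by (auto simp: h_def)
  have "koszul \<pi> s v = (\<Prod>(i, j)\<in>?P. h i j)"
    unfolding koszul_prod by (rule prod.cong) (auto simp: h_def)
  also have "\<dots> = (\<Prod>(i, j)\<in>?P. h (t i) (t j))"
    using prod_pairs_permute[OF t, of h] sym by metis
  finally have 1: "koszul \<pi> s v = (\<Prod>(i, j)\<in>?P. h (t i) (t j))" .
  have "koszul \<pi> t (permute_list s v) =
      (\<Prod>(i, j)\<in>?P. if t i > t j \<and> ?o (t i) \<and> ?o (t j) then -1 else 1)"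
    unfolding koszul_prod length_permute_list
    by (rule prod.cong) (auto simp: permute_list_nth[OF s] tlt split: if_splits)
  then have "koszul \<pi> t (permute_list s v) * koszul \<pi> s v =
      (\<Prod>p\<in>?P. (case p of (i, j) \<Rightarrow> if t i > t j \<and> ?o (t i) \<and> ?o (t j) then -1 else 1) *
        (case p of (i, j) \<Rightarrow> h (t i) (t j)))"
    unfolding 1 by (simp add: prod.distrib)
  also have "\<dots> = koszul \<pi> (s \<circ> t) v"
    unfolding koszul_prod
  proof (rule prod.cong, goal_cases)
    case (2 p)
    then obtain i j where p: "p = (i, j)" "i < j" by auto
    then have ne: "t i \<noteq> t j" "s (t i) \<noteq> s (t j)" using tinj sinj by auto
    show ?case using ne unfolding p h_def by auto
  qed simp
  finally show ?thesis by simp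
qed

lemma koszul_id [simp]: "koszul \<pi> id v = 1"
proof -
  have *: "{(i, j). i < j \<and> j < length v \<and> id i > id j \<and> \<pi> (v ! id i) \<and> \<pi> (v ! id j)} = {}" by auto
  show ?thesis unfolding koszul_def * by simp
qed

lemma koszul_square: "koszul \<pi> s v * koszul \<pi> s v = 1"
  by (simp add: koszul_def flip: power_mult_distrib)

lemma cmod_koszul [simp]: "cmod (koszul \<pi> s v) = 1"
  by (simp add: koszul_def norm_power)

section \<open>Adjacent transpositions and graded symmetric functions\<close>

definition swap_sign :: "('a \<Rightarrow> bool) \<Rightarrow> 'a \<Rightarrow> 'a \<Rightarrow> complex" where
  "swap_sign \<pi> a b = (if \<pi> a \<and> \<pi> b then -1 else 1)"

lemma transpose_Suc_permutes: "Suc i < n \<Longrightarrow> Transposition.transpose i (Suc i) permutes {..<n}"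
  by (rule permutes_swap_id) auto

lemma koszul_adjacent:
  assumes "Suc i < length v"
  shows "koszul \<pi> (Transposition.transpose i (Suc i)) v = swap_sign \<pi> (v ! i) (v ! Suc i)"
proof -
  let ?t = "Transposition.transpose i (Suc i)"
  have inv: "j < k \<and> ?t k < ?t j \<longleftrightarrow> j = i \<and> k = Suc i" for j k
    by (auto simp: Transposition.transpose_def split: if_splits)
  then have "{(j, k). j < k \<and> k < length v \<and> ?t j > ?t k \<and> \<pi> (v ! ?t j) \<and> \<pi> (v ! ?t k)} =
      (if \<pi> (v ! i) \<and> \<pi> (v ! Suc i) then {(i, Suc i)} else {})"
    using assms by (auto; metis transpose_apply_first transpose_apply_second)
  then show ?thesis unfolding koszul_def by (simp add: swap_sign_def)
qed

lemma permute_list_adjacent: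
  assumes "Suc i < length v"
  shows "permute_list (Transposition.transpose i (Suc i)) v = take i v @ [v ! Suc i, v ! i] @ drop (Suc (Suc i)) v"
  using assms
  by (intro nth_equalityI)
    (auto simp: permute_list_nth[OF transpose_Suc_permutes] nth_append Transposition.transpose_def nth_Cons
      split: nat.split intro: arg_cong[where f = "nth v"])

lemma split_adjacent:
  assumes "Suc i < length v"
  shows "v = take i v @ [v ! i, v ! Suc i] @ drop (Suc (Suc i)) v"
  using assms by (simp add: Cons_nth_drop_Suc)

text \<open>Only exchanges of neighbours are required, since this can be checked along a recursion
  on words. The rule for arbitrary permutations follows in
  \<open>graded_symmetric_permute\<close>.\<close>

definition graded_symmetric :: "('a \<Rightarrow> bool) \<Rightarrow> ('a list \<Rightarrow> complex) \<Rightarrow> bool" where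
  "graded_symmetric \<pi> x \<longleftrightarrow> (\<forall>u a b v. x (u @ [b, a] @ v) = swap_sign \<pi> a b * x (u @ [a, b] @ v))"

lemma graded_symmetricD:
  "graded_symmetric \<pi> x \<Longrightarrow> x (u @ [b, a] @ v) = swap_sign \<pi> a b * x (u @ [a, b] @ v)"
  unfolding graded_symmetric_def by blast

text \<open>Permutations obeying the sign rule are closed under composition by
  \<open>koszul_compose\<close>, so that it suffices to treat adjacent transpositions, which
  generate all others.\<close>

lemma graded_symmetric_permute:
  assumes x: "graded_symmetric \<pi> x" and s: "s permutes {..<length v}"
  shows "x (permute_list s v) = koszul \<pi> s v * x v"
proof -
  define n where "n = length v"
  \<comment> \<open>All words of length \<open>n\<close> are quantified over because, in a
    composite, the second permutation acts on an already permuted word.\<close>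
  define Q where "Q s \<longleftrightarrow> s permutes {..<n} \<and>
    (\<forall>v. length v = n \<longrightarrow> x (permute_list s v) = koszul \<pi> s v * x v)" for s
  have Qcomp: "Q (s \<circ> t)" if "Q s" "Q t" for s t
    using that unfolding Q_def
    by (auto simp: permutes_compose koszul_compose permute_list_compose mult.assoc)
  have Qid: "Q id"
    unfolding Q_def by (simp add: permutes_id)
  have Qadj: "Q (Transposition.transpose i (Suc i))" if "Suc i < n" for i
    unfolding Q_def
  proof (intro conjI allI impI)
    fix v :: "'a list" assume "length v = n"
    with that have i: "Suc i < length v" by simp
    show "x (permute_list (Transposition.transpose i (Suc i)) v) =
        koszul \<pi> (Transposition.transpose i (Suc i)) v * x v"
      using graded_symmetricD[OF x, of "take i v" "v ! Suc i" "v ! i" "drop (Suc (Suc i)) v"]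
      unfolding koszul_adjacent[OF i] permute_list_adjacent[OF i] split_adjacent[OF i, symmetric] .
  qed (rule transpose_Suc_permutes[OF that])
  have Qtr: "Q (Transposition.transpose i (Suc (i + k)))" if "Suc (i + k) < n" for i k
    using that
  proof (induction k)
    case 0
    then show ?case using Qadj by simp
  next
    case (Suc k)
    let ?a = "Transposition.transpose (Suc (i + k)) (Suc (Suc (i + k)))"
    \<comment> \<open>Conjugation with an adjacent transposition increases the distance of the
      exchanged places by one.\<close>
    have "Transposition.transpose i (Suc (Suc (i + k))) =
        ?a \<circ> (Transposition.transpose i (Suc (i + k)) \<circ> ?a)"
      by (auto simp: fun_eq_iff Transposition.transpose_def)
    moreover have "Q \<dots>"
      using Suc by (intro Qcomp Qadj) auto
    ultimately show ?case by (simp only: add_Suc_right)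
  qed
  have Qtr': "Q (Transposition.transpose a b)" if "a < n" "b < n" "a \<noteq> b" for a b
  proof (cases "a < b")
    case True
    then show ?thesis using Qtr[of a "b - a - 1"] that by simp
  next
    case False
    then have "b < a" using that by simp
    then show ?thesis using Qtr[of b "a - b - 1"] that by (simp add: transpose_commute)
  qed
  have "Q s"
    using s[folded n_def]
  proof (rule permutes_induct)
    show "Q (Transposition.transpose a b \<circ> p)"
      if "a \<in> {..<n}" "b \<in> {..<n}" "a \<noteq> b" "Q p" for a b p
      using that by (intro Qcomp Qtr') simp_all
  qed (simp_all only: Qid finite_lessThan)
  then show ?thesis unfolding Q_def n_def by blast
qed

lemma sum_permutations_compose_left:
  assumes "t permutes S"
  shows "(\<Sum>s | s permutes S. f (t \<circ> s)) = (\<Sum>s | s permutes S. f s)"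
proof -
  have "inj_on ((\<circ>) t) {s. s permutes S}"
    by (rule inj_onI) (simp add: fun.inj_map_strong fun_eq_iff inj_eq[OF permutes_inj[OF assms]])
  moreover have "(\<circ>) t ` {s. s permutes S} = {s. s permutes S}"
    using image_compose_permutations_left[OF assms] by (simp add: image_Collect)
  ultimately show ?thesis using sum.reindex[of "(\<circ>) t" "{s. s permutes S}" f] by simp
qed

lemma graded_proj_symmetric:
  assumes "graded_symmetric \<pi> x"
  shows "graded_proj \<pi> x = x"
proof
  fix w
  have "koszul \<pi> s (permute_list (inv s) w) * x (permute_list (inv s) w) = x w"
    if s: "s permutes {..<length w}" for s
    using graded_symmetric_permute[OF assms, of s "permute_list (inv s) w"] s
    by (simp add: permutes_inv_o permute_list_compose[symmetric])
  then have "graded_proj \<pi> x w = (\<Sum>s | s permutes {..<length w}. x w) / fact (length w)"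
    unfolding graded_proj_def Let_def by (intro arg_cong2[where f = "(/)"] sum.cong) auto
  then show "graded_proj \<pi> x w = x w"
    by (simp add: card_permutations)
qed

text \<open>Reindexing the average by \<open>s \<circ> t\<close> undoes the exchange
  \<open>t\<close> inside the argument of \<open>T\<close>; by the cocycle rule it leaves behind
  \<open>koszul \<pi> t w\<close>, the same factor in every summand.\<close>

lemma graded_symmetric_graded_proj:
  fixes T :: "'a list \<Rightarrow> complex"
  shows "graded_symmetric \<pi> (graded_proj \<pi> T)"
  unfolding graded_symmetric_def
proof (intro allI)
  fix u v :: "'a list" and a b
  define w where "w = u @ [a, b] @ v"
  define t where "t = Transposition.transpose (length u) (Suc (length u))"
  have i: "Suc (length u) < length w" by (simp add: w_def)
  have t: "t permutes {..<length w}" unfolding t_def by (rule transpose_Suc_permutes[OF i])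
  have tw: "permute_list t w = u @ [b, a] @ v" and kw: "koszul \<pi> t w = swap_sign \<pi> a b"
    unfolding t_def permute_list_adjacent[OF i] koszul_adjacent[OF i]
    by (simp_all add: w_def nth_append)
  let ?f = "\<lambda>s. koszul \<pi> s (permute_list (t \<circ> inv s) w) * T (permute_list (t \<circ> inv s) w)"
  have "graded_proj \<pi> T (permute_list t w) = (\<Sum>s | s permutes {..<length w}. ?f s) / fact (length w)"
    unfolding graded_proj_def Let_def length_permute_list
    by (simp add: permute_list_compose permutes_inv)
  also have "(\<Sum>s | s permutes {..<length w}. ?f s) = (\<Sum>s | s permutes {..<length w}. ?f (s \<circ> t))"
    by (rule sum_permutations_compose_right[OF t])
  also have "\<dots> = (\<Sum>s | s permutes {..<length w}. koszul \<pi> t w *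
      (koszul \<pi> s (permute_list (inv s) w) * T (permute_list (inv s) w)))"
  proof (rule sum.cong, goal_cases)
    case (2 s)
    then have s: "s permutes {..<length w}" by simp
    have "t \<circ> inv (s \<circ> t) = inv s"
      using s t by (simp add: o_inv_distrib permutes_bij o_assoc permutes_inv_o)
    moreover have "permute_list s (permute_list (inv s) w) = w"
      using s by (simp add: permutes_inv_o permute_list_compose[symmetric])
    ultimately show ?case using s t by (simp add: koszul_compose)
  qed simp
  finally show "graded_proj \<pi> T (u @ [b, a] @ v) = swap_sign \<pi> a b * graded_proj \<pi> T (u @ [a, b] @ v)"
    unfolding tw kw by (simp add: sum_distrib_left graded_proj_def Let_def w_def)
qed

text \<open>Here the places in the argument of \<open>T\<close> are exchanged, not those of
  \<open>w\<close>. The sign can leave the sum because, with all letters odd, it does not depend on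
  which letters stand at the two places.\<close>

lemma graded_proj_adjacent:
  assumes "Suc i < length w" "\<And>a. \<pi> a"
  shows "graded_proj \<pi> (\<lambda>v. T (permute_list (Transposition.transpose i (Suc i)) v)) w = - graded_proj \<pi> T w"
proof -
  define t where "t = Transposition.transpose i (Suc i)"
  have t: "t permutes {..<length w}" unfolding t_def by (rule transpose_Suc_permutes[OF assms(1)])
  let ?f = "\<lambda>s. koszul \<pi> s (permute_list (inv s) w) * T (permute_list t (permute_list (inv s) w))"
  have "(\<Sum>s | s permutes {..<length w}. ?f s) = (\<Sum>s | s permutes {..<length w}. ?f (t \<circ> s))"
    by (rule sum_permutations_compose_left[OF t, symmetric])
  also have "\<dots> = (\<Sum>s | s permutes {..<length w}.
      - (koszul \<pi> s (permute_list (inv s) w) * T (permute_list (inv s) w)))"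
  proof (rule sum.cong, goal_cases)
    case (2 s)
    then have s: "s permutes {..<length w}" by simp
    let ?v = "permute_list (inv (t \<circ> s)) w"
    have "inv (t \<circ> s) \<circ> t = inv s"
      using s t by (simp add: o_inv_distrib permutes_bij o_assoc[symmetric] permutes_inv_o)
    then have tv: "permute_list t ?v = permute_list (inv s) w"
      using t by (simp add: permute_list_compose[symmetric])
    have "koszul \<pi> t ?v = -1"
      unfolding t_def using assms by (simp add: koszul_adjacent swap_sign_def)
    then have "koszul \<pi> (t \<circ> s) ?v = - koszul \<pi> s (permute_list (inv s) w)"
      using s t by (simp add: koszul_compose tv)
    then show ?case unfolding tv by simp
  qed simp
  finally show ?thesis unfolding graded_proj_def Let_def t_def[symmetric] by (simp add: sum_negf)
qed

subsection \<open>The signed shuffle product\<close>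

text \<open>Each letter goes to the left or to the right part, so this sums \<open>B u v\<close>
  over all splittings into complementary subwords, weighted by the sign of the permutation that
  turns the word into \<open>u @ v\<close>. A letter sent to the right has to pass all later letters
  that went left, hence \<open>(-1) ^ length u\<close>.\<close>

primrec shuffle_sum :: "'a list \<Rightarrow> ('a list \<Rightarrow> 'a list \<Rightarrow> complex) \<Rightarrow> complex" where
  "shuffle_sum [] B = B [] []"
| "shuffle_sum (a # l) B =
     shuffle_sum l (\<lambda>u v. B (a # u) v) + shuffle_sum l (\<lambda>u v. (-1) ^ length u * B u (a # v))"

definition shuffle_mult :: "('a list \<Rightarrow> complex) \<Rightarrow> ('a list \<Rightarrow> complex) \<Rightarrow> 'a list \<Rightarrow> complex" where
  "shuffle_mult x y l = shuffle_sum l (\<lambda>u v. x u * y v)"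

text \<open>Plays the part of contraction with the basis vector \<open>a\<close>;
  \<open>parity_flip\<close> is the grading automorphism, with which it anticommutes.\<close>

definition front :: "'a \<Rightarrow> ('a list \<Rightarrow> complex) \<Rightarrow> 'a list \<Rightarrow> complex" where
  "front a x = (\<lambda>l. x (a # l))"

definition parity_flip :: "('a list \<Rightarrow> complex) \<Rightarrow> 'a list \<Rightarrow> complex" where
  "parity_flip x = (\<lambda>l. (-1) ^ length l * x l)"

lemma front_simps:
  "front a (\<lambda>l. - x l) = (\<lambda>l. - front a x l)"
  "front a (parity_flip x) = (\<lambda>l. - parity_flip (front a x) l)"
  by (simp_all add: front_def parity_flip_def)

lemma parity_flip_simps:
  "parity_flip (\<lambda>l. - x l) = (\<lambda>l. - parity_flip x l)"
  "parity_flip (parity_flip x) = x"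
  by (simp_all add: parity_flip_def algebra_simps flip: mult.assoc power_mult_distrib)

lemma shuffle_sum_add:
  "shuffle_sum l (\<lambda>u v. B u v + C u v) = shuffle_sum l B + shuffle_sum l C"
  by (induction l arbitrary: B C) (simp_all add: algebra_simps)

lemma shuffle_sum_cmult: "shuffle_sum l (\<lambda>u v. c * B u v) = c * shuffle_sum l B"
  by (induction l arbitrary: B) (simp_all add: distrib_left mult.left_commute)

lemma shuffle_mult_add:
  "shuffle_mult (\<lambda>l. x l + x' l) y l = shuffle_mult x y l + shuffle_mult x' y l"
  "shuffle_mult x (\<lambda>l. y l + y' l) l = shuffle_mult x y l + shuffle_mult x y' l"
  by (simp_all add: shuffle_mult_def algebra_simps shuffle_sum_add)

lemma shuffle_mult_cmult:
  "shuffle_mult (\<lambda>l. c * x l) y l = c * shuffle_mult x y l"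
  "shuffle_mult x (\<lambda>l. c * y l) l = c * shuffle_mult x y l"
  by (simp_all add: shuffle_mult_def mult_ac flip: shuffle_sum_cmult)

lemma shuffle_mult_minus:
  "shuffle_mult (\<lambda>l. - x l) y l = - shuffle_mult x y l"
  "shuffle_mult x (\<lambda>l. - y l) l = - shuffle_mult x y l"
  using shuffle_mult_cmult[where c = "-1"] by simp_all

lemma shuffle_mult_Nil [simp]: "shuffle_mult x y [] = x [] * y []"
  by (simp add: shuffle_mult_def)

text \<open>The graded Leibniz rule: \<open>front a\<close> is an antiderivation of the shuffle
  product. The algebraic laws below reduce to it by induction on the word.\<close>

lemma shuffle_mult_Cons:
  "shuffle_mult x y (a # l) =
     shuffle_mult (front a x) y l + shuffle_mult (parity_flip x) (front a y) l"
  by (simp add: shuffle_mult_def front_def parity_flip_def mult.assoc)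

lemma front_shuffle_mult:
  "front a (shuffle_mult x y) =
     (\<lambda>l. shuffle_mult (front a x) y l + shuffle_mult (parity_flip x) (front a y) l)"
  by (simp add: front_def[of a "shuffle_mult x y"] shuffle_mult_Cons)

lemma parity_flip_shuffle_mult:
  "parity_flip (shuffle_mult x y) = shuffle_mult (parity_flip x) (parity_flip y)"
proof
  show "parity_flip (shuffle_mult x y) l = shuffle_mult (parity_flip x) (parity_flip y) l" for l
  proof (induction l arbitrary: x y)
    case (Cons a l)
    have "parity_flip (shuffle_mult x y) (a # l) =
        - (parity_flip (shuffle_mult (front a x) y) l + parity_flip (shuffle_mult (parity_flip x) (front a y)) l)"
      by (simp add: parity_flip_def shuffle_mult_Cons algebra_simps)
    then show ?case
      by (simp add: Cons.IH shuffle_mult_Cons front_simps shuffle_mult_minus parity_flip_simps)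
  qed (simp add: parity_flip_def)
qed

text \<open>By the Leibniz rule and multiplicativity of \<open>parity_flip\<close>, both sides
  expand into the same three terms, with the contraction falling on \<open>x\<close>,
  \<open>y\<close> or \<open>z\<close>.\<close>

lemma shuffle_mult_assoc:
  "shuffle_mult (shuffle_mult x y) z l = shuffle_mult x (shuffle_mult y z) l"
  by (induction l arbitrary: x y z)
    (simp_all add: shuffle_mult_Cons front_shuffle_mult parity_flip_shuffle_mult shuffle_mult_add)

lemma shuffle_mult_unit: "shuffle_mult unit_tensor x l = x l"
proof (induction l arbitrary: x)
  case (Cons a l)
  have "front a unit_tensor = (\<lambda>l. 0 * front a unit_tensor l)" "parity_flip unit_tensor = unit_tensor"
    by (auto simp: front_def parity_flip_def unit_tensor_def fun_eq_iff)
  then show ?case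
    unfolding shuffle_mult_Cons by (metis (no_types) Cons shuffle_mult_cmult(1) mult_zero_left add_0 front_def)
qed (simp add: unit_tensor_def)

text \<open>Contraction turns an even factor into an odd one and vice versa, so both cases are
  proved in one induction. An odd factor passes \<open>y\<close> at the price of the grading
  automorphism, which covers \<open>y\<close> of mixed parity as well.\<close>

lemma shuffle_mult_commute:
  "parity_flip x = x \<Longrightarrow> shuffle_mult x y l = shuffle_mult y x l"
  "parity_flip x = (\<lambda>l. - x l) \<Longrightarrow> shuffle_mult x y l = shuffle_mult (parity_flip y) x l"
proof (induction l arbitrary: x y)
  case (Cons a l)
  {
    case 1
    then have "front a x l = - parity_flip (front a x) l" for l
      using fun_cong[OF front_simps(2)[of a x], of l] by simp
    then have o: "parity_flip (front a x) = (\<lambda>l. - front a x l)"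
      by (metis minus_minus)
    show ?case
      using Cons(2)[OF o, of y] Cons(1)[OF 1] 1 by (simp add: shuffle_mult_Cons)
  next
    case 2
    then have "parity_flip (front a x) l = front a x l" for l
      using fun_cong[OF front_simps(2)[of a x], of l] by (simp add: front_simps(1))
    then have e: "parity_flip (front a x) = front a x" by (rule ext)
    show ?case
      using Cons(1)[OF e, of y] Cons(2)[OF 2, of "front a y"] 2
      by (simp add: shuffle_mult_Cons front_simps shuffle_mult_minus parity_flip_simps)
  }
qed (simp_all add: parity_flip_def)

abbreviation alternating :: "('a list \<Rightarrow> complex) \<Rightarrow> bool" where
  "alternating \<equiv> graded_symmetric (\<lambda>_. True)"

lemma alternating_iff: "alternating x \<longleftrightarrow> (\<forall>u a b v. x (u @ b # a # v) = - x (u @ a # b # v))"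
  by (simp add: graded_symmetric_def swap_sign_def)

lemma alternating_front: "alternating x \<Longrightarrow> alternating (front a x)"
  unfolding alternating_iff front_def by (metis append_Cons)

lemma alternating_parity_flip: "alternating x \<Longrightarrow> alternating (parity_flip x)"
  unfolding alternating_iff parity_flip_def by (metis length_append length_Cons mult_minus_right)

text \<open>Contract with two letters. Where both hit the same factor, its antisymmetry gives the
  sign; where they hit different factors, the sign arises because \<open>front\<close> and
  \<open>parity_flip\<close> anticommute.\<close>

lemma alternating_shuffle_mult:
  assumes "alternating x" "alternating y"
  shows "alternating (shuffle_mult x y)"
proof -
  have "shuffle_mult x y (u @ b # a # v) = - shuffle_mult x y (u @ a # b # v)" for u a b v
    using assms
  proof (induction u arbitrary: x y)
    case Nil
    have *: "front a (front b z) = (\<lambda>l. - front b (front a z) l)" if "alternating z" for z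
      using that[unfolded alternating_iff, rule_format, of "[]" a b] by (simp add: front_def)
    show ?case
      using *[OF Nil(1)] *[OF Nil(2)]
      by (simp add: shuffle_mult_Cons front_simps shuffle_mult_minus parity_flip_simps)
  next
    case (Cons c u)
    then show ?case
      by (simp add: shuffle_mult_Cons alternating_front alternating_parity_flip)
  qed
  then show ?thesis unfolding alternating_iff by blast
qed

section \<open>Antisymmetrization of shuffle sums\<close>

lemma graded_proj_cong:
  assumes "\<And>v. length v = length w \<Longrightarrow> T v = T' v"
  shows "graded_proj \<pi> T w = graded_proj \<pi> T' w"
  unfolding graded_proj_def Let_def by (simp add: assms)

lemma graded_proj_add: "graded_proj \<pi> (\<lambda>v. T v + T' v) w = graded_proj \<pi> T w + graded_proj \<pi> T' w"
  by (simp add: graded_proj_def Let_def algebra_simps sum.distrib add_divide_distrib)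

text \<open>Under the antisymmetrizer a letter may be moved past its \<open>p\<close> right
  neighbours at the cost of one sign each. This restores consecutive blocks after a letter has been
  sent to the right part of a shuffle.\<close>

lemma alt_proj_rotate:
  assumes "k + p < length w"
  shows "alt_proj (\<lambda>l. C (take k l) (l ! k) (take p (drop (Suc k) l)) (drop (Suc (k + p)) l)) w =
    (-1) ^ p * alt_proj (\<lambda>l. C (take k l) (l ! (k + p)) (take p (drop k l)) (drop (Suc (k + p)) l)) w"
proof -
  \<comment> \<open>\<open>R j\<close> takes the distinguished letter from place
    \<open>k + j\<close>; consecutive ones differ by one adjacent exchange.\<close>
  define R where "R j l = C (take k l) (l ! (k + j))
    (take j (drop k l) @ take (p - j) (drop (Suc (k + j)) l)) (drop (Suc (k + p)) l)" for j l
  have "alt_proj (R j) w = (-1) ^ j * alt_proj (R 0) w" if "j \<le> p" for j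
    using that
  proof (induction j)
    case (Suc j)
    have "alt_proj (R (Suc j)) w =
        alt_proj (\<lambda>l. R j (permute_list (Transposition.transpose (k + j) (Suc (k + j))) l)) w"
    proof (rule graded_proj_cong)
      fix l :: "'a list" assume "length l = length w"
      then have i: "Suc (k + j) < length l" using assms Suc.prems by simp
      have len: "length (take (k + j) l) = k + j" using i by simp
      obtain q where q: "p - j = Suc q" "p = Suc (j + q)"
        using Suc.prems by (metis Suc_diff_Suc Suc_le_lessD add_Suc_right le_add_diff_inverse less_imp_le_nat)
      define pre a b rest where "pre = take (k + j) l" and "a = l ! (k + j)" and "b = l ! Suc (k + j)"
        and "rest = drop (Suc (Suc (k + j))) l"
      have l: "l = pre @ [a, b] @ rest" and lp: "length pre = k + j"
        and tl: "permute_list (Transposition.transpose (k + j) (Suc (k + j))) l = pre @ [b, a] @ rest"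
        using split_adjacent[OF i] permute_list_adjacent[OF i] len
        unfolding pre_def a_def b_def rest_def by auto
      show "R (Suc j) l = R j (permute_list (Transposition.transpose (k + j) (Suc (k + j))) l)"
        unfolding tl unfolding l R_def q by (simp add: lp nth_append)
    qed
    also have "\<dots> = - alt_proj (R j) w"
      using assms Suc.prems by (intro graded_proj_adjacent) auto
    finally show ?case using Suc by simp
  qed simp
  from this[of p] have "alt_proj (R 0) w = (-1) ^ p * alt_proj (R p) w"
    by (simp flip: mult.assoc power_mult_distrib)
  then show ?thesis by (simp add: R_def[abs_def])
qed

text \<open>After antisymmetrization every shuffle with \<open>p\<close> letters on the left equals
  the plain cut with a left block of length \<open>p\<close>, and there are
  \<open>m choose p\<close> of them. The prefix \<open>take k l\<close> is carried along because
  letters already distributed must remain visible to the antisymmetrizer.\<close>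

lemma alt_proj_shuffle_sum:
  assumes "k + m = length w"
  shows "alt_proj (\<lambda>l. shuffle_sum (drop k l) (B (take k l))) w =
    (\<Sum>p\<le>m. of_nat (m choose p) *
       alt_proj (\<lambda>l. B (take k l) (take p (drop k l)) (drop (k + p) l)) w)"
  using assms
proof (induction m arbitrary: k B)
  case 0
  then show ?case by (auto intro!: graded_proj_cong)
next
  case (Suc m)
  define E where "E p = alt_proj (\<lambda>l. B (take k l) (take p (drop k l)) (drop (k + p) l)) w" for p
  \<comment> \<open>The letter at place \<open>k\<close> is recovered as the last letter of the
    longer prefix, so that both alternatives have the shape of the induction hypothesis for
    \<open>Suc k\<close>.\<close>
  define B1 where "B1 = (\<lambda>t u v. B (take k t) (t ! k # u) v)"
  define B2 where "B2 = (\<lambda>t u v. (-1) ^ length u * B (take k t) u (t ! k # v))"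
  have "alt_proj (\<lambda>l. shuffle_sum (drop k l) (B (take k l))) w =
     alt_proj (\<lambda>l. shuffle_sum (drop (Suc k) l) (B1 (take (Suc k) l)) +
       shuffle_sum (drop (Suc k) l) (B2 (take (Suc k) l))) w"
  proof (rule graded_proj_cong)
    fix l :: "'a list" assume "length l = length w"
    then have k: "k < length l" using Suc.prems by simp
    show "shuffle_sum (drop k l) (B (take k l)) = shuffle_sum (drop (Suc k) l) (B1 (take (Suc k) l)) +
       shuffle_sum (drop (Suc k) l) (B2 (take (Suc k) l))"
      unfolding Cons_nth_drop_Suc[OF k, symmetric] by (simp add: B1_def B2_def)
  qed
  also have "\<dots> = alt_proj (\<lambda>l. shuffle_sum (drop (Suc k) l) (B1 (take (Suc k) l))) w +
      alt_proj (\<lambda>l. shuffle_sum (drop (Suc k) l) (B2 (take (Suc k) l))) w"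
    by (rule graded_proj_add)
  also have "alt_proj (\<lambda>l. shuffle_sum (drop (Suc k) l) (B1 (take (Suc k) l))) w =
      (\<Sum>p\<le>m. of_nat (m choose p) * E (Suc p))"
    unfolding E_def using Suc.prems
    by (subst Suc.IH)
      (auto simp: B1_def take_Suc_conv_app_nth Cons_nth_drop_Suc[symmetric] min_def
        intro!: sum.cong graded_proj_cong)
  also have "alt_proj (\<lambda>l. shuffle_sum (drop (Suc k) l) (B2 (take (Suc k) l))) w =
      (\<Sum>p\<le>m. of_nat (m choose p) * E p)"
  proof (subst Suc.IH, goal_cases)
    case 2
    show ?case
    proof (intro sum.cong refl arg_cong2[where f = "(*)"])
      fix p assume "p \<in> {..m}"
      then have p: "k + p < length w" using Suc.prems by simp
      have "alt_proj (\<lambda>l. B2 (take (Suc k) l) (take p (drop (Suc k) l)) (drop (Suc k + p) l)) w =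
          alt_proj (\<lambda>l. (-1) ^ p * B (take k l) (take p (drop (Suc k) l)) (l ! k # drop (Suc (k + p)) l)) w"
        using p by (intro graded_proj_cong) (simp add: B2_def)
      also have "\<dots> = (-1) ^ p * ((-1) ^ p *
          alt_proj (\<lambda>l. B (take k l) (take p (drop k l)) (l ! (k + p) # drop (Suc (k + p)) l)) w)"
        unfolding graded_proj_cmult
        by (subst alt_proj_rotate[OF p, of "\<lambda>t a u v. B t u (a # v)"]) simp
      also have "\<dots> = alt_proj (\<lambda>l. B (take k l) (take p (drop k l)) (l ! (k + p) # drop (Suc (k + p)) l)) w"
        by (simp flip: mult.assoc power_mult_distrib)
      also have "\<dots> = E p"
        unfolding E_def using p by (intro graded_proj_cong) (simp add: Cons_nth_drop_Suc)
      finally show "alt_proj (\<lambda>l. B2 (take (Suc k) l) (take p (drop (Suc k) l)) (drop (Suc k + p) l)) w = E p" .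
    qed
  qed (use Suc.prems in simp)
  \<comment> \<open>Pascal's rule: a letter sent left lengthens the left block, a letter sent right
    does not.\<close>
  also have "(\<Sum>p\<le>m. of_nat (m choose p) * E (Suc p)) + (\<Sum>p\<le>m. of_nat (m choose p) * E p) =
      (\<Sum>p\<le>Suc m. of_nat (Suc m choose p) * E p)"
  proof -
    have "(\<Sum>p\<le>m. of_nat (m choose p) * E p) = (\<Sum>p\<le>Suc m. of_nat (m choose p) * E p)"
      by simp
    also have "\<dots> = E 0 + (\<Sum>p\<le>m. of_nat (m choose Suc p) * E (Suc p))"
      by (subst sum.atMost_Suc_shift) simp
    finally show ?thesis
      unfolding sum.atMost_Suc_shift by (simp add: sum.distrib distrib_right)
  qed
  finally show ?case unfolding E_def .
qed

subsection \<open>The Grassmann product as a shuffle product\<close>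

definition divided :: "('a list \<Rightarrow> complex) \<Rightarrow> 'a list \<Rightarrow> complex" where
  "divided x l = complex_of_real (sqrt (fact (length l))) * x l"

lemma divided_eqD: "divided x = divided y \<Longrightarrow> x = y"
  by (simp add: divided_def fun_eq_iff)

lemma alternating_divided: "alternating x \<Longrightarrow> alternating (divided x)"
  unfolding alternating_iff divided_def by (metis length_append length_Cons mult_minus_right)

text \<open>A shuffle product of alternating functions is itself alternating, so the antisymmetrizer
  may be inserted and \<open>alt_proj_shuffle_sum\<close> applies. The rescaling is the one for
  which the square root of \<open>n choose p\<close> in the product becomes the number
  \<open>n choose p\<close> of shuffles.\<close>

lemma divided_grassmann_mult:
  assumes x: "alternating x" and y: "alternating y"
  shows "divided (x \<cdot>\<^sub>\<Lambda> y) = shuffle_mult (divided x) (divided y)"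
proof
  fix l :: "'a list"
  let ?n = "length l"
  have "shuffle_mult (divided x) (divided y) l = alt_proj (shuffle_mult (divided x) (divided y)) l"
    using assms by (simp add: graded_proj_symmetric alternating_shuffle_mult alternating_divided)
  also have "\<dots> = (\<Sum>p\<le>?n. of_nat (?n choose p) *
      alt_proj (\<lambda>w. divided x (take p w) * divided y (drop p w)) l)"
    using alt_proj_shuffle_sum[of 0 ?n l "\<lambda>_ u v. divided x u * divided y v"]
    by (simp add: shuffle_mult_def[abs_def])
  also have "\<dots> = (\<Sum>p\<le>?n. complex_of_real (sqrt (fact ?n)) *
      (complex_of_real (sqrt (fact ?n / (fact p * fact (?n - p)))) *
        alt_proj (\<lambda>w. x (take p w) * y (drop p w)) l))"
  proof (rule sum.cong)
    fix p assume "p \<in> {..?n}"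
    then have p: "p \<le> ?n" by simp
    have "alt_proj (\<lambda>w. divided x (take p w) * divided y (drop p w)) l =
        complex_of_real (sqrt (fact p * fact (?n - p))) * alt_proj (\<lambda>w. x (take p w) * y (drop p w)) l"
      unfolding graded_proj_cmult(1)[symmetric]
      using p by (intro graded_proj_cong) (simp add: divided_def min_def real_sqrt_mult)
    moreover have "real (?n choose p) * sqrt (fact p * fact (?n - p)) =
        sqrt (fact ?n) * sqrt (fact ?n / (fact p * fact (?n - p)))"
    proof -
      define s :: real where "s = sqrt (fact p * fact (?n - p))"
      have s: "s * s = fact p * fact (?n - p)" "s \<noteq> 0"
        unfolding s_def by simp_all
      have "real (?n choose p) * s = fact ?n / (s * s) * s"
        using p unfolding s by (simp add: binomial_fact)
      also have "\<dots> = fact ?n / s"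
        using s(2) by simp
      also have "\<dots> = sqrt (fact ?n) * (sqrt (fact ?n) / s)"
        by simp
      finally show ?thesis
        unfolding s_def by (simp only: real_sqrt_divide)
    qed
    then have "of_nat (?n choose p) * complex_of_real (sqrt (fact p * fact (?n - p))) =
        complex_of_real (sqrt (fact ?n)) * complex_of_real (sqrt (fact ?n / (fact p * fact (?n - p))))"
      by (metis of_real_mult of_real_of_nat_eq)
    ultimately show "of_nat (?n choose p) * alt_proj (\<lambda>w. divided x (take p w) * divided y (drop p w)) l =
        complex_of_real (sqrt (fact ?n)) * (complex_of_real (sqrt (fact ?n / (fact p * fact (?n - p)))) *
          alt_proj (\<lambda>w. x (take p w) * y (drop p w)) l)"
      by (simp only: mult.assoc[symmetric])
  qed simp
  finally show "divided (x \<cdot>\<^sub>\<Lambda> y) l = shuffle_mult (divided x) (divided y) l"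
    by (simp add: divided_def[of "x \<cdot>\<^sub>\<Lambda> y"] graded_mult_def sum_distrib_left)
qed

lemma alternating_grassmann_mult: "alternating (x \<cdot>\<^sub>\<Lambda> y)"
proof -
  have "alt_proj T (u @ b # a # v) = - alt_proj T (u @ a # b # v)" for T u a b v
    using graded_symmetric_graded_proj[of "\<lambda>_. True" T] unfolding alternating_iff by blast
  note swap = this
  have "(x \<cdot>\<^sub>\<Lambda> y) (u @ b # a # v) = - (x \<cdot>\<^sub>\<Lambda> y) (u @ a # b # v)" for u a b v
  proof -
    have len: "length (u @ b # a # v) = length (u @ a # b # v)" by simp
    show ?thesis
      unfolding graded_mult_def swap[of _ u b a v] len mult_minus_right by (rule sum_negf)
  qed
  then show ?thesis unfolding alternating_iff by blast
qed

lemma grassmann_mult_assoc: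
  assumes "alternating x" "alternating y" "alternating z"
  shows "(x \<cdot>\<^sub>\<Lambda> y) \<cdot>\<^sub>\<Lambda> z = x \<cdot>\<^sub>\<Lambda> (y \<cdot>\<^sub>\<Lambda> z)"
  by (rule divided_eqD)
    (simp add: divided_grassmann_mult assms alternating_grassmann_mult fun_eq_iff shuffle_mult_assoc)

lemma alternating_unit: "alternating unit_tensor"
  unfolding alternating_iff unit_tensor_def by simp

lemma grassmann_mult_unit:
  assumes "alternating x"
  shows "unit_tensor \<cdot>\<^sub>\<Lambda> x = x"
proof -
  have *: "divided unit_tensor = unit_tensor"
    by (auto simp: divided_def unit_tensor_def fun_eq_iff)
  show ?thesis
    by (rule divided_eqD, rule ext)
      (simp only: divided_grassmann_mult[OF alternating_unit assms] * shuffle_mult_unit)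
qed

text \<open>Parity is expressed on the support, so that the zero function has both parities. On
  functions of definite parity \<open>parity_flip\<close> is a sign, and the commutation law for
  shuffles becomes graded commutativity.\<close>

lemma grassmann_mult_swap:
  assumes alt: "alternating x" "alternating y"
    and x: "\<And>l. x l \<noteq> 0 \<Longrightarrow> odd (length l) \<longleftrightarrow> p" and y: "\<And>l. y l \<noteq> 0 \<Longrightarrow> odd (length l) \<longleftrightarrow> q"
  shows "x \<cdot>\<^sub>\<Lambda> y = (\<lambda>l. (if p \<and> q then -1 else 1) * (y \<cdot>\<^sub>\<Lambda> x) l)"
proof -
  have par: "parity_flip (divided z) = (if p then (\<lambda>l. - divided z l) else divided z)"
    if "\<And>l. z l \<noteq> 0 \<Longrightarrow> odd (length l) \<longleftrightarrow> p" for z :: "'a list \<Rightarrow> complex" and p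
  proof -
    have "parity_flip (divided z) l = (if p then - divided z l else divided z l)" for l
      using that[of l] by (cases "z l = 0") (auto simp: parity_flip_def divided_def)
    then show ?thesis by auto
  qed
  have "divided (x \<cdot>\<^sub>\<Lambda> y) = divided (\<lambda>l. (if p \<and> q then -1 else 1) * (y \<cdot>\<^sub>\<Lambda> x) l)"
    (is "_ = divided (\<lambda>l. ?c * _ l)")
  proof
    fix l
    have "shuffle_mult (divided x) (divided y) l = ?c * shuffle_mult (divided y) (divided x) l"
      using shuffle_mult_commute(1)[of "divided x" "divided y" l]
        shuffle_mult_commute(2)[of "divided x" "divided y" l] par[of x p, OF x] par[of y q, OF y]
      by (auto simp: shuffle_mult_minus split: if_splits)
    then have "divided (x \<cdot>\<^sub>\<Lambda> y) l = ?c * divided (y \<cdot>\<^sub>\<Lambda> x) l"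
      by (simp only: divided_grassmann_mult alt)
    then show "divided (x \<cdot>\<^sub>\<Lambda> y) l = divided (\<lambda>l. ?c * (y \<cdot>\<^sub>\<Lambda> x) l) l"
      by (simp add: divided_def)
  qed
  then show ?thesis by (rule divided_eqD)
qed

subsection \<open>Weighted square sums\<close>

text \<open>With sums as integrals over the counting measure in the extended nonnegative reals,
  exchange of summations and the Cauchy-Schwarz inequality hold without summability
  conditions.\<close>

abbreviation nnsum :: "('i \<Rightarrow> ennreal) \<Rightarrow> ennreal" where
  "nnsum f \<equiv> \<integral>\<^sup>+ i. f i \<partial>count_space UNIV"

definition sqsum :: "('i \<Rightarrow> real) \<Rightarrow> ('i \<Rightarrow> complex) \<Rightarrow> ennreal" where
  "sqsum wt x = nnsum (\<lambda>i. ennreal (wt i * (cmod (x i))\<^sup>2))"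

lemma summable_on_iff_nnsum:
  fixes f :: "'i \<Rightarrow> real"
  assumes "\<And>i. 0 \<le> f i"
  shows "f summable_on UNIV \<longleftrightarrow> nnsum (\<lambda>i. ennreal (f i)) < \<infinity>"
    "f summable_on UNIV \<Longrightarrow> nnsum (\<lambda>i. ennreal (f i)) = ennreal (infsum f UNIV)"
proof -
  have *: "f summable_on UNIV \<longleftrightarrow> Infinite_Set_Sum.abs_summable_on f UNIV"
    by (rule trans[OF summable_on_iff_abs_summable_on_real abs_summable_equivalent])
  then show "f summable_on UNIV \<longleftrightarrow> nnsum (\<lambda>i. ennreal (f i)) < \<infinity>"
    unfolding Infinite_Set_Sum.abs_summable_on_def integrable_iff_bounded using assms by simp
  show "nnsum (\<lambda>i. ennreal (f i)) = ennreal (infsum f UNIV)" if "f summable_on UNIV"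
    using nn_integral_conv_infsetsum[of f UNIV] infsetsum_infsum[of f UNIV] that assms
    unfolding * by metis
qed

lemma cmod_infsum_le_nnsum:
  "ennreal (cmod (infsum f UNIV)) \<le> nnsum (\<lambda>i. ennreal (cmod (f i)))"
proof (cases "nnsum (\<lambda>i. ennreal (cmod (f i))) < \<infinity>")
  case True
  then have "(\<lambda>i. cmod (f i)) summable_on UNIV"
    by (simp add: summable_on_iff_nnsum)
  then show ?thesis
    using norm_infsum_bound[of f UNIV] by (simp add: summable_on_iff_nnsum ennreal_leI)
qed (simp add: not_less top_unique)

lemma weighted_l2_iff:
  assumes "\<And>i. 0 \<le> wt i"
  shows "x \<in> weighted_l2 wt \<longleftrightarrow> sqsum wt x < \<infinity>"
  unfolding weighted_l2_def sqsum_def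
  using summable_on_iff_nnsum(1)[of "\<lambda>i. wt i * (cmod (x i))\<^sup>2"] assms by simp

lemma weighted_norm_sqsum:
  assumes "\<And>i. 0 \<le> wt i" "x \<in> weighted_l2 wt"
  shows "ennreal ((weighted_norm wt x)\<^sup>2) = sqsum wt x"
  using summable_on_iff_nnsum(2)[of "\<lambda>i. wt i * (cmod (x i))\<^sup>2"] assms
  unfolding weighted_norm_def sqsum_def weighted_l2_def by (simp add: infsum_nonneg)

lemma cmod_add_square_le: "(cmod (x + y))\<^sup>2 \<le> 2 * (cmod x)\<^sup>2 + 2 * (cmod y)\<^sup>2"
proof -
  have "(cmod (x + y))\<^sup>2 \<le> (cmod x + cmod y)\<^sup>2"
    by (simp add: norm_triangle_ineq power_mono)
  then show ?thesis using sum_squares_ge_zero[of "cmod x - cmod y" 0]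
    by (simp add: power2_eq_square algebra_simps)
qed

text \<open>The factor 2 stems from \<open>cmod_add_square_le\<close>; this replaces the triangle
  inequality wherever only finiteness or boundedness is wanted.\<close>

lemma sqsum_add:
  fixes x y :: "'i \<Rightarrow> complex"
  assumes "\<And>i. 0 \<le> wt i"
  shows "sqsum wt (\<lambda>i. x i + y i) \<le> 2 * (sqsum wt x + sqsum wt y)"
proof -
  have "sqsum wt (\<lambda>i. x i + y i) \<le>
      nnsum (\<lambda>i. 2 * (ennreal (wt i * (cmod (x i))\<^sup>2) + ennreal (wt i * (cmod (y i))\<^sup>2)))"
    unfolding sqsum_def
  proof (rule nn_integral_mono)
    fix i
    have "wt i * (cmod (x i + y i))\<^sup>2 \<le> 2 * (wt i * (cmod (x i))\<^sup>2 + wt i * (cmod (y i))\<^sup>2)"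
      using mult_left_mono[OF cmod_add_square_le[of "x i" "y i"] assms[of i]] by (simp add: algebra_simps)
    then have "ennreal (wt i * (cmod (x i + y i))\<^sup>2) \<le>
        ennreal (2 * (wt i * (cmod (x i))\<^sup>2 + wt i * (cmod (y i))\<^sup>2))"
      by (rule ennreal_leI)
    then show "ennreal (wt i * (cmod (x i + y i))\<^sup>2) \<le>
        2 * (ennreal (wt i * (cmod (x i))\<^sup>2) + ennreal (wt i * (cmod (y i))\<^sup>2))"
      using assms by (simp add: ennreal_mult')
  qed
  then show ?thesis unfolding sqsum_def by (simp add: nn_integral_cmult nn_integral_add)
qed

lemma sqsum_cmult: "sqsum wt (\<lambda>i. c * x i) = ennreal ((cmod c)\<^sup>2) * sqsum wt x"
  unfolding sqsum_def
  by (subst nn_integral_cmult[symmetric])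
    (auto simp: norm_mult power_mult_distrib mult_ac simp flip: ennreal_mult' intro!: nn_integral_cong)

lemma nnsum_by_length:
  fixes f :: "'a list \<Rightarrow> ennreal"
  shows "nnsum f = (\<Sum>n. \<integral>\<^sup>+ l. f l \<partial>count_space {l. length l = n})"
proof -
  have "f l = (\<Sum>n. f l * indicator {l. length l = n} l)" for l
    by (subst suminf_finite[of "{length l}"]) auto
  then have "nnsum f = nnsum (\<lambda>l. \<Sum>n. f l * indicator {l. length l = n} l)"
    by presburger
  also have "\<dots> = (\<Sum>n. nnsum (\<lambda>l. f l * indicator {l. length l = n} l))"
    by (rule nn_integral_suminf) simp
  finally show ?thesis by (simp add: nn_integral_count_space_indicator)
qed

text \<open>At a fixed length each permutation is a bijection of the words, so that n! equal sums
  are averaged.\<close>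

lemma nnsum_permutation_average:
  fixes f :: "'a list \<Rightarrow> ennreal"
  shows "nnsum (\<lambda>l. (\<Sum>s | s permutes {..<length l}. f (permute_list (inv s) l)) / of_nat (fact (length l))) = nnsum f"
  unfolding nnsum_by_length
proof (rule arg_cong[where f = suminf], rule ext)
  fix n
  let ?W = "{l :: 'a list. length l = n}" and ?S = "{s. s permutes {..<n}}"
  have "bij_betw (permute_list (inv s)) ?W ?W" if "s \<in> ?S" for s
  proof (rule bij_betwI[where g = "permute_list s"])
    show "permute_list s (permute_list (inv s) l) = l" "permute_list (inv s) (permute_list s l) = l"
      if "l \<in> ?W" for l
      using that \<open>s \<in> ?S\<close>
      by (simp_all add: permutes_inv_o permutes_inv permute_list_compose[symmetric])
  qed auto
  then have s: "(\<integral>\<^sup>+ l. f (permute_list (inv s) l) \<partial>count_space ?W) = (\<integral>\<^sup>+ l. f l \<partial>count_space ?W)"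
    if "s \<in> ?S" for s
    using that by (intro nn_integral_bij_count_space) auto
  have "(\<integral>\<^sup>+ l. (\<Sum>s | s permutes {..<length l}. f (permute_list (inv s) l)) / of_nat (fact (length l)) \<partial>count_space ?W) =
      (\<integral>\<^sup>+ l. (\<Sum>s\<in>?S. f (permute_list (inv s) l)) / of_nat (fact n) \<partial>count_space ?W)"
    by (rule nn_integral_cong) auto
  also have "\<dots> = (\<Sum>s\<in>?S. (\<integral>\<^sup>+ l. f (permute_list (inv s) l) \<partial>count_space ?W)) / of_nat (fact n)"
    by (simp add: nn_integral_divide nn_integral_sum)
  also have "\<dots> = of_nat (fact n) * (\<integral>\<^sup>+ l. f l \<partial>count_space ?W) / of_nat (fact n)"
    using s by (simp add: card_permutations)
  also have "\<dots> = (\<integral>\<^sup>+ l. f l \<partial>count_space ?W)"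
    by (subst mult.commute) (simp add: ennreal_mult_divide_eq)
  finally show "(\<integral>\<^sup>+ l. (\<Sum>s | s permutes {..<length l}. f (permute_list (inv s) l)) / of_nat (fact (length l)) \<partial>count_space ?W) =
    (\<integral>\<^sup>+ l. f l \<partial>count_space ?W)" .
qed

lemma nnsum_pair: "nnsum (\<lambda>(a, b). f a * g b) = nnsum f * nnsum g"
  by (simp add: nn_integral_fst_count_space[symmetric] nn_integral_cmult nn_integral_multc)

text \<open>A word with a marked cut is the same as a pair of words, so summing over all cuts of all
  words separates the two factors.\<close>

lemma nnsum_deconcatenation:
  fixes f g :: "'a list \<Rightarrow> ennreal"
  shows "nnsum (\<lambda>l. \<Sum>p\<le>length l. f (take p l) * g (drop p l)) = nnsum f * nnsum g"
proof -
  have "nnsum (\<lambda>l. \<Sum>p\<le>length l. f (take p l) * g (drop p l)) =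
      nnsum (\<lambda>l. \<integral>\<^sup>+ p. f (take p l) * g (drop p l) \<partial>count_space {..length l})"
    by (simp add: nn_integral_count_space_finite)
  also have "\<dots> = nnsum (\<lambda>l. nnsum (\<lambda>p. case (l, p) of (l, p) \<Rightarrow> f (take p l) * g (drop p l) * indicator {..length l} p))"
    by (simp add: nn_integral_count_space_indicator)
  also have "\<dots> = nnsum (\<lambda>(l, p). f (take p l) * g (drop p l) * indicator {..length l} p)"
    by (rule nn_integral_fst_count_space)
  also have "\<dots> = (\<integral>\<^sup>+ lp. (case lp of (l, p) \<Rightarrow> f (take p l) * g (drop p l)) \<partial>count_space {(l, p). p \<le> length l})"
    by (subst nn_integral_count_space_indicator)
      (auto intro!: nn_integral_cong simp: indicator_def)
  also have "\<dots> = nnsum (\<lambda>uv. case (case uv of (u, v) \<Rightarrow> (u @ v, length u)) of (l, p) \<Rightarrow> f (take p l) * g (drop p l))"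
    by (rule nn_integral_bij_count_space[symmetric], rule bij_betwI[where g = "\<lambda>(l, p). (take p l, drop p l)"]) auto
  also have "\<dots> = nnsum (\<lambda>(u, v). f u * g v)"
    by (rule nn_integral_cong) auto
  finally show ?thesis by (simp add: nnsum_pair)
qed

lemma nnsum_Cons:
  fixes f :: "'a list \<Rightarrow> ennreal"
  assumes "f [] = 0"
  shows "nnsum f = nnsum (\<lambda>(a, l). f (a # l))"
proof -
  have "nnsum f = (\<integral>\<^sup>+ l. f l \<partial>count_space {l. l \<noteq> []})"
    using assms by (intro nn_integral_count_space_eq) auto
  also have "\<dots> = nnsum (\<lambda>al. f (case al of (a, l) \<Rightarrow> a # l))"
    by (rule nn_integral_bij_count_space[symmetric], rule bij_betwI[where g = "\<lambda>l. (hd l, tl l)"]) auto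
  finally show ?thesis by (simp add: case_prod_unfold)
qed

subsection \<open>Continuity of the Grassmann product\<close>

lemma binomial_ge: "0 < p \<Longrightarrow> p < n \<Longrightarrow> n \<le> n choose p"
proof (induction n arbitrary: p)
  case (Suc n)
  then obtain q where p: "p = Suc q" by (cases p) auto
  show ?case
  proof (cases "q = 0 \<or> p = n")
    case True
    then show ?thesis using p by (auto simp: binomial_symmetric[of n "Suc n"])
  next
    case False
    then have "n \<le> n choose q" "n \<le> n choose p"
      using Suc p by auto
    then show ?thesis using p Suc.prems by simp
  qed
qed simp

text \<open>The two ends contribute at most 1 each; every inner binomial coefficient is at least
  \<open>n\<close>, so that the rest contributes at most 1.\<close>

lemma sum_inverse_binomial_le: "(\<Sum>p\<le>n. 1 / real (n choose p)) \<le> 3"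
proof -
  have "(\<Sum>p\<le>n. 1 / real (n choose p)) \<le>
      (\<Sum>p\<le>n. (if p = 0 then 1 else 0) + (if p = n then 1 else 0) + (if p = 0 then 0 else 1 / real n))"
  proof (rule sum_mono)
    fix p assume "p \<in> {..n}"
    then consider "p = 0" | "p = n" | "0 < p" "p < n" by fastforce
    then show "1 / real (n choose p) \<le>
        (if p = 0 then 1 else 0) + (if p = n then 1 else 0) + (if p = 0 then 0 else 1 / real n)"
      by cases (auto simp: frac_le binomial_ge)
  qed
  also have "\<dots> = 2 + (\<Sum>p\<le>n. if p = 0 then 0 else 1 / real n)"
    by (simp add: sum.distrib)
  also have "(\<Sum>p\<le>n. if p = 0 then 0 else 1 / real n) = (\<Sum>p\<in>{1..n}. 1 / real n)"
    by (rule sum.mono_neutral_cong_right) auto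
  also have "\<dots> \<le> 1" by simp
  finally show ?thesis by simp
qed

text \<open>The signs have modulus 1, and the square of an average is at most the average of the
  squares.\<close>

lemma graded_proj_square_le:
  "(cmod (graded_proj \<pi> T w))\<^sup>2 \<le>
     (\<Sum>s | s permutes {..<length w}. (cmod (T (permute_list (inv s) w)))\<^sup>2) / fact (length w)"
proof -
  let ?S = "{s. s permutes {..<length w}}"
  let ?k = "\<lambda>s. koszul \<pi> s (permute_list (inv s) w) * T (permute_list (inv s) w)"
  have "cmod (\<Sum>s\<in>?S. ?k s) \<le> (\<Sum>s\<in>?S. cmod (T (permute_list (inv s) w)))"
    by (rule order_trans[OF norm_sum]) (simp add: norm_mult)
  then have "(cmod (\<Sum>s\<in>?S. ?k s))\<^sup>2 \<le> (\<Sum>s\<in>?S. cmod (T (permute_list (inv s) w)))\<^sup>2"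
    by (simp add: power_mono)
  also have "\<dots> \<le> (\<Sum>s\<in>?S. (cmod (T (permute_list (inv s) w)))\<^sup>2) * fact (length w)"
    using sum_squared_le_sum_of_squares[of "\<lambda>s. cmod (T (permute_list (inv s) w))" ?S]
    by (simp add: card_permutations finite_permutations)
  finally have "(cmod (\<Sum>s\<in>?S. ?k s))\<^sup>2 / (fact (length w))\<^sup>2 \<le>
      (\<Sum>s\<in>?S. (cmod (T (permute_list (inv s) w)))\<^sup>2) * fact (length w) / (fact (length w))\<^sup>2"
    by (rule divide_right_mono) simp
  then show ?thesis
    unfolding graded_proj_def Let_def norm_divide power_divide by (simp add: power2_eq_square)
qed

lemma grassmann_weight_nonneg [simp]: "0 \<le> grassmann_weight l"
  by (simp add: grassmann_weight_def)

text \<open>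
  Writing \<open>a\<^sub>p = \<parallel>x\<^sub>p\<parallel> / p!\<close> and \<open>b\<^sub>q = \<parallel>y\<^sub>q\<parallel> / q!\<close>, the component of degree \<open>n\<close> of the product has
  weighted norm at most \<open>\<Sum>\<^sub>p (n choose p)\<^sup>-\<^sup>\<onehalf> a\<^sub>p b\<^sub>n\<^sub>-\<^sub>p\<close>; the constant comes from
  \<open>sum_inverse_binomial_le\<close> and the Cauchy-Schwarz inequality.
\<close>

lemma sqsum_grassmann_mult:
  "sqsum grassmann_weight (x \<cdot>\<^sub>\<Lambda> y) \<le> 3 * sqsum grassmann_weight x * sqsum grassmann_weight y"
proof -
  define g where "g z u = grassmann_weight u * (cmod (z u))\<^sup>2" for z :: "'a list \<Rightarrow> complex" and u
  define Z where "Z l = (\<Sum>p\<le>length l. g x (take p l) * g y (drop p l))" for l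
  have g0: "0 \<le> g z u" for z u by (simp add: g_def)
  have Z0: "0 \<le> Z l" for l unfolding Z_def by (intro sum_nonneg mult_nonneg_nonneg g0)
  have pointwise: "g (x \<cdot>\<^sub>\<Lambda> y) l \<le>
      3 * ((\<Sum>s | s permutes {..<length l}. Z (permute_list (inv s) l)) / fact (length l))" for l
  proof -
    let ?n = "length l" and ?S = "{s. s permutes {..<length l}}"
    let ?b = "\<lambda>p. real (?n choose p)"
    define A where "A p = cmod (alt_proj (\<lambda>v. x (take p v) * y (drop p v)) l)" for p
    have b: "sqrt (fact ?n / (fact p * fact (?n - p))) = sqrt (?b p)" if "p \<le> ?n" for p
      using that by (simp add: binomial_fact)
    have "cmod ((x \<cdot>\<^sub>\<Lambda> y) l) \<le> (\<Sum>p\<le>?n. sqrt (?b p) * A p)"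
      unfolding graded_mult_def A_def
      by (rule order_trans[OF norm_sum], rule sum_mono) (simp add: norm_mult b)
    then have "(cmod ((x \<cdot>\<^sub>\<Lambda> y) l))\<^sup>2 \<le> (\<Sum>p\<le>?n. sqrt (1 / ?b p) * (?b p * A p))\<^sup>2"
    proof (rule power_mono[THEN order_trans])
      have "sqrt (?b p) * A p = sqrt (1 / ?b p) * (?b p * A p)" if "p \<le> ?n" for p
      proof -
        have "?b p = sqrt (?b p) * sqrt (?b p)" by simp
        moreover have "sqrt (?b p) \<noteq> 0" using that by simp
        ultimately show ?thesis by (simp add: real_sqrt_divide field_simps)
      qed
      then have "(\<Sum>p\<le>?n. sqrt (?b p) * A p) = (\<Sum>p\<le>?n. sqrt (1 / ?b p) * (?b p * A p))"
        by (intro sum.cong refl) (simp only: atMost_iff)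
      then show "(\<Sum>p\<le>?n. sqrt (?b p) * A p)\<^sup>2 \<le> (\<Sum>p\<le>?n. sqrt (1 / ?b p) * (?b p * A p))\<^sup>2"
        by (simp only: order_refl)
    qed simp
    also have "\<dots> \<le> (\<Sum>p\<le>?n. (sqrt (1 / ?b p))\<^sup>2) * (\<Sum>p\<le>?n. (?b p * A p)\<^sup>2)"
      by (rule Cauchy_Schwarz_ineq_sum)
    also have "\<dots> \<le> 3 * (\<Sum>p\<le>?n. (?b p * A p)\<^sup>2)"
      using sum_inverse_binomial_le[of ?n] by (intro mult_right_mono sum_nonneg) auto
    also have "(\<Sum>p\<le>?n. (?b p * A p)\<^sup>2) \<le>
        (\<Sum>p\<le>?n. (\<Sum>s\<in>?S. (?b p)\<^sup>2 * (cmod (x (take p (permute_list (inv s) l)) * y (drop p (permute_list (inv s) l))))\<^sup>2) / fact ?n)"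
      unfolding A_def power_mult_distrib sum_distrib_left[symmetric] times_divide_eq_right[symmetric]
      by (intro sum_mono mult_left_mono graded_proj_square_le) auto
    also have "\<dots> = (\<Sum>s\<in>?S. \<Sum>p\<le>?n. (?b p)\<^sup>2 * (cmod (x (take p (permute_list (inv s) l)) * y (drop p (permute_list (inv s) l))))\<^sup>2) / fact ?n"
      unfolding sum_divide_distrib[symmetric] by (subst sum.swap) simp
    \<comment> \<open>The squared binomial coefficient supplies exactly the weights of the two
      factors; the remaining square of n! is cancelled by the weight of the product.\<close>
    also have "(\<Sum>s\<in>?S. \<Sum>p\<le>?n. (?b p)\<^sup>2 * (cmod (x (take p (permute_list (inv s) l)) * y (drop p (permute_list (inv s) l))))\<^sup>2) =
        (\<Sum>s\<in>?S. (fact ?n)\<^sup>2 * Z (permute_list (inv s) l))"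
      unfolding Z_def sum_distrib_left length_permute_list
      by (intro sum.cong refl)
        (simp add: g_def grassmann_weight_def binomial_fact norm_mult power_mult_distrib power_divide)
    finally have "(cmod ((x \<cdot>\<^sub>\<Lambda> y) l))\<^sup>2 \<le> 3 * ((fact ?n)\<^sup>2 * (\<Sum>s\<in>?S. Z (permute_list (inv s) l)) / fact ?n)"
      by (simp add: sum_distrib_left)
    then have "(cmod ((x \<cdot>\<^sub>\<Lambda> y) l))\<^sup>2 / (fact ?n)\<^sup>2 \<le> 3 * ((fact ?n)\<^sup>2 * (\<Sum>s\<in>?S. Z (permute_list (inv s) l)) / fact ?n) / (fact ?n)\<^sup>2"
      by (rule divide_right_mono) simp
    then show ?thesis
      by (simp add: g_def grassmann_weight_def)
  qed
  have "sqsum grassmann_weight (x \<cdot>\<^sub>\<Lambda> y) \<le>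
      nnsum (\<lambda>l. 3 * ((\<Sum>s | s permutes {..<length l}. ennreal (Z (permute_list (inv s) l))) / of_nat (fact (length l))))"
    unfolding sqsum_def
  proof (rule nn_integral_mono)
    fix l
    have "ennreal (g (x \<cdot>\<^sub>\<Lambda> y) l) \<le> ennreal (3 * ((\<Sum>s | s permutes {..<length l}. Z (permute_list (inv s) l)) / real (fact (length l))))"
      using pointwise by (intro ennreal_leI) simp
    also have "\<dots> = 3 * ((\<Sum>s | s permutes {..<length l}. ennreal (Z (permute_list (inv s) l))) / ennreal (real (fact (length l))))"
      by (subst ennreal_mult') (simp_all add: divide_ennreal[symmetric] sum_nonneg Z0 sum_ennreal)
    finally show "ennreal (grassmann_weight l * (cmod ((x \<cdot>\<^sub>\<Lambda> y) l))\<^sup>2) \<le>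
        3 * ((\<Sum>s | s permutes {..<length l}. ennreal (Z (permute_list (inv s) l))) / of_nat (fact (length l)))"
      unfolding g_def ennreal_of_nat_eq_real_of_nat .
  qed
  also have "\<dots> = 3 * nnsum (\<lambda>l. ennreal (Z l))"
    by (subst nn_integral_cmult, simp)
      (rule arg_cong[OF nnsum_permutation_average[of "\<lambda>l. ennreal (Z l)"]])
  also have "nnsum (\<lambda>l. ennreal (Z l)) = nnsum (\<lambda>l. \<Sum>p\<le>length l. ennreal (g x (take p l)) * ennreal (g y (drop p l)))"
    unfolding Z_def by (simp add: g0 ennreal_mult' flip: sum_ennreal)
  also have "\<dots> = nnsum (\<lambda>u. ennreal (g x u)) * nnsum (\<lambda>u. ennreal (g y u))"
    by (rule nnsum_deconcatenation)
  finally show ?thesis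
    by (simp add: sqsum_def g_def mult.assoc)
qed

subsection \<open>Products of families\<close>

text \<open>One family per tensor factor, so that the same construction yields the powers of a point
  (all families equal) and their polarization. Words of the wrong length give 0, which permits sums
  over all words.\<close>

fun family_prod :: "('h \<Rightarrow> 'l list \<Rightarrow> complex) list \<Rightarrow> 'h list \<Rightarrow> 'l list \<Rightarrow> complex" where
  "family_prod [] [] = unit_tensor"
| "family_prod (f # fs) (a # v) = f a \<cdot>\<^sub>\<Lambda> family_prod fs v"
| "family_prod _ _ = (\<lambda>_. 0)"

text \<open>The squared norm of the family as a vector of the Hilbert tensor product of \<Lambda>
  with the square summable sequences.\<close>

definition family_sqsum :: "('h \<Rightarrow> 'l list \<Rightarrow> complex) \<Rightarrow> ennreal" where
  "family_sqsum f = nnsum (\<lambda>a. sqsum grassmann_weight (f a))"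

lemma sqsum_zero [simp]: "sqsum wt (\<lambda>_. 0) = 0"
  by (simp add: sqsum_def)

lemma sqsum_unit: "sqsum grassmann_weight (unit_tensor :: 'a list \<Rightarrow> complex) = 1"
proof -
  have "sqsum grassmann_weight (unit_tensor :: 'a list \<Rightarrow> complex) = nnsum (\<lambda>l :: 'a list. indicator {[]} l)"
    unfolding sqsum_def
    by (rule nn_integral_cong) (auto simp: unit_tensor_def grassmann_weight_def)
  then show ?thesis by simp
qed

lemma family_sqsum_family_prod:
  fixes fs :: "('h \<Rightarrow> 'l list \<Rightarrow> complex) list"
  shows "family_sqsum (family_prod fs) \<le> prod_list (map (\<lambda>f. 3 * family_sqsum f) fs)"
proof (induction fs)
  case Nil
  have "family_sqsum (family_prod [] :: 'h list \<Rightarrow> 'l list \<Rightarrow> complex) = nnsum (\<lambda>v :: 'h list. indicator {[]} v)"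
    unfolding family_sqsum_def
  proof (rule nn_integral_cong)
    show "sqsum grassmann_weight (family_prod [] v :: 'l list \<Rightarrow> complex) = indicator {[]} v" for v :: "'h list"
      by (cases v) (simp_all add: sqsum_unit)
  qed
  then show ?case by simp
next
  case (Cons f fs)
  have "family_sqsum (family_prod (f # fs)) =
      nnsum (\<lambda>(a, v). sqsum grassmann_weight (f a \<cdot>\<^sub>\<Lambda> family_prod fs v))"
    unfolding family_sqsum_def by (subst nnsum_Cons) simp_all
  also have "\<dots> \<le> nnsum (\<lambda>(a, v). (3 * sqsum grassmann_weight (f a)) * sqsum grassmann_weight (family_prod fs v))"
    by (intro nn_integral_mono) (auto simp: sqsum_grassmann_mult)
  also have "\<dots> = 3 * family_sqsum f * family_sqsum (family_prod fs)"
    by (subst nnsum_pair) (simp add: nn_integral_cmult family_sqsum_def)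
  also have "\<dots> \<le> 3 * family_sqsum f * prod_list (map (\<lambda>f. 3 * family_sqsum f) fs)"
    by (intro mult_left_mono Cons.IH) simp
  finally show ?case by simp
qed

subsection \<open>Pairing a family with square summable coefficients\<close>

text \<open>Bilinear, without a conjugate, because \<open>fock_star\<close> cancels the one in
  \<open>fock_inner\<close>.\<close>

definition family_pair :: "('i \<Rightarrow> 'l list \<Rightarrow> complex) \<Rightarrow> ('i \<Rightarrow> complex) \<Rightarrow> 'l list \<Rightarrow> complex" where
  "family_pair f T l = (\<Sum>\<^sub>\<infinity>v. f v l * T v)"

abbreviation l2sq :: "('i \<Rightarrow> complex) \<Rightarrow> ennreal" where
  "l2sq \<equiv> sqsum (\<lambda>_. 1)"

lemma nnsum_mult_square_le:
  fixes a b :: "'i \<Rightarrow> complex"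
  shows "(nnsum (\<lambda>v. ennreal (cmod (a v * b v))))\<^sup>2 \<le> l2sq a * l2sq b"
proof -
  have "(nnsum (\<lambda>v. ennreal (cmod (a v)) * ennreal (cmod (b v))))\<^sup>2 \<le>
      nnsum (\<lambda>v. (ennreal (cmod (a v)))\<^sup>2) * nnsum (\<lambda>v. (ennreal (cmod (b v)))\<^sup>2)"
    by (rule Cauchy_Schwarz_nn_integral) simp_all
  then show ?thesis
    by (simp add: sqsum_def norm_mult ennreal_mult' ennreal_power)
qed

text \<open>One Grassmann coefficient is dominated by the whole norm. As its weight is positive, its
  sequence over the index set is square summable, which makes the series in
  \<open>family_pair\<close> converge absolutely.\<close>

lemma l2sq_coeff_le:
  "ennreal (grassmann_weight l) * l2sq (\<lambda>v. f v l) \<le> family_sqsum f"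
proof -
  have "ennreal (grassmann_weight l) * l2sq (\<lambda>v. f v l) =
      nnsum (\<lambda>v. ennreal (grassmann_weight l * (cmod (f v l))\<^sup>2))"
    unfolding sqsum_def by (subst nn_integral_cmult[symmetric]) (simp_all add: ennreal_mult')
  also have "\<dots> \<le> family_sqsum f"
    unfolding family_sqsum_def sqsum_def
    by (intro nn_integral_mono nn_integral_ge_point) simp
  finally show ?thesis .
qed

lemma family_pair_summable:
  assumes "family_sqsum f < \<infinity>" "l2sq T < \<infinity>"
  shows "(\<lambda>v. cmod (f v l * T v)) summable_on UNIV"
proof -
  have "ennreal (grassmann_weight l) * l2sq (\<lambda>v. f v l) < \<infinity>"
    using l2sq_coeff_le assms(1) by (rule le_less_trans)
  moreover have "ennreal (grassmann_weight l) \<noteq> 0"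
    by (simp add: grassmann_weight_def)
  ultimately have "l2sq (\<lambda>v. f v l) < \<infinity>"
    by (auto simp: ennreal_mult_less_top)
  then have "l2sq (\<lambda>v. f v l) * l2sq T < \<infinity>"
    using assms(2) by (simp add: ennreal_mult_less_top)
  then have "(nnsum (\<lambda>v. ennreal (cmod (f v l * T v))))\<^sup>2 < \<infinity>"
    using nnsum_mult_square_le le_less_trans by blast
  then have "nnsum (\<lambda>v. ennreal (cmod (f v l * T v))) < \<infinity>"
    by (simp add: power_less_top_ennreal)
  then show ?thesis by (simp add: summable_on_iff_nnsum)
qed

text \<open>The Cauchy-Schwarz inequality for each Grassmann coefficient, followed by an exchange of
  the sums over coefficients and indices.\<close>

lemma sqsum_family_pair:
  "sqsum grassmann_weight (family_pair f T) \<le> family_sqsum f * l2sq T"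
proof -
  have "sqsum grassmann_weight (family_pair f T) \<le>
      nnsum (\<lambda>l. (ennreal (grassmann_weight l) * l2sq (\<lambda>v. f v l)) * l2sq T)"
    unfolding sqsum_def[of grassmann_weight]
  proof (rule nn_integral_mono)
    fix l
    have "ennreal ((cmod (family_pair f T l))\<^sup>2) \<le> (nnsum (\<lambda>v. ennreal (cmod (f v l * T v))))\<^sup>2"
      unfolding family_pair_def
      by (subst ennreal_power[symmetric]) (auto intro!: power_mono cmod_infsum_le_nnsum)
    also have "\<dots> \<le> l2sq (\<lambda>v. f v l) * l2sq T" by (rule nnsum_mult_square_le)
    finally have "ennreal (grassmann_weight l) * ennreal ((cmod (family_pair f T l))\<^sup>2) \<le>
        ennreal (grassmann_weight l) * (l2sq (\<lambda>v. f v l) * l2sq T)"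
      by (rule mult_left_mono) simp
    then show "ennreal (grassmann_weight l * (cmod (family_pair f T l))\<^sup>2) \<le>
        (ennreal (grassmann_weight l) * l2sq (\<lambda>v. f v l)) * l2sq T"
      by (simp add: ennreal_mult' mult.assoc)
  qed
  also have "\<dots> = nnsum (\<lambda>l. nnsum (\<lambda>v. case (l, v) of (l, v) \<Rightarrow> ennreal (grassmann_weight l * (cmod (f v l))\<^sup>2))) * l2sq T"
    by (simp add: sqsum_def nn_integral_multc nn_integral_cmult ennreal_mult')
  also have "nnsum (\<lambda>l. nnsum (\<lambda>v. case (l, v) of (l, v) \<Rightarrow> ennreal (grassmann_weight l * (cmod (f v l))\<^sup>2))) =
      nnsum (\<lambda>v. nnsum (\<lambda>l. case (l, v) of (l, v) \<Rightarrow> ennreal (grassmann_weight l * (cmod (f v l))\<^sup>2)))"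
    by (simp only: nn_integral_fst_count_space nn_integral_snd_count_space)
  finally show ?thesis by (simp add: family_sqsum_def sqsum_def)
qed

subsection \<open>Linearity of the graded operations\<close>

lemma graded_proj_zero: "graded_proj \<pi> (\<lambda>_. 0) w = 0"
  by (simp add: graded_proj_def)

lemma graded_proj_sum: "graded_proj \<pi> (\<lambda>v. \<Sum>i\<in>I. T i v) w = (\<Sum>i\<in>I. graded_proj \<pi> (T i) w)"
  by (induction I rule: infinite_finite_induct) (simp_all add: graded_proj_zero graded_proj_add)

lemma graded_proj_swap:
  "graded_proj \<pi> (\<lambda>u. graded_proj \<rho> (\<lambda>v. T u v) h) l = graded_proj \<rho> (\<lambda>v. graded_proj \<pi> (\<lambda>u. T u v) l) h"
proof -
  let ?S = "{s. s permutes {..<length l}}" and ?R = "{s. s permutes {..<length h}}"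
  let ?k = "\<lambda>s. koszul \<pi> s (permute_list (inv s) l)" and ?m = "\<lambda>s. koszul \<rho> s (permute_list (inv s) h)"
  let ?T = "\<lambda>s r. T (permute_list (inv s) l) (permute_list (inv r) h)"
  have "graded_proj \<pi> (\<lambda>u. graded_proj \<rho> (\<lambda>v. T u v) h) l =
      (\<Sum>s\<in>?S. \<Sum>r\<in>?R. ?k s * (?m r * ?T s r)) / (fact (length h) * fact (length l))"
    by (simp add: graded_proj_def Let_def sum_distrib_left sum_divide_distrib)
  also have "(\<Sum>s\<in>?S. \<Sum>r\<in>?R. ?k s * (?m r * ?T s r)) = (\<Sum>r\<in>?R. \<Sum>s\<in>?S. ?m r * (?k s * ?T s r))"
    by (subst sum.swap) (simp add: mult.left_commute)
  also have "\<dots> / (fact (length h) * fact (length l)) =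
      graded_proj \<rho> (\<lambda>v. graded_proj \<pi> (\<lambda>u. T u v) l) h"
    by (simp add: graded_proj_def Let_def sum_distrib_left sum_divide_distrib mult.commute)
  finally show ?thesis .
qed

lemma graded_mult_cmult:
  "graded_mult \<pi> (\<lambda>u. c * F u) G = (\<lambda>w. c * graded_mult \<pi> F G w)"
  "graded_mult \<pi> F (\<lambda>u. c * G u) = (\<lambda>w. c * graded_mult \<pi> F G w)"
  unfolding graded_mult_def
  by (simp_all add: mult.assoc mult.left_commute[of _ c] graded_proj_cmult(1) sum_distrib_left)

lemma graded_mult_add:
  "graded_mult \<pi> (\<lambda>u. F u + F' u) G = (\<lambda>w. graded_mult \<pi> F G w + graded_mult \<pi> F' G w)"
  "graded_mult \<pi> F (\<lambda>u. G u + G' u) = (\<lambda>w. graded_mult \<pi> F G w + graded_mult \<pi> F G' w)"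
  unfolding graded_mult_def
  by (simp_all add: distrib_left distrib_right graded_proj_add sum.distrib)

lemma graded_mult_zero:
  "graded_mult \<pi> (\<lambda>_. 0) G = (\<lambda>_. 0)" "graded_mult \<pi> F (\<lambda>_. 0) = (\<lambda>_. 0)"
  by (simp_all add: graded_mult_def graded_proj_zero fun_eq_iff)

lemma graded_mult_sum:
  "graded_mult \<pi> (\<lambda>u. \<Sum>i\<in>I. F i u) G w = (\<Sum>i\<in>I. graded_mult \<pi> (F i) G w)"
  "graded_mult \<pi> G (\<lambda>u. \<Sum>i\<in>I. F i u) w = (\<Sum>i\<in>I. graded_mult \<pi> G (F i) w)"
  by (induction I rule: infinite_finite_induct) (simp_all add: graded_mult_zero graded_mult_add)

lemma has_sum_finite_sum:
  fixes f :: "'i \<Rightarrow> 'a \<Rightarrow> complex"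
  assumes "\<And>i. i \<in> I \<Longrightarrow> (f i has_sum S i) A"
  shows "((\<lambda>a. \<Sum>i\<in>I. f i a) has_sum (\<Sum>i\<in>I. S i)) A"
  using assms by (induction I rule: infinite_finite_induct) (auto intro: has_sum_add)

lemma has_sum_graded_proj:
  assumes "\<And>v. length v = length w \<Longrightarrow> ((\<lambda>a. T a v) has_sum S v) A"
  shows "((\<lambda>a. graded_proj \<pi> (T a) w) has_sum graded_proj \<pi> S w) A"
  unfolding graded_proj_def Let_def divide_inverse
  by (intro has_sum_cmult_left has_sum_finite_sum has_sum_cmult_right assms) simp

text \<open>A fixed coefficient of the product involves only finitely many pairs of subwords, and
  for each of them the double series factors by absolute convergence.\<close>

lemma has_sum_graded_mult:
  assumes A: "\<And>u. (\<lambda>v. cmod (A v u)) summable_on UNIV"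
    and B: "\<And>u. (\<lambda>v. cmod (B v u)) summable_on UNIV"
  shows "((\<lambda>(v, v'). graded_mult \<pi> (A v) (B v') l) has_sum
    graded_mult \<pi> (\<lambda>u. \<Sum>\<^sub>\<infinity>v. A v u) (\<lambda>u. \<Sum>\<^sub>\<infinity>v. B v u) l) UNIV"
proof -
  have "((\<lambda>(v, v'). A v u * B v' u') has_sum (\<Sum>\<^sub>\<infinity>v. A v u) * (\<Sum>\<^sub>\<infinity>v. B v u')) (UNIV \<times> UNIV)" for u u'
  proof (rule has_sum_SigmaI)
    have "nnsum (\<lambda>p. ennreal (cmod (case p of (v, v') \<Rightarrow> A v u * B v' u'))) =
        nnsum (\<lambda>(v, v'). ennreal (cmod (A v u)) * ennreal (cmod (B v' u')))"
      by (rule nn_integral_cong) (simp add: case_prod_unfold norm_mult ennreal_mult')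
    also have "\<dots> < \<infinity>"
      using A B by (simp add: nnsum_pair summable_on_iff_nnsum ennreal_mult_less_top)
    finally have "(\<lambda>p. cmod (case p of (v, v') \<Rightarrow> A v u * B v' u')) summable_on UNIV"
      by (simp add: summable_on_iff_nnsum)
    then show "(\<lambda>(v, v'). A v u * B v' u') summable_on UNIV \<times> UNIV"
      by (simp add: abs_summable_summable)
    show "((\<lambda>v'. case (v, v') of (v, v') \<Rightarrow> A v u * B v' u') has_sum A v u * (\<Sum>\<^sub>\<infinity>v. B v u')) UNIV" for v
      using has_sum_cmult_right[OF has_sum_infsum[OF abs_summable_summable[OF B]]] by simp
    show "((\<lambda>v. A v u * (\<Sum>\<^sub>\<infinity>v. B v u')) has_sum (\<Sum>\<^sub>\<infinity>v. A v u) * (\<Sum>\<^sub>\<infinity>v. B v u')) UNIV"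
      by (rule has_sum_cmult_left[OF has_sum_infsum[OF abs_summable_summable[OF A]]])
  qed
  then show ?thesis
    unfolding graded_mult_def case_prod_unfold UNIV_Times_UNIV
    by (intro has_sum_finite_sum has_sum_cmult_right has_sum_graded_proj)
qed

subsection \<open>Words of superspace coordinates\<close>

definition super_family :: "('h \<Rightarrow> bool) \<Rightarrow> ('h \<Rightarrow> 'l list \<Rightarrow> complex) \<Rightarrow> bool" where
  "super_family \<pi> f \<longleftrightarrow> (\<forall>a. alternating (f a) \<and> (\<forall>l. f a l \<noteq> 0 \<longrightarrow> (odd (length l) \<longleftrightarrow> \<pi> a)))"

definition word_prod :: "('h \<Rightarrow> 'l list \<Rightarrow> complex) \<Rightarrow> 'h list \<Rightarrow> 'l list \<Rightarrow> complex" where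
  "word_prod f w = family_prod (replicate (length w) f) w"

lemma word_prod_simps [simp]:
  "word_prod f [] = unit_tensor" "word_prod f (a # w) = f a \<cdot>\<^sub>\<Lambda> word_prod f w"
  by (simp_all add: word_prod_def)

lemma family_prod_length: "length fs \<noteq> length w \<Longrightarrow> family_prod fs w = (\<lambda>_. 0)"
  by (induction fs w rule: family_prod.induct) (auto simp: graded_mult_zero)

lemma family_prod_replicate: "family_prod (replicate n f) w = (if length w = n then word_prod f w else (\<lambda>_. 0))"
  by (simp add: word_prod_def family_prod_length)

lemma alternating_family_prod:
  "alternating (family_prod fs w)"
proof (induction fs w rule: family_prod.induct)
  case (2 f fs a v)
  show ?case by (simp add: alternating_grassmann_mult)
qed (simp_all add: alternating_unit, simp_all add: alternating_iff)

lemma alternating_word_prod: "alternating (word_prod f w)"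
  unfolding word_prod_def by (rule alternating_family_prod)

lemma alternating_family_pair:
  assumes "\<And>v. alternating (f v)"
  shows "alternating (family_pair f T)"
proof -
  have "f x (u @ b # a # v) = - f x (u @ a # b # v)" for x u a b v
    using assms[of x] unfolding alternating_iff by blast
  then show ?thesis
    unfolding alternating_iff family_pair_def infsum_uminus[symmetric]
    by (intro allI infsum_cong) (metis minus_mult_left)
qed

lemma word_prod_append:
  assumes "super_family \<pi> f"
  shows "word_prod f (u @ v) = word_prod f u \<cdot>\<^sub>\<Lambda> word_prod f v"
  using assms
  by (induction u)
    (simp_all add: grassmann_mult_unit alternating_word_prod grassmann_mult_assoc super_family_def)

lemma word_prod_graded_symmetric:
  assumes f: "super_family \<pi> f"
  shows "graded_symmetric \<pi> (\<lambda>w. word_prod f w l)"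
proof -
  have "word_prod f (u @ [b, a] @ v) = (\<lambda>l. swap_sign \<pi> a b * word_prod f (u @ [a, b] @ v) l)" for u a b v
  proof -
    have "f b \<cdot>\<^sub>\<Lambda> f a = (\<lambda>l. swap_sign \<pi> a b * (f a \<cdot>\<^sub>\<Lambda> f b) l)"
      using grassmann_mult_swap[of "f b" "f a" "\<pi> b" "\<pi> a"] f
      unfolding super_family_def swap_sign_def by (simp add: conj_commute)
    moreover have "word_prod f ([c, d] @ v) = (f c \<cdot>\<^sub>\<Lambda> f d) \<cdot>\<^sub>\<Lambda> word_prod f v" for c d
      using f by (simp add: grassmann_mult_assoc alternating_word_prod super_family_def)
    ultimately have "word_prod f ([b, a] @ v) = (\<lambda>l. swap_sign \<pi> a b * word_prod f ([a, b] @ v) l)"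
      by (simp only: graded_mult_cmult)
    then show ?thesis
      by (simp only: word_prod_append[OF f, of u] graded_mult_cmult)
  qed
  then show ?thesis unfolding graded_symmetric_def by metis
qed

section \<open>Coordinates of superspace points, of their powers and exponentials\<close>

definition coords :: "('l list \<times> 'h list \<Rightarrow> complex) \<Rightarrow> 'h \<Rightarrow> 'l list \<Rightarrow> complex" where
  "coords \<zeta> a = (\<lambda>l. \<zeta> (l, [a]))"

lemma superspaceD:
  assumes "\<zeta> \<in> superspace"
  shows "length h \<noteq> 1 \<Longrightarrow> \<zeta> (l, h) = 0" "l \<notin> lists gbasis \<Longrightarrow> \<zeta> (l, h) = 0"
    "h \<notin> lists hbasis \<Longrightarrow> \<zeta> (l, h) = 0"
  using assms unfolding superspace_def ext_fock_def by auto

lemma super_family_coords: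
  assumes "\<zeta> \<in> superspace"
  shows "super_family odd_vec (coords \<zeta>)"
  unfolding super_family_def coords_def
proof (intro allI conjI impI)
  fix a
  have "alt_proj (\<lambda>l. \<zeta> (l, [a])) = (\<lambda>l. \<zeta> (l, [a]))"
    using assms unfolding superspace_def ext_fock_def by blast
  then show "alternating (\<lambda>l. \<zeta> (l, [a]))"
    by (metis graded_symmetric_graded_proj)
  fix l assume "\<zeta> (l, [a]) \<noteq> 0"
  with assms show "odd (length l) \<longleftrightarrow> odd_vec a"
    unfolding superspace_def by fastforce
qed

text \<open>As \<open>\<zeta>\<close> lives on one-letter words, only the cut after the first letter
  survives in the Fock part. It carries the square root of n + 1, and these factors accumulate to
  the square root of n!.\<close>

lemma ext_power_superspace:
  assumes z: "\<zeta> \<in> superspace"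
  shows "ext_power \<zeta> n (l, h) =
    (if length h = n then complex_of_real (sqrt (fact n)) * word_prod (coords \<zeta>) h l else 0)"
proof (induction n arbitrary: l h)
  case 0
  then show ?case by (simp add: ext_tensor_def) (simp add: unit_tensor_def)
next
  case (Suc n)
  let ?f = "coords \<zeta>" and ?E = "ext_power \<zeta> n"
  let ?c = "\<lambda>n p. complex_of_real (sqrt (fact n / (fact p * fact (n - p))))"
  define X where "X U V r = graded_proj odd_vec (\<lambda>v. \<zeta> (U, take r v) * ?E (V, drop r v)) h" for U V r
  have X0: "X U V r = 0" if "r \<le> length h" "r \<noteq> 1 \<or> length h \<noteq> Suc n" for U V r
  proof -
    have "X U V r = graded_proj odd_vec (\<lambda>_. 0) h"
      unfolding X_def using that superspaceD(1)[OF z]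
      by (intro graded_proj_cong) (auto simp: Suc.IH)
    then show ?thesis by (simp add: graded_proj_zero)
  qed
  have em: "ext_power \<zeta> (Suc n) (l, h) = (\<Sum>p\<le>length l. ?c (length l) p *
      alt_proj (\<lambda>u. \<Sum>r\<le>length h. ?c (length h) r * X (take p u) (drop p u) r) l)"
    by (simp add: ext_mult_def X_def)
  show ?case
  proof (cases "length h = Suc n")
    case False
    then show ?thesis unfolding em by (simp add: X0 graded_proj_zero)
  next
    case True
    let ?K = "complex_of_real (sqrt (fact (Suc n)))"
    have X1: "(\<Sum>r\<le>length h. ?c (length h) r * X U V r) =
        ?K * graded_proj odd_vec (\<lambda>v. ?f (hd v) U * word_prod ?f (tl v) V) h" for U V
    proof -
      have "(\<Sum>r\<le>length h. ?c (length h) r * X U V r) = (\<Sum>r\<in>{1}. ?c (length h) r * X U V r)"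
        using True X0 by (intro sum.mono_neutral_right) auto
      also have "\<dots> = ?c (length h) 1 * X U V 1" by simp
      also have "X U V 1 = complex_of_real (sqrt (fact n)) *
          graded_proj odd_vec (\<lambda>v. ?f (hd v) U * word_prod ?f (tl v) V) h"
        unfolding X_def graded_proj_cmult(1)[symmetric]
      proof (rule graded_proj_cong)
        fix v :: "'b list" assume "length v = length h"
        then obtain a v' where v: "v = a # v'" "length v' = n" using True by (cases v) auto
        then show "\<zeta> (U, take 1 v) * ?E (V, drop 1 v) =
            complex_of_real (sqrt (fact n)) * (?f (hd v) U * word_prod ?f (tl v) V)"
          by (simp add: Suc.IH coords_def)
      qed
      finally show ?thesis using True
        by (simp add: real_sqrt_mult del: of_nat_Suc) simp
    qed
    \<comment> \<open>The two projections act on different words and commute. With the Fock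
      projection outside, the Grassmann product can be assembled and prolongs the word product by
      one letter.\<close>
    have "ext_power \<zeta> (Suc n) (l, h) = (\<Sum>p\<le>length l. ?c (length l) p *
      (?K * graded_proj odd_vec (\<lambda>v. alt_proj (\<lambda>u. ?f (hd v) (take p u) * word_prod ?f (tl v) (drop p u)) l) h))"
      unfolding em X1 graded_proj_cmult(1) graded_proj_swap[of "\<lambda>_. True"] ..
    also have "\<dots> = ?K * graded_proj odd_vec (\<lambda>v. (?f (hd v) \<cdot>\<^sub>\<Lambda> word_prod ?f (tl v)) l) h"
      unfolding graded_mult_def graded_proj_sum graded_proj_cmult(1) sum_distrib_left
      by (simp add: mult.left_commute)
    also have "graded_proj odd_vec (\<lambda>v. (?f (hd v) \<cdot>\<^sub>\<Lambda> word_prod ?f (tl v)) l) h =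
        graded_proj odd_vec (\<lambda>v. word_prod ?f v l) h"
    proof (rule graded_proj_cong)
      fix v :: "'b list" assume "length v = length h"
      then show "(?f (hd v) \<cdot>\<^sub>\<Lambda> word_prod ?f (tl v)) l = word_prod ?f v l"
        using True by (cases v) auto
    qed
    also have "\<dots> = word_prod ?f h l"
      using graded_proj_symmetric[OF word_prod_graded_symmetric[OF super_family_coords[OF z]]] by metis
    finally show ?thesis using True by simp
  qed
qed

lemma ext_exp_superspace:
  assumes "\<zeta> \<in> superspace"
  shows "ext_exp \<zeta> (l, h) = word_prod (coords \<zeta>) h l / complex_of_real (sqrt (fact (length h)))"
proof -
  define s where "s = sqrt (fact (length h))"
  have s: "s * s = fact (length h)" "s \<noteq> 0" by (simp_all add: s_def)
  have "ext_exp \<zeta> (l, h) = (\<Sum>p\<in>{length h}. ext_power \<zeta> p (l, h) / fact p)"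
    unfolding ext_exp_def prod.case
    by (rule suminf_finite) (auto simp: ext_power_superspace[OF assms])
  also have "\<dots> = complex_of_real s * word_prod (coords \<zeta>) h l / complex_of_real (s * s)"
    by (simp add: ext_power_superspace[OF assms] s) (simp add: s_def)
  also have "\<dots> = word_prod (coords \<zeta>) h l / complex_of_real s"
    using s(2) by simp
  finally show ?thesis by (simp add: s_def)
qed

lemma odd_vec_star: "odd_vec (star a) \<longleftrightarrow> odd_vec a"
proof -
  have "odd_vec (star a)" if "odd_vec a" for a :: 'a
    using that unfolding odd_vec_def graded_part_def
    by (auto simp: star_add star_star) (metis add.commute)
  then show ?thesis by (metis star_star)
qed

text \<open>The star comes from \<open>fock_star\<close>, which evaluates the exponential at the
  starred word.\<close>

definition dual_coords ::
    "('l list \<times> 'h::graded_hilbert_space list \<Rightarrow> complex) \<Rightarrow> 'h \<Rightarrow> 'l list \<Rightarrow> complex" where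
  "dual_coords \<zeta> a = coords \<zeta> (star a)"

lemma super_family_dual_coords: "\<zeta> \<in> superspace \<Longrightarrow> super_family odd_vec (dual_coords \<zeta>)"
  using super_family_coords[of \<zeta>] unfolding super_family_def dual_coords_def by (simp add: odd_vec_star)

lemma word_prod_map_star: "word_prod (coords \<zeta>) (map star w) = word_prod (dual_coords \<zeta>) w"
  by (induction w) (simp_all add: dual_coords_def)

lemma word_prod_dual_coords_support:
  assumes "\<zeta> \<in> superspace" "w \<notin> lists hbasis"
  shows "word_prod (dual_coords \<zeta>) w = (\<lambda>_. 0)"
  using assms(2)
proof (induction w)
  case (Cons a w)
  have "dual_coords \<zeta> a = (\<lambda>_. 0)" if "a \<notin> hbasis"
    using superspaceD(3)[OF assms(1), of "[star a]"] that by (simp add: dual_coords_def coords_def)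
  then show ?case using Cons by (cases "a \<in> hbasis") (auto simp: graded_mult_zero)
qed simp

text \<open>Absorbs the factor that the exponential leaves at \<open>w\<close>. It also removes the
  square roots from \<open>\<odot>\<close>: the coefficients of a product become the sum over all
  cuts of the projected products of coefficients.\<close>

definition exp_coeffs :: "('h list \<Rightarrow> complex) \<Rightarrow> 'h list \<Rightarrow> complex" where
  "exp_coeffs F w = F w / complex_of_real (sqrt (fact (length w)))"

lemma phi_superspace:
  assumes z: "\<zeta> \<in> superspace"
  shows "phi F \<zeta> = family_pair (word_prod (dual_coords \<zeta>)) (exp_coeffs F)"
proof
  fix l
  let ?P = "family_pair (word_prod (dual_coords \<zeta>)) (exp_coeffs F)"
  let ?c = "\<lambda>n p. complex_of_real (sqrt (fact n / (fact p * fact (n - p))))"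
  have pair: "fock_pairing (\<lambda>v. ext_exp \<zeta> (u, v)) F = ?P u" for u
    unfolding fock_pairing_def fock_inner_def fock_star_def complex_cnj_cnj family_pair_def
    by (rule infsum_cong_neutral)
      (auto simp: ext_exp_superspace[OF z] word_prod_map_star word_prod_dual_coords_support[OF z] exp_coeffs_def)
  \<comment> \<open>The Grassmann part of the second argument is the unit, so that only the cut with
    an empty right piece contributes.\<close>
  have "phi F \<zeta> l = (\<Sum>p\<in>{length l}. ?c (length l) p *
      alt_proj (\<lambda>u. fock_pairing (\<lambda>v. ext_exp \<zeta> (take p u, v)) (\<lambda>v. ext_tensor unit_tensor F (drop p u, v))) l)"
    unfolding phi_def ext_pairing_def
  proof (rule sum.mono_neutral_right, simp, simp, rule ballI)
    fix p assume p: "p \<in> {..length l} - {length l}"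
    have "alt_proj (\<lambda>u. fock_pairing (\<lambda>v. ext_exp \<zeta> (take p u, v)) (\<lambda>v. ext_tensor unit_tensor F (drop p u, v))) l =
        alt_proj (\<lambda>_. 0) l"
      using p by (intro graded_proj_cong)
        (auto simp: ext_tensor_def unit_tensor_def fock_pairing_def fock_inner_def)
    then show "?c (length l) p * alt_proj (\<lambda>u. fock_pairing (\<lambda>v. ext_exp \<zeta> (take p u, v)) (\<lambda>v. ext_tensor unit_tensor F (drop p u, v))) l = 0"
      by (simp add: graded_proj_zero)
  qed
  also have "\<dots> = alt_proj ?P l"
    by (auto simp: ext_tensor_def unit_tensor_def pair intro!: graded_proj_cong)
  also have "\<dots> = ?P l"
    by (simp add: graded_proj_symmetric alternating_family_pair alternating_word_prod)
  finally show "phi F \<zeta> l = ?P l" .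
qed

subsection \<open>Finite Fock vectors\<close>

text \<open>What is used about an element of \<open>S_fin\<close>: degrees below \<open>N\<close>
  only, and a finite norm.\<close>

definition finite_fock :: "nat \<Rightarrow> ('h list \<Rightarrow> complex) \<Rightarrow> bool" where
  "finite_fock N F \<longleftrightarrow> (\<forall>w. N \<le> length w \<longrightarrow> F w = 0) \<and> l2sq F < \<infinity>"

lemma finite_fock_mono: "finite_fock N F \<Longrightarrow> N \<le> M \<Longrightarrow> finite_fock M F"
  by (auto simp: finite_fock_def)

lemma l2sq_mono: "(\<And>i. cmod (x i) \<le> cmod (y i)) \<Longrightarrow> l2sq x \<le> l2sq y"
  unfolding sqsum_def by (intro nn_integral_mono ennreal_leI) (simp add: power_mono)

lemma l2sq_exp_coeffs:
  assumes "l2sq F < \<infinity>"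
  shows "l2sq (exp_coeffs F) < \<infinity>"
proof -
  have "cmod (exp_coeffs F w) \<le> cmod (F w)" for w
    using mult_right_mono[of 1 "sqrt (fact (length w))" "cmod (F w)"]
    by (simp add: exp_coeffs_def norm_divide divide_le_eq mult.commute)
  then show ?thesis using l2sq_mono le_less_trans assms by blast
qed

lemma family_sqsum_family_prod_finite:
  assumes "\<And>f. f \<in> set fs \<Longrightarrow> family_sqsum f < \<infinity>"
  shows "family_sqsum (family_prod fs) < \<infinity>"
proof -
  have "prod_list (map (\<lambda>f. 3 * family_sqsum f) fs) < \<infinity>"
    using assms by (induction fs) (auto simp: ennreal_mult_less_top)
  then show ?thesis using family_sqsum_family_prod le_less_trans by blast
qed

lemma ext_weight_nonneg [simp]: "0 \<le> ext_weight p"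
  by (simp add: ext_weight_def case_prod_unfold)

text \<open>The involution permutes the letters, and the one-letter words contribute only a part of
  the whole sum.\<close>

lemma family_sqsum_dual_coords:
  fixes \<zeta> :: "'l list \<times> 'h::graded_hilbert_space list \<Rightarrow> complex"
  shows "family_sqsum (dual_coords \<zeta>) \<le> sqsum ext_weight \<zeta>"
proof -
  let ?g = "\<lambda>p. ennreal (ext_weight p * (cmod (\<zeta> p))\<^sup>2)"
  let ?i = "\<lambda>(a, l). (l, [a])"
  have "bij (star :: 'h \<Rightarrow> 'h)"
    by (rule bij_betwI[where g = star]) (auto simp: star_star)
  then have "family_sqsum (dual_coords \<zeta>) = family_sqsum (coords \<zeta>)"
    unfolding family_sqsum_def dual_coords_def
    by (intro nn_integral_bij_count_space[of star UNIV UNIV])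
  also have "\<dots> = nnsum (\<lambda>a. nnsum (\<lambda>l. ?g (?i (a, l))))"
    by (simp add: family_sqsum_def sqsum_def coords_def ext_weight_def)
  also have "\<dots> = nnsum (\<lambda>al. ?g (?i al))"
    by (rule nn_integral_fst_count_space)
  also have "\<dots> = (\<integral>\<^sup>+ p. ?g p \<partial>count_space (range ?i))"
    by (rule nn_integral_bij_count_space) (auto intro!: inj_on_imp_bij_betw injI)
  also have "\<dots> = nnsum (\<lambda>p. ?g p * indicator (range ?i) p)"
    by (rule nn_integral_count_space_indicator) (simp add: NO_MATCH_def)
  also have "\<dots> \<le> sqsum ext_weight \<zeta>"
    unfolding sqsum_def by (rule nn_integral_mono) (simp add: indicator_def)
  finally show ?thesis .
qed

lemma sqsum_superspace: "\<zeta> \<in> superspace \<Longrightarrow> sqsum ext_weight \<zeta> < \<infinity>"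
  by (simp add: superspace_def ext_fock_def weighted_l2_iff)

lemma family_sqsum_superspace: "\<zeta> \<in> superspace \<Longrightarrow> family_sqsum (dual_coords \<zeta>) < \<infinity>"
  using family_sqsum_dual_coords sqsum_superspace le_less_trans by blast

lemma family_pair_has_sum:
  assumes "family_sqsum f < \<infinity>" "l2sq T < \<infinity>"
  shows "((\<lambda>v. f v l * T v) has_sum family_pair f T l) UNIV"
  unfolding family_pair_def
  by (rule has_sum_infsum, rule abs_summable_summable, rule family_pair_summable[OF assms])

lemma has_sum_words:
  "((\<lambda>w. family_prod (replicate n f) w l * T w) has_sum S) UNIV \<longleftrightarrow>
   ((\<lambda>w. word_prod f w l * T w) has_sum S) {w. length w = n}"
  by (rule has_sum_cong_neutral) (auto simp: family_prod_replicate)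

lemma phi_has_sum:
  assumes z: "\<zeta> \<in> superspace" and F: "\<And>w. N \<le> length w \<Longrightarrow> F w = 0"
    and S: "\<And>n. n < N \<Longrightarrow>
      ((\<lambda>w. family_prod (replicate n (dual_coords \<zeta>)) w l * exp_coeffs F w) has_sum S n) UNIV"
  shows "phi F \<zeta> l = (\<Sum>n<N. S n)"
proof -
  have "((\<lambda>w. \<Sum>n<N. family_prod (replicate n (dual_coords \<zeta>)) w l * exp_coeffs F w) has_sum (\<Sum>n<N. S n)) UNIV"
    by (rule has_sum_finite_sum) (simp add: S)
  moreover have "(\<Sum>n<N. family_prod (replicate n (dual_coords \<zeta>)) w l * exp_coeffs F w) =
      word_prod (dual_coords \<zeta>) w l * exp_coeffs F w" for w
  proof -
    have "(\<Sum>n<N. family_prod (replicate n (dual_coords \<zeta>)) w l * exp_coeffs F w) =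
        (\<Sum>n<N. if n = length w then word_prod (dual_coords \<zeta>) w l * exp_coeffs F w else 0)"
      by (rule sum.cong) (auto simp: family_prod_replicate)
    then show ?thesis using F[of w] by (auto simp: exp_coeffs_def not_less)
  qed
  ultimately show ?thesis
    unfolding phi_superspace[OF z] family_pair_def by (simp add: infsumI)
qed

lemma phi_finite_fock:
  assumes z: "\<zeta> \<in> superspace" and F: "finite_fock N F"
  shows "phi F \<zeta> l =
    (\<Sum>n<N. family_pair (family_prod (replicate n (dual_coords \<zeta>))) (exp_coeffs F) l)"
proof (rule phi_has_sum[OF z])
  show "((\<lambda>w. family_prod (replicate n (dual_coords \<zeta>)) w l * exp_coeffs F w) has_sum
    family_pair (family_prod (replicate n (dual_coords \<zeta>))) (exp_coeffs F) l) UNIV" for n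
    using F family_sqsum_superspace[OF z]
    by (intro family_pair_has_sum family_sqsum_family_prod_finite l2sq_exp_coeffs)
      (auto simp: finite_fock_def)
qed (use F in \<open>simp add: finite_fock_def\<close>)

lemma phi_linear:
  assumes z: "\<zeta> \<in> superspace" and F: "finite_fock N F" and G: "finite_fock M G"
  shows "phi (\<lambda>w. a * F w + b * G w) \<zeta> l = a * phi F \<zeta> l + b * phi G \<zeta> l"
proof -
  let ?K = "max N M" and ?W = "\<lambda>n. family_prod (replicate n (dual_coords \<zeta>))"
  have FK: "finite_fock ?K F" and GK: "finite_fock ?K G"
    using F G by (auto intro: finite_fock_mono)
  have hs: "((\<lambda>w. ?W n w l * exp_coeffs H w) has_sum family_pair (?W n) (exp_coeffs H) l) UNIV"
    if "finite_fock ?K H" for H n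
    using that family_sqsum_superspace[OF z]
    by (intro family_pair_has_sum family_sqsum_family_prod_finite l2sq_exp_coeffs)
      (auto simp: finite_fock_def)
  have "phi (\<lambda>w. a * F w + b * G w) \<zeta> l =
      (\<Sum>n<?K. a * family_pair (?W n) (exp_coeffs F) l + b * family_pair (?W n) (exp_coeffs G) l)"
  proof (rule phi_has_sum[OF z])
    fix n
    have "((\<lambda>w. a * (?W n w l * exp_coeffs F w) + b * (?W n w l * exp_coeffs G w)) has_sum
      a * family_pair (?W n) (exp_coeffs F) l + b * family_pair (?W n) (exp_coeffs G) l) UNIV"
      by (intro has_sum_add has_sum_cmult_right hs FK GK)
    then show "((\<lambda>w. ?W n w l * exp_coeffs (\<lambda>w. a * F w + b * G w) w) has_sum
      a * family_pair (?W n) (exp_coeffs F) l + b * family_pair (?W n) (exp_coeffs G) l) UNIV"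
      by (simp add: exp_coeffs_def algebra_simps add_divide_distrib)
  qed (use FK GK in \<open>auto simp: finite_fock_def\<close>)
  then show ?thesis
    by (simp add: phi_finite_fock[OF z FK] phi_finite_fock[OF z GK] sum.distrib sum_distrib_left)
qed

lemma phi_unit:
  assumes z: "\<zeta> \<in> superspace"
  shows "phi unit_tensor \<zeta> = unit_tensor"
proof
  fix l
  have "((\<lambda>w. family_prod (replicate 0 (dual_coords \<zeta>)) w l * exp_coeffs unit_tensor w) has_sum unit_tensor l) {[]}"
    by (rule has_sum_finiteI) (auto simp: exp_coeffs_def unit_tensor_def)
  then have "((\<lambda>w. family_prod (replicate 0 (dual_coords \<zeta>)) w l * exp_coeffs unit_tensor w) has_sum unit_tensor l) UNIV"
    by (rule has_sum_cong_neutral[THEN iffD1, rotated -1]) (auto simp: exp_coeffs_def unit_tensor_def)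
  then have "phi unit_tensor \<zeta> l = (\<Sum>n<Suc 0. unit_tensor l)"
    by (intro phi_has_sum[OF z]) (auto simp: unit_tensor_def)
  then show "phi unit_tensor \<zeta> l = unit_tensor l" by simp
qed

subsection \<open>Multiplicativity\<close>

text \<open>The projection is self-adjoint for the bilinear pairing and fixes \<open>x\<close>. For
  each permutation the series is reindexed within the words of length \<open>n\<close>, and the sign
  taken up by \<open>x\<close> cancels the one in the projection.\<close>

lemma has_sum_graded_proj_adjoint:
  assumes x: "graded_symmetric \<pi> x" and S: "((\<lambda>w. x w * T w) has_sum S) {w. length w = n}"
  shows "((\<lambda>w. x w * graded_proj \<pi> T w) has_sum S) {w. length w = n}"
proof -
  let ?W = "{w :: 'a list. length w = n}" and ?P = "{s. s permutes {..<n}}"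
  define g where "g w = x w * T w" for w
  have each: "((\<lambda>w. g (permute_list (inv s) w)) has_sum S) ?W" if "s \<in> ?P" for s
  proof -
    have "bij_betw (permute_list (inv s)) ?W ?W"
    proof (rule bij_betwI[where g = "permute_list s"])
      show "permute_list s (permute_list (inv s) l) = l" "permute_list (inv s) (permute_list s l) = l"
        if "l \<in> ?W" for l
        using that \<open>s \<in> ?P\<close>
        by (simp_all add: permutes_inv_o permutes_inv permute_list_compose[symmetric])
    qed auto
    then show ?thesis
      using has_sum_reindex_bij_betw[of "permute_list (inv s)" ?W ?W g S] S
      by (simp add: g_def[abs_def])
  qed
  have eq: "(\<Sum>s\<in>?P. g (permute_list (inv s) w)) / fact n = x w * graded_proj \<pi> T w" if w: "w \<in> ?W" for w
  proof -
    have "g (permute_list (inv s) w) = x w * (koszul \<pi> s (permute_list (inv s) w) * T (permute_list (inv s) w))"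
      if s: "s \<in> ?P" for s
    proof -
      let ?v = "permute_list (inv s) w"
      have "permute_list s ?v = w"
        using w s by (simp add: permutes_inv_o permute_list_compose[symmetric])
      then have "x w = koszul \<pi> s ?v * x ?v"
        using graded_symmetric_permute[OF x, of s ?v] w s by simp
      then show ?thesis
        using koszul_square[of \<pi> s ?v] unfolding g_def
        by (metis (no_types, opaque_lifting) mult.assoc mult.commute mult_1)
    qed
    then show ?thesis
      using w by (simp add: graded_proj_def Let_def sum_distrib_left)
  qed
  have "((\<lambda>w. (\<Sum>s\<in>?P. g (permute_list (inv s) w)) / fact n) has_sum (\<Sum>s\<in>?P. S) / fact n) ?W"
    unfolding divide_inverse by (intro has_sum_cmult_left has_sum_finite_sum each)
  moreover have "(\<Sum>s\<in>?P. S) / fact n = S"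
    by (simp add: card_permutations)
  ultimately show ?thesis
    using has_sum_cong[of ?W _ _ S, OF eq] by simp
qed

text \<open>The product is a double series over pairs of words. Cutting after \<open>p\<close>
  letters identifies these pairs with the words of length \<open>p + q\<close>, and
  \<open>word_prod_append\<close> identifies the summands.\<close>

lemma grassmann_mult_family_pair:
  assumes f: "super_family \<pi> f" "family_sqsum f < \<infinity>" and T: "l2sq T < \<infinity>" and U: "l2sq U < \<infinity>"
  shows "((\<lambda>w. word_prod f w l * (T (take p w) * U (drop p w))) has_sum
    (family_pair (family_prod (replicate p f)) T \<cdot>\<^sub>\<Lambda> family_pair (family_prod (replicate q f)) U) l)
    {w. length w = p + q}"
proof -
  let ?W = "\<lambda>n. family_prod (replicate n f)"
  let ?A = "{(v, v'). length v = p \<and> length v' = q}"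
  have abs: "(\<lambda>v. cmod (?W n v u * T v)) summable_on UNIV" if "l2sq T < \<infinity>" for n u and T :: "'a list \<Rightarrow> complex"
    using that f by (intro family_pair_summable family_sqsum_family_prod_finite) auto
  have "((\<lambda>(v, v'). ((\<lambda>u. ?W p v u * T v) \<cdot>\<^sub>\<Lambda> (\<lambda>u. ?W q v' u * U v')) l) has_sum
      ((family_pair (?W p) T) \<cdot>\<^sub>\<Lambda> (family_pair (?W q) U)) l) UNIV" (is "(?L has_sum ?S) _")
    unfolding family_pair_def[abs_def]
    by (rule has_sum_graded_mult) (rule abs[OF T], rule abs[OF U])
  moreover have L: "?L (v, v') = (?W p v \<cdot>\<^sub>\<Lambda> ?W q v') l * (T v * U v')" for v v'
    using fun_cong[OF graded_mult_cmult(1)[of "\<lambda>_. True" "T v" "?W p v" "\<lambda>u. U v' * ?W q v' u"], of l]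
      fun_cong[OF graded_mult_cmult(2)[of "\<lambda>_. True" "?W p v" "U v'" "?W q v'"], of l]
    by (simp add: mult_ac)
  ultimately have "(?L has_sum ?S) ?A"
    by (subst has_sum_cong_neutral[of UNIV ?A ?L ?L])
      (auto simp: L family_prod_replicate graded_mult_zero split: if_splits)
  moreover have "bij_betw (\<lambda>w. (take p w, drop p w)) {w :: 'a list. length w = p + q} ?A"
    by (rule bij_betwI[where g = "\<lambda>(v, v'). v @ v'"]) auto
  ultimately have "((\<lambda>w. ?L (take p w, drop p w)) has_sum ?S) {w. length w = p + q}"
    using has_sum_reindex_bij_betw by blast
  then show ?thesis
  proof (rule has_sum_cong[THEN iffD1, rotated])
    fix w :: "'a list" assume "w \<in> {w. length w = p + q}"
    then show "?L (take p w, drop p w) = word_prod f w l * (T (take p w) * U (drop p w))"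
      unfolding L using word_prod_append[OF f(1), of "take p w" "drop p w"]
      by (simp add: family_prod_replicate)
  qed
qed

lemma phi_mult:
  assumes z: "\<zeta> \<in> superspace" and F: "finite_fock N F" and G: "finite_fock M G"
  shows "phi (F \<odot> G) \<zeta> l = (phi F \<zeta> \<cdot>\<^sub>\<Lambda> phi G \<zeta>) l"
proof -
  let ?f = "dual_coords \<zeta>"
  define P where "P H p = family_pair (family_prod (replicate p ?f)) (exp_coeffs H)" for H p
  have P0: "P H p = (\<lambda>_. 0)" if "finite_fock K H" "K \<le> p" for H K p
  proof -
    have "family_prod (replicate p ?f) w l * exp_coeffs H w = 0" for w l
      using that by (auto simp: family_prod_replicate exp_coeffs_def finite_fock_def)
    then show ?thesis by (intro ext) (simp only: P_def family_pair_def infsum_0_simp)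
  qed
  \<comment> \<open>Any cut of a word of length at least \<open>N + M\<close> leaves at least
    \<open>N\<close> letters on the left or at least \<open>M\<close> on the right, so
    \<open>N + M\<close> bounds the degree of the product.\<close>
  have "phi (F \<odot> G) \<zeta> l = (\<Sum>n<N + M. \<Sum>p\<le>n. (P F p \<cdot>\<^sub>\<Lambda> P G (n - p)) l)"
  proof (rule phi_has_sum[OF z])
    fix w :: "'b list" assume w: "N + M \<le> length w"
    have "graded_proj odd_vec (\<lambda>v. F (take p v) * G (drop p v)) w = graded_proj odd_vec (\<lambda>_. 0) w"
      if "p \<le> length w" for p
    proof (rule graded_proj_cong)
      fix v :: "'b list" assume "length v = length w"
      then have "N \<le> length (take p v) \<or> M \<le> length (drop p v)" using w that by auto
      then show "F (take p v) * G (drop p v) = 0" using F G unfolding finite_fock_def by auto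
    qed
    then show "(F \<odot> G) w = 0" unfolding graded_mult_def by (simp add: graded_proj_zero)
  next
    fix n
    let ?T = "\<lambda>p v. exp_coeffs F (take p v) * exp_coeffs G (drop p v)"
    have "((\<lambda>w. word_prod ?f w l * graded_proj odd_vec (?T p) w) has_sum (P F p \<cdot>\<^sub>\<Lambda> P G (n - p)) l) {w. length w = n}"
      if "p \<le> n" for p
    proof (rule has_sum_graded_proj_adjoint)
      show "graded_symmetric odd_vec (\<lambda>w. word_prod ?f w l)"
        by (rule word_prod_graded_symmetric[OF super_family_dual_coords[OF z]])
      show "((\<lambda>w. word_prod ?f w l * ?T p w) has_sum (P F p \<cdot>\<^sub>\<Lambda> P G (n - p)) l) {w. length w = n}"
        using grassmann_mult_family_pair[OF super_family_dual_coords[OF z] family_sqsum_superspace[OF z]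
            l2sq_exp_coeffs l2sq_exp_coeffs, of F G l p "n - p"] F G that
        by (simp add: P_def finite_fock_def)
    qed
    then have "((\<lambda>w. \<Sum>p\<le>n. word_prod ?f w l * graded_proj odd_vec (?T p) w) has_sum
        (\<Sum>p\<le>n. (P F p \<cdot>\<^sub>\<Lambda> P G (n - p)) l)) {w. length w = n}"
      by (intro has_sum_finite_sum) simp
    moreover have eq: "(\<Sum>p\<le>n. word_prod ?f w l * graded_proj odd_vec (?T p) w) =
        word_prod ?f w l * exp_coeffs (F \<odot> G) w" if w: "length w = n" for w
    proof -
      have "graded_proj odd_vec (?T p) w =
          complex_of_real (sqrt (fact n / (fact p * fact (n - p)))) *
            graded_proj odd_vec (\<lambda>v. F (take p v) * G (drop p v)) w / complex_of_real (sqrt (fact n))"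
        if p: "p \<le> n" for p
      proof -
        have "graded_proj odd_vec (?T p) w = graded_proj odd_vec
            (\<lambda>v. complex_of_real (1 / (sqrt (fact p) * sqrt (fact (n - p)))) * (F (take p v) * G (drop p v))) w"
          using w p by (intro graded_proj_cong) (simp add: exp_coeffs_def min_def)
        also have "\<dots> = complex_of_real (1 / (sqrt (fact p) * sqrt (fact (n - p)))) *
            graded_proj odd_vec (\<lambda>v. F (take p v) * G (drop p v)) w"
          by (rule graded_proj_cmult)
        finally show ?thesis
          by (simp add: real_sqrt_divide real_sqrt_mult)
      qed
      then have "(\<Sum>p\<le>n. graded_proj odd_vec (?T p) w) = exp_coeffs (F \<odot> G) w"
        unfolding exp_coeffs_def graded_mult_def w sum_divide_distrib by (intro sum.cong) auto
      then show ?thesis by (simp flip: sum_distrib_left)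
    qed
    ultimately have "((\<lambda>w. word_prod ?f w l * exp_coeffs (F \<odot> G) w) has_sum
        (\<Sum>p\<le>n. (P F p \<cdot>\<^sub>\<Lambda> P G (n - p)) l)) {w. length w = n}"
      by (auto intro: has_sum_cong[THEN iffD1, rotated])
    then show "((\<lambda>w. family_prod (replicate n ?f) w l * exp_coeffs (F \<odot> G) w) has_sum
        (\<Sum>p\<le>n. (P F p \<cdot>\<^sub>\<Lambda> P G (n - p)) l)) UNIV"
      unfolding has_sum_words .
  qed
  also have "\<dots> = (\<Sum>(p, q)\<in>{(p, q). p + q < N + M}. (P F p \<cdot>\<^sub>\<Lambda> P G q) l)"
    by (rule sum.triangle_reindex[symmetric])
  \<comment> \<open>The triangle contains the rectangle, and outside the rectangle one of the two
    blocks vanishes.\<close>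
  also have "\<dots> = (\<Sum>(p, q)\<in>{..<N} \<times> {..<M}. (P F p \<cdot>\<^sub>\<Lambda> P G q) l)"
  proof (rule sum.mono_neutral_right)
    show "finite {(p, q). p + q < N + M}"
      by (rule finite_subset[of _ "{..<N + M} \<times> {..<N + M}"]) auto
    have zero: "(P F p \<cdot>\<^sub>\<Lambda> P G q) l = 0" if "\<not> (p < N \<and> q < M)" for p q
    proof -
      have "P F p = (\<lambda>_. 0) \<or> P G q = (\<lambda>_. 0)"
        using that P0[OF F, of p] P0[OF G, of q] by linarith
      then show ?thesis by (auto simp: graded_mult_zero)
    qed
    show "\<forall>i\<in>{(p, q). p + q < N + M} - {..<N} \<times> {..<M}. (case i of (p, q) \<Rightarrow> (P F p \<cdot>\<^sub>\<Lambda> P G q) l) = 0"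
      by (auto intro!: zero)
  qed auto
  also have "\<dots> = (\<Sum>p<N. \<Sum>q<M. (P F p \<cdot>\<^sub>\<Lambda> P G q) l)"
    by (rule sum.cartesian_product[symmetric])
  also have "\<dots> = ((\<lambda>u. \<Sum>p<N. P F p u) \<cdot>\<^sub>\<Lambda> (\<lambda>u. \<Sum>q<M. P G q u)) l"
    by (rule trans[OF _ graded_mult_sum(1)[symmetric]])
      (intro sum.cong refl graded_mult_sum(2)[symmetric])
  also have "(\<lambda>u. \<Sum>p<N. P F p u) = phi F \<zeta>"
    by (simp add: fun_eq_iff phi_finite_fock[OF z F] P_def)
  also have "(\<lambda>u. \<Sum>q<M. P G q u) = phi G \<zeta>"
    by (simp add: fun_eq_iff phi_finite_fock[OF z G] P_def)
  finally show ?thesis .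
qed

subsection \<open>Square summability of finite Fock vectors\<close>

lemma is_onb_creation: "is_onb (creation k) (onb (creation k))"
  by (rule is_onb_onb[OF creation_scaleC])

lemma creation_distinct_orthogonal:
  assumes "x \<in> creation k" "y \<in> creation m" "k \<noteq> m"
  shows "cinner x y = 0"
  using assms creation_orthogonal[of x y] creation_orthogonal[of y x] cinner_commute[of x y]
  by (cases k; cases m) auto

lemma hbasis_orthonormal:
  assumes "a \<in> hbasis" "b \<in> hbasis"
  shows "cinner a a = 1" "a \<noteq> b \<Longrightarrow> cinner a b = 0"
proof -
  let ?O = "\<lambda>k. onb (creation k) :: 'a set"
  have onb: "x \<in> creation k" "cinner x x = 1" if "x \<in> ?O k" for x k
    using conjunct1[OF is_onb_creation[of k, unfolded is_onb_def]]
      conjunct1[OF conjunct2[OF is_onb_creation[of k, unfolded is_onb_def]]] that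
    by blast+
  have orth: "cinner x y = 0" if "x \<in> ?O k" "y \<in> ?O m" "x \<noteq> y" for x y k m
  proof (cases "k = m")
    case True
    then show ?thesis
      using conjunct1[OF conjunct2[OF conjunct2[OF is_onb_creation[of k, unfolded is_onb_def]]]] that
      by blast
  next
    case False
    then show ?thesis by (rule creation_distinct_orthogonal[OF onb(1)[OF that(1)] onb(1)[OF that(2)]])
  qed
  have star_orth: "cinner x (star y) = 0" if "x \<in> ?O k" "y \<in> ?O m" for x y k m
    using creation_star_orthogonal onb(1) that by blast
  obtain k where k: "a \<in> ?O k \<or> a \<in> star ` ?O k" using assms(1) unfolding hbasis_def by blast
  obtain m where m: "b \<in> ?O m \<or> b \<in> star ` ?O m" using assms(2) unfolding hbasis_def by blast
  show "cinner a a = 1" using k onb(2) by (auto simp: star_cinner)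
  show "cinner a b = 0" if "a \<noteq> b"
    using k m
  proof (elim disjE imageE)
    show ?thesis if "a = star x" "x \<in> ?O k" "b \<in> ?O m" for x
      using star_orth[OF that(3,2)] that(1) cinner_commute[of a b] by simp
    show ?thesis if "a = star x" "x \<in> ?O k" "b = star y" "y \<in> ?O m" for x y
      using orth[OF that(4,2)] \<open>a \<noteq> b\<close> that by (auto simp: star_cinner)
  qed (use orth star_orth \<open>a \<noteq> b\<close> in auto)
qed

lemma cinner_scaleC_left: "cinner (c *\<^sub>C x) y = cnj c * cinner x y"
  by (subst cinner_commute, simp add: cinner_scaleC_right) (metis cinner_commute)

text \<open>Removing the component of \<open>x\<close> along \<open>b\<close> lowers the squared
  norm by the corresponding summand and leaves the other coefficients unchanged; the induction
  therefore runs over all \<open>x\<close>.\<close>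

lemma bessel_hbasis:
  fixes x :: "'h::graded_hilbert_space"
  assumes "finite B" "B \<subseteq> hbasis"
  shows "(\<Sum>b\<in>B. (cmod (cinner b x))\<^sup>2) \<le> (norm x)\<^sup>2"
  using assms
proof (induction B arbitrary: x rule: finite_induct)
  case (insert b B)
  define c where "c = cinner b x"
  define y where "y = x + (- c) *\<^sub>C b"
  have bb: "cinner b b = 1" using hbasis_orthonormal(1) insert.prems by blast
  have "cinner a b = 0" if "a \<in> B" for a
    using hbasis_orthonormal(2)[of a b] insert.prems insert.hyps that by blast
  then have y: "cinner a y = cinner a x" if "a \<in> B" for a
    using that by (simp add: y_def cinner_add_right cinner_scaleC_right)
  have "cinner x b = cnj c" unfolding c_def by (rule cinner_commute)
  then have "cinner y y = cinner x x - c * cnj c"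
    by (simp add: y_def cinner_add_right cinner_add_left cinner_scaleC_right cinner_scaleC_left bb
        c_def[symmetric])
  then have "complex_of_real ((norm y)\<^sup>2) = complex_of_real ((norm x)\<^sup>2 - (cmod c)\<^sup>2)"
    unfolding cinner_self by (simp only: complex_norm_square of_real_diff)
  then have "(norm y)\<^sup>2 = (norm x)\<^sup>2 - (cmod c)\<^sup>2" by (simp only: of_real_eq_iff)
  moreover have "(\<Sum>a\<in>B. (cmod (cinner a x))\<^sup>2) \<le> (norm y)\<^sup>2"
    using insert.IH[of y] insert.prems y by simp
  ultimately show ?case using insert.hyps by (simp add: c_def)
qed simp

lemma l2sq_coords_finite:
  fixes f :: "'h::graded_hilbert_space"
  shows "l2sq (\<lambda>b. if b \<in> hbasis then cinner b f else 0) < \<infinity>"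
proof -
  let ?g = "\<lambda>b. (cmod (if b \<in> hbasis then cinner b f else 0))\<^sup>2"
  have "?g summable_on UNIV"
  proof (rule nonneg_bdd_above_summable_on)
    show "bdd_above (sum ?g ` {F. F \<subseteq> UNIV \<and> finite F})"
    proof (rule bdd_aboveI2)
      fix F :: "'h set" assume "F \<in> {F. F \<subseteq> UNIV \<and> finite F}"
      then have "finite F" by simp
      then have "sum ?g F = (\<Sum>b\<in>F \<inter> hbasis. (cmod (cinner b f))\<^sup>2)"
        by (intro sum.mono_neutral_cong_right) auto
      also have "\<dots> \<le> (norm f)\<^sup>2"
        using \<open>finite F\<close> by (intro bessel_hbasis) auto
      finally show "sum ?g F \<le> (norm f)\<^sup>2" .
    qed
  qed simp
  then show ?thesis
    using summable_on_iff_nnsum(1)[of ?g] by (simp add: sqsum_def)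
qed

text \<open>Splitting off the first letter factors the sum of squares into one sum for each vector,
  and each of these is finite by Bessel's inequality.\<close>

lemma l2sq_tensor: "l2sq (tensor fs) < \<infinity>"
proof (induction fs)
  case Nil
  have "l2sq (tensor [] :: 'a list \<Rightarrow> complex) = nnsum (\<lambda>w :: 'a list. indicator {[]} w)"
    unfolding sqsum_def by (rule nn_integral_cong) (auto simp: tensor_def split: split_indicator)
  then show ?case by simp
next
  case (Cons f fs)
  let ?g = "\<lambda>b. if b \<in> hbasis then cinner b f else 0"
  have "tensor (f # fs) (b # w) = ?g b * tensor fs w" for b w
    by (simp add: tensor_def prod.lessThan_Suc_shift del: prod.lessThan_Suc)
  then have "l2sq (tensor (f # fs)) =
      nnsum (\<lambda>(b, w). ennreal ((cmod (?g b))\<^sup>2) * ennreal ((cmod (tensor fs w))\<^sup>2))"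
    unfolding sqsum_def
    by (subst nnsum_Cons)
      (auto simp: tensor_def[of _ "[]"] norm_mult power_mult_distrib ennreal_mult' intro!: nn_integral_cong)
  also have "\<dots> = l2sq ?g * l2sq (tensor fs)"
    by (simp only: nnsum_pair sqsum_def mult_1)
  also have "\<dots> < \<infinity>"
    using l2sq_coords_finite[of f] Cons by (simp add: ennreal_mult_less_top)
  finally show ?case .
qed

lemma l2sq_graded_proj:
  fixes T :: "'a list \<Rightarrow> complex"
  shows "l2sq (graded_proj \<pi> T) \<le> l2sq T"
proof -
  have "l2sq (graded_proj \<pi> T) \<le> nnsum (\<lambda>w.
      (\<Sum>s | s permutes {..<length w}. ennreal ((cmod (T (permute_list (inv s) w)))\<^sup>2)) / of_nat (fact (length w)))"
    unfolding sqsum_def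
  proof (rule nn_integral_mono)
    fix w :: "'a list"
    let ?S = "{s. s permutes {..<length w}}"
    have "ennreal (1 * (cmod (graded_proj \<pi> T w))\<^sup>2) \<le>
        ennreal ((\<Sum>s\<in>?S. (cmod (T (permute_list (inv s) w)))\<^sup>2) / real (fact (length w)))"
      using graded_proj_square_le[of \<pi> T w] by (intro ennreal_leI) simp
    also have "\<dots> = (\<Sum>s\<in>?S. ennreal ((cmod (T (permute_list (inv s) w)))\<^sup>2)) / ennreal (real (fact (length w)))"
      by (subst divide_ennreal[symmetric]) (simp_all add: sum_nonneg sum_ennreal)
    finally show "ennreal (1 * (cmod (graded_proj \<pi> T w))\<^sup>2) \<le>
        (\<Sum>s\<in>?S. ennreal ((cmod (T (permute_list (inv s) w)))\<^sup>2)) / of_nat (fact (length w))"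
      unfolding ennreal_of_nat_eq_real_of_nat .
  qed
  also have "\<dots> = nnsum (\<lambda>w. ennreal ((cmod (T w))\<^sup>2))"
    by (rule nnsum_permutation_average)
  finally show ?thesis by (simp add: sqsum_def)
qed

lemma sqsum_sum_finite:
  fixes x :: "'j \<Rightarrow> 'i \<Rightarrow> complex"
  assumes "\<And>i. 0 \<le> wt i" "\<And>j. j \<in> J \<Longrightarrow> sqsum wt (x j) < \<infinity>"
  shows "sqsum wt (\<lambda>i. \<Sum>j\<in>J. x j i) < \<infinity>"
  using assms(2)
proof (induction J rule: infinite_finite_induct)
  case (insert j J)
  then have "2 * (sqsum wt (x j) + sqsum wt (\<lambda>i. \<Sum>j\<in>J. x j i)) < \<infinity>"
    by (auto simp: ennreal_mult_less_top)
  then show ?case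
    using sqsum_add[of wt "x j" "\<lambda>i. \<Sum>j\<in>J. x j i"] assms(1) insert.hyps
    by (auto intro: le_less_trans)
qed simp_all

lemma finite_fock_sym_power:
  fixes F :: "'h::graded_hilbert_space list \<Rightarrow> complex"
  assumes "F \<in> sym_power n"
  shows "finite_fock (Suc n) F"
proof -
  obtain m :: nat and c :: "nat \<Rightarrow> complex" and fs :: "nat \<Rightarrow> 'h list"
    where len: "\<forall>i<m. length (fs i) = n"
      and F: "F = graded_proj odd_vec (\<lambda>w. \<Sum>i<m. c i * tensor (fs i) w)"
    using assms unfolding sym_power_def alg_tensor_power_def by blast
  have "F w = 0" if w: "Suc n \<le> length w" for w
  proof -
    have "F w = graded_proj odd_vec (\<lambda>_. 0) w"
      unfolding F using w len by (intro graded_proj_cong) (auto simp: tensor_def)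
    then show ?thesis by (simp add: graded_proj_zero)
  qed
  moreover have "l2sq (\<lambda>w. \<Sum>i<m. c i * tensor (fs i) w) < \<infinity>"
  proof (rule sqsum_sum_finite)
    show "l2sq (\<lambda>w. c i * tensor (fs i) w) < \<infinity>" for i
      using l2sq_tensor[of "fs i"] by (simp add: sqsum_cmult ennreal_mult_less_top)
  qed simp
  then have "l2sq F < \<infinity>"
    unfolding F using l2sq_graded_proj le_less_trans by blast
  ultimately show ?thesis unfolding finite_fock_def by blast
qed

lemma finite_fock_S_fin:
  assumes "F \<in> S_fin"
  obtains N where "finite_fock N F"
proof -
  obtain N :: nat and H where H: "\<forall>n<N. H n \<in> sym_power n" and F: "F = (\<lambda>w. \<Sum>n<N. H n w)"
    using assms unfolding S_fin_def by blast
  have fH: "finite_fock (Suc n) (H n)" if "n < N" for n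
    using H that finite_fock_sym_power by blast
  have "finite_fock (Suc N) F"
    unfolding finite_fock_def F
  proof (intro conjI allI impI)
    show "(\<Sum>n<N. H n w) = 0" if "Suc N \<le> length w" for w
      using fH that by (intro sum.neutral) (auto simp: finite_fock_def)
    show "l2sq (\<lambda>w. \<Sum>n<N. H n w) < \<infinity>"
      using fH by (intro sqsum_sum_finite) (auto simp: finite_fock_def)
  qed
  then show ?thesis by (rule that)
qed

subsection \<open>Bounded multilinear maps\<close>

lemma grassmann_zero: "(\<lambda>_. 0) \<in> grassmann"
  by (simp add: grassmann_def weighted_l2_iff graded_proj_zero fun_eq_iff)

lemma grassmann_norm_nonneg: "0 \<le> grassmann_norm x"
  by (simp add: grassmann_norm_def weighted_norm_def infsum_nonneg)

lemma grassmann_norm_sqsum: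
  assumes "x \<in> grassmann"
  shows "ennreal ((grassmann_norm x)\<^sup>2) = sqsum grassmann_weight x"
  using assms unfolding grassmann_def grassmann_norm_def by (intro weighted_norm_sqsum) auto

lemma grassmann_add:
  assumes x: "x \<in> grassmann" and y: "y \<in> grassmann"
  shows "(\<lambda>l. x l + y l) \<in> grassmann"
    "grassmann_norm (\<lambda>l. x l + y l) \<le> 2 * (grassmann_norm x + grassmann_norm y)"
proof -
  have fin: "sqsum grassmann_weight x < \<infinity>" "sqsum grassmann_weight y < \<infinity>"
    using x y by (auto simp: grassmann_def weighted_l2_iff)
  have "2 * (sqsum grassmann_weight x + sqsum grassmann_weight y) < \<infinity>"
    using fin by (auto simp: ennreal_mult_less_top)
  then have "sqsum grassmann_weight (\<lambda>l. x l + y l) < \<infinity>"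
    using sqsum_add[of grassmann_weight x y] by (auto intro: le_less_trans)
  then show s: "(\<lambda>l. x l + y l) \<in> grassmann"
    using x y by (auto simp: grassmann_def weighted_l2_iff graded_proj_add fun_eq_iff)
  have "ennreal ((grassmann_norm (\<lambda>l. x l + y l))\<^sup>2) \<le>
      2 * (ennreal ((grassmann_norm x)\<^sup>2) + ennreal ((grassmann_norm y)\<^sup>2))"
    using sqsum_add[of grassmann_weight x y] by (simp add: grassmann_norm_sqsum x y s)
  also have "\<dots> = ennreal (2 * ((grassmann_norm x)\<^sup>2 + (grassmann_norm y)\<^sup>2))"
    by (simp add: ennreal_mult')
  finally have "(grassmann_norm (\<lambda>l. x l + y l))\<^sup>2 \<le> 2 * ((grassmann_norm x)\<^sup>2 + (grassmann_norm y)\<^sup>2)"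
    by (subst (asm) ennreal_le_iff) auto
  also have "\<dots> \<le> (2 * (grassmann_norm x + grassmann_norm y))\<^sup>2"
    using mult_nonneg_nonneg[OF grassmann_norm_nonneg[of x] grassmann_norm_nonneg[of y]]
    by (simp add: power2_eq_square algebra_simps)
  finally show "grassmann_norm (\<lambda>l. x l + y l) \<le> 2 * (grassmann_norm x + grassmann_norm y)"
    by (rule power2_le_imp_le) (simp add: grassmann_norm_nonneg)
qed

lemma grassmann_sum:
  "(\<And>i. i \<in> I \<Longrightarrow> x i \<in> grassmann) \<Longrightarrow> (\<lambda>l. \<Sum>i\<in>I. x i l) \<in> grassmann"
  by (induction I rule: infinite_finite_induct) (simp_all add: grassmann_zero grassmann_add)

lemma ext_norm_nonneg: "0 \<le> ext_norm x"
  by (simp add: ext_norm_def weighted_norm_def infsum_nonneg)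

abbreviation super_multilinear ::
    "nat \<Rightarrow> (('l::complex_hilbert_space list \<times> 'h::graded_hilbert_space list \<Rightarrow> complex) list
       \<Rightarrow> 'l list \<Rightarrow> complex) \<Rightarrow> bool" where
  "super_multilinear \<equiv> bounded_multilinear superspace ext_norm grassmann grassmann_norm"

lemma bounded_multilinearI:
  assumes "\<And>xs. set xs \<subseteq> X \<Longrightarrow> length xs = n \<Longrightarrow> M xs \<in> Y"
    and "\<And>xs i x y a b. set xs \<subseteq> X \<Longrightarrow> length xs = n \<Longrightarrow> i < n \<Longrightarrow> x \<in> X \<Longrightarrow> y \<in> X \<Longrightarrow>
        M (xs[i := (\<lambda>k. a * x k + b * y k)]) = (\<lambda>j. a * M (xs[i := x]) j + b * M (xs[i := y]) j)"
    and "\<And>xs. set xs \<subseteq> X \<Longrightarrow> length xs = n \<Longrightarrow> nY (M xs) \<le> C * prod_list (map nX xs)"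
  shows "bounded_multilinear X nX Y nY n M"
  using assms unfolding bounded_multilinear_def by blast

lemma bounded_multilinearD:
  assumes "bounded_multilinear X nX Y nY n M"
  shows "\<And>xs. set xs \<subseteq> X \<Longrightarrow> length xs = n \<Longrightarrow> M xs \<in> Y"
    and "\<And>xs i x y a b. set xs \<subseteq> X \<Longrightarrow> length xs = n \<Longrightarrow> i < n \<Longrightarrow> x \<in> X \<Longrightarrow> y \<in> X \<Longrightarrow>
        M (xs[i := (\<lambda>k. a * x k + b * y k)]) = (\<lambda>j. a * M (xs[i := x]) j + b * M (xs[i := y]) j)"
    and "\<exists>C. \<forall>xs. set xs \<subseteq> X \<and> length xs = n \<longrightarrow> nY (M xs) \<le> C * prod_list (map nX xs)"
  using assms unfolding bounded_multilinear_def by blast+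

lemma super_multilinear_zero: "super_multilinear n (\<lambda>_ _. 0)"
  by (rule bounded_multilinearI[where C = 0])
    (auto simp: grassmann_zero grassmann_norm_def weighted_norm_def)

lemma super_multilinear_add:
  assumes M: "super_multilinear n M" and M': "super_multilinear n M'"
  shows "super_multilinear n (\<lambda>xs l. M xs l + M' xs l)"
proof -
  obtain C C' where C: "\<And>xs. set xs \<subseteq> superspace \<Longrightarrow> length xs = n \<Longrightarrow> grassmann_norm (M xs) \<le> C * prod_list (map ext_norm xs)"
    "\<And>xs. set xs \<subseteq> superspace \<Longrightarrow> length xs = n \<Longrightarrow> grassmann_norm (M' xs) \<le> C' * prod_list (map ext_norm xs)"
    using bounded_multilinearD(3)[OF M] bounded_multilinearD(3)[OF M'] by blast
  show ?thesis
  proof (rule bounded_multilinearI[where C = "2 * (C + C')"])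
    fix xs :: "('a list \<times> 'b list \<Rightarrow> complex) list" assume xs: "set xs \<subseteq> superspace" "length xs = n"
    note g = bounded_multilinearD(1)[OF M xs] bounded_multilinearD(1)[OF M' xs]
    show "(\<lambda>l. M xs l + M' xs l) \<in> grassmann" by (rule grassmann_add[OF g])
    show "grassmann_norm (\<lambda>l. M xs l + M' xs l) \<le> 2 * (C + C') * prod_list (map ext_norm xs)"
      using grassmann_add(2)[OF g] C(1)[OF xs] C(2)[OF xs] by (simp add: algebra_simps)
  qed (simp add: bounded_multilinearD(2)[OF M] bounded_multilinearD(2)[OF M'] algebra_simps)
qed

lemma super_multilinear_sum:
  assumes "\<And>i. i \<in> I \<Longrightarrow> super_multilinear n (M i)"
  shows "super_multilinear n (\<lambda>xs l. \<Sum>i\<in>I. M i xs l)"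
  using assms
  by (induction I rule: infinite_finite_induct) (simp_all add: super_multilinear_zero super_multilinear_add)

lemma grassmann_mult_support:
  assumes "\<And>l. l \<notin> lists B \<Longrightarrow> x l = 0" "\<And>l. l \<notin> lists B \<Longrightarrow> y l = 0" "l \<notin> lists B"
  shows "(x \<cdot>\<^sub>\<Lambda> y) l = 0"
proof -
  have "x (take p (permute_list (inv s) l)) * y (drop p (permute_list (inv s) l)) = 0"
    if "s permutes {..<length l}" for s p
  proof -
    let ?v = "permute_list (inv s) l"
    have "set ?v = set l" by (rule set_permute_list[OF permutes_inv[OF that]])
    then have "take p ?v @ drop p ?v \<notin> lists B"
      unfolding append_take_drop_id using assms(3) by (simp add: in_lists_conv_set)
    then have "take p ?v \<notin> lists B \<or> drop p ?v \<notin> lists B"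
      unfolding append_in_lists_conv by blast
    then show ?thesis using assms by auto
  qed
  then show ?thesis
    unfolding graded_mult_def graded_proj_def Let_def by (auto intro!: sum.neutral)
qed

lemma family_pair_grassmann:
  assumes f: "\<And>f a l. f \<in> set fs \<Longrightarrow> l \<notin> lists gbasis \<Longrightarrow> f a l = 0"
    and fin: "\<And>f. f \<in> set fs \<Longrightarrow> family_sqsum f < \<infinity>" and T: "l2sq T < \<infinity>"
  shows "family_pair (family_prod fs) T \<in> grassmann"
proof -
  have supp: "family_prod fs v l = 0" if "l \<notin> lists gbasis" for v l
    using f that
  proof (induction fs v arbitrary: l rule: family_prod.induct)
    case (2 f fs a v)
    then show ?case by (simp add: grassmann_mult_support[where B = gbasis])
  qed (auto simp: unit_tensor_def)
  have "family_sqsum (family_prod fs) * l2sq T < \<infinity>"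
    using family_sqsum_family_prod_finite[OF fin] T by (simp add: ennreal_mult_less_top)
  then have "sqsum grassmann_weight (family_pair (family_prod fs) T) < \<infinity>"
    using sqsum_family_pair le_less_trans by blast
  moreover have "alt_proj (family_pair (family_prod fs) T) = family_pair (family_prod fs) T"
    by (intro graded_proj_symmetric alternating_family_pair alternating_family_prod)
  ultimately show ?thesis
    unfolding grassmann_def by (simp add: weighted_l2_iff family_pair_def supp)
qed

lemma family_prod_update:
  assumes "i < length zs"
  shows "family_prod (map dual_coords (zs[i := (\<lambda>k. a * x k + b * y k)])) v l =
    a * family_prod (map dual_coords (zs[i := x])) v l + b * family_prod (map dual_coords (zs[i := y])) v l"
  using assms
proof (induction zs arbitrary: i v l)
  case (Cons z zs)
  show ?case
  proof (cases v)
    case v: (Cons c w)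
    show ?thesis
    proof (cases i)
      case 0
      have "dual_coords (\<lambda>k. a * x k + b * y k) c = (\<lambda>l. a * dual_coords x c l + b * dual_coords y c l)"
        by (simp add: dual_coords_def coords_def)
      then show ?thesis
        by (simp add: 0 v graded_mult_add graded_mult_cmult)
    next
      case (Suc j)
      then have "family_prod (map dual_coords (zs[j := (\<lambda>k. a * x k + b * y k)])) w =
        (\<lambda>l. a * family_prod (map dual_coords (zs[j := x])) w l + b * family_prod (map dual_coords (zs[j := y])) w l)"
        using Cons by (intro ext) simp
      then show ?thesis
        by (simp add: Suc v graded_mult_add graded_mult_cmult)
    qed
  next
    case Nil
    then show ?thesis by (cases i) simp_all
  qed
qed simp

text \<open>The polarization of the part of degree \<open>n\<close> of \<open>phi\<close>: the
  \<open>n\<close> arguments occupy the \<open>n\<close> places of the word.\<close>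

lemma super_multilinear_family_pair:
  assumes T: "l2sq T < \<infinity>"
  shows "super_multilinear n (\<lambda>zs. family_pair (family_prod (map dual_coords zs)) T)"
proof -
  define L where "L = enn2real (l2sq T)"
  have L: "l2sq T = ennreal L" "0 \<le> L" using T by (auto simp: L_def)
  have fin: "family_sqsum f < \<infinity>" if "set zs \<subseteq> superspace" "f \<in> set (map dual_coords zs)" for f zs
    using that family_sqsum_superspace by auto
  show ?thesis
  \<comment> \<open>One factor 3 for each Grassmann multiplication, and \<open>L\<close> from the
    Cauchy-Schwarz inequality; the root passes from squares to norms.\<close>
  proof (rule bounded_multilinearI[where C = "sqrt (3 ^ n * L)"])
    fix zs :: "('b list \<times> 'a list \<Rightarrow> complex) list"
    assume zs: "set zs \<subseteq> superspace" "length zs = n"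
    show mem: "family_pair (family_prod (map dual_coords zs)) T \<in> grassmann"
    proof (rule family_pair_grassmann[OF _ _ T])
      show "f a l = 0" if "f \<in> set (map dual_coords zs)" "l \<notin> lists gbasis" for f a l
        using that zs superspaceD(2) by (fastforce simp: dual_coords_def coords_def)
    qed (rule fin[OF zs(1)])
    have "prod_list (map (\<lambda>f. 3 * family_sqsum f) (map dual_coords zs)) \<le>
        ennreal (3 ^ length zs * (prod_list (map ext_norm zs))\<^sup>2)"
      using zs(1)
    proof (induction zs)
      case (Cons z zs)
      have "family_sqsum (dual_coords z) \<le> ennreal ((ext_norm z)\<^sup>2)"
        using Cons.prems family_sqsum_dual_coords[of z]
        by (simp add: ext_norm_def weighted_norm_sqsum superspace_def ext_fock_def)
      then have "3 * family_sqsum (dual_coords z) \<le> ennreal (3 * (ext_norm z)\<^sup>2)"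
        by (simp add: ennreal_mult' mult_left_mono)
      then have "3 * family_sqsum (dual_coords z) * prod_list (map (\<lambda>f. 3 * family_sqsum f) (map dual_coords zs)) \<le>
          ennreal (3 * (ext_norm z)\<^sup>2) * ennreal (3 ^ length zs * (prod_list (map ext_norm zs))\<^sup>2)"
        using Cons by (intro mult_mono) auto
      also have "\<dots> = ennreal (3 ^ length (z # zs) * (prod_list (map ext_norm (z # zs)))\<^sup>2)"
        by (subst ennreal_mult'[symmetric]) (auto simp: power_mult_distrib mult_ac)
      finally show ?case by simp
    qed simp
    then have "sqsum grassmann_weight (family_pair (family_prod (map dual_coords zs)) T) \<le>
        ennreal (3 ^ length zs * (prod_list (map ext_norm zs))\<^sup>2) * ennreal L"
      using order_trans[OF sqsum_family_pair[of "family_prod (map dual_coords zs)" T]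
          mult_right_mono[OF order_trans[OF family_sqsum_family_prod]]]
      by (simp add: L(1))
    then have "ennreal ((grassmann_norm (family_pair (family_prod (map dual_coords zs)) T))\<^sup>2) \<le>
        ennreal (3 ^ n * L * (prod_list (map ext_norm zs))\<^sup>2)"
      using zs(2) L(2) by (simp add: grassmann_norm_sqsum[OF mem] mult_ac flip: ennreal_mult')
    then have "(grassmann_norm (family_pair (family_prod (map dual_coords zs)) T))\<^sup>2 \<le>
        3 ^ n * L * (prod_list (map ext_norm zs))\<^sup>2"
      using L(2) by (subst (asm) ennreal_le_iff) auto
    also have "\<dots> = (sqrt (3 ^ n * L) * prod_list (map ext_norm zs))\<^sup>2"
      using L(2) by (simp add: power_mult_distrib)
    finally show "grassmann_norm (family_pair (family_prod (map dual_coords zs)) T) \<le>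
        sqrt (3 ^ n * L) * prod_list (map ext_norm zs)"
      by (rule power2_le_imp_le)
        (use L(2) in \<open>auto intro!: mult_nonneg_nonneg prod_list_nonneg simp: ext_norm_nonneg\<close>)
  next
    fix zs :: "('b list \<times> 'a list \<Rightarrow> complex) list" and i a b
      and x y :: "'b list \<times> 'a list \<Rightarrow> complex"
    assume zs: "set zs \<subseteq> superspace" "length zs = n" "i < n" "x \<in> superspace" "y \<in> superspace"
    show "family_pair (family_prod (map dual_coords (zs[i := (\<lambda>k. a * x k + b * y k)]))) T =
      (\<lambda>l. a * family_pair (family_prod (map dual_coords (zs[i := x]))) T l +
        b * family_pair (family_prod (map dual_coords (zs[i := y]))) T l)"
    proof
      fix l
      have hs: "((\<lambda>v. family_prod (map dual_coords (zs[i := z])) v l * T v) has_sum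
          family_pair (family_prod (map dual_coords (zs[i := z]))) T l) UNIV" if "z \<in> superspace" for z
        using that zs set_update_subset_insert[of zs i z]
        by (intro family_pair_has_sum family_sqsum_family_prod_finite T) (rule fin, auto)
      show "family_pair (family_prod (map dual_coords (zs[i := (\<lambda>k. a * x k + b * y k)]))) T l =
        a * family_pair (family_prod (map dual_coords (zs[i := x]))) T l +
        b * family_pair (family_prod (map dual_coords (zs[i := y]))) T l"
        unfolding family_pair_def[of "family_prod (map dual_coords (zs[i := (\<lambda>k. a * x k + b * y k)]))"]
        using has_sum_add[OF has_sum_cmult_right[OF hs[OF zs(4)], of a] has_sum_cmult_right[OF hs[OF zs(5)], of b]] zs
        by (intro infsumI) (simp add: family_prod_update algebra_simps)
    qed
  qed
qed

subsection \<open>Taylor expansion\<close>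

text \<open>A mask decides place by place between the base point \<open>x\<close> and the next entry
  of \<open>hs\<close>; the number of \<open>True\<close> is the degree in the increment.\<close>

primrec fill :: "bool list \<Rightarrow> 'a \<Rightarrow> 'a list \<Rightarrow> 'a list" where
  "fill [] x hs = []"
| "fill (c # b) x hs = (if c then hd hs # fill b x (tl hs) else x # fill b x hs)"

lemma length_fill [simp]: "length (fill b x hs) = length b"
  by (induction b arbitrary: hs) auto

lemma set_fill: "length hs = count_list b True \<Longrightarrow> set (fill b x hs) \<subseteq> insert x (set hs)"
proof (induction b arbitrary: hs)
  case (Cons c b)
  then show ?case by (cases c; cases hs) force+
qed simp

text \<open>When the lengths match, each entry of \<open>hs\<close> is used at exactly one place, so
  that linearity in it is inherited.\<close>

lemma fill_update:
  assumes "i < length hs" "length hs = count_list b True"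
  shows "\<exists>j<length b. \<forall>z. fill b x (hs[i := z]) = (fill b x hs)[j := z]"
  using assms
proof (induction b arbitrary: hs i)
  case (Cons c b)
  show ?case
  proof (cases c)
    case True
    then obtain h hs' where hs: "hs = h # hs'" "length hs' = count_list b True"
      using Cons.prems by (cases hs) auto
    show ?thesis
    proof (cases i)
      case 0
      then show ?thesis using True hs by (intro exI[of _ 0]) simp
    next
      case (Suc k)
      then obtain j where "j < length b" "\<forall>z. fill b x (hs'[k := z]) = (fill b x hs')[j := z]"
        using Cons.IH[of k hs'] Cons.prems hs by auto
      then show ?thesis using True hs Suc by (intro exI[of _ "Suc j"]) simp
    qed
  next
    case False
    then obtain j where "j < length b" "\<forall>z. fill b x (hs[i := z]) = (fill b x hs)[j := z]"
      using Cons.IH[of i hs] Cons.prems by auto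
    then show ?thesis using False by (intro exI[of _ "Suc j"]) simp
  qed
qed simp

lemma prod_list_fill:
  fixes f :: "'a \<Rightarrow> real"
  assumes "length hs = count_list b True"
  shows "prod_list (map f (fill b x hs)) = f x ^ count_list b False * prod_list (map f hs)"
  using assms
proof (induction b arbitrary: hs)
  case (Cons c b)
  then show ?case by (cases c; cases hs) (simp_all add: mult_ac)
qed simp

lemma fill_replicate: "fill b x (replicate (count_list b True) h) = map (\<lambda>c. if c then h else x) b"
  by (induction b) auto

text \<open>Freezing an argument at \<open>x\<close> costs a factor \<open>ext_norm x\<close> in the
  bound.\<close>

lemma super_multilinear_fill:
  assumes M: "super_multilinear m M" and x: "x \<in> superspace"
    and b: "length b = m" "count_list b True = n"
  shows "super_multilinear n (\<lambda>hs. M (fill b x hs))"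
proof -
  obtain C where C: "\<And>xs. set xs \<subseteq> superspace \<Longrightarrow> length xs = m \<Longrightarrow> grassmann_norm (M xs) \<le> C * prod_list (map ext_norm xs)"
    using bounded_multilinearD(3)[OF M] by blast
  have fs: "set (fill b x hs) \<subseteq> superspace" if "set hs \<subseteq> superspace" "length hs = n" for hs
    using set_fill[of hs b x] that b x by auto
  show ?thesis
  proof (rule bounded_multilinearI[where C = "C * ext_norm x ^ count_list b False"])
    fix hs :: "('a list \<times> 'b list \<Rightarrow> complex) list"
    assume hs: "set hs \<subseteq> superspace" "length hs = n"
    show "M (fill b x hs) \<in> grassmann"
      by (rule bounded_multilinearD(1)[OF M fs[OF hs]]) (simp add: b)
    show "grassmann_norm (M (fill b x hs)) \<le> C * ext_norm x ^ count_list b False * prod_list (map ext_norm hs)"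
      using C[OF fs[OF hs]] hs b by (simp add: prod_list_fill mult.assoc)
  next
    fix hs :: "('a list \<times> 'b list \<Rightarrow> complex) list" and i \<alpha> \<beta>
      and y z :: "'a list \<times> 'b list \<Rightarrow> complex"
    assume hs: "set hs \<subseteq> superspace" "length hs = n" "i < n" "y \<in> superspace" "z \<in> superspace"
    then obtain j where "j < m" "\<And>z. fill b x (hs[i := z]) = (fill b x hs)[j := z]"
      using fill_update[of i hs b x] b by auto
    then show "M (fill b x (hs[i := (\<lambda>k. \<alpha> * y k + \<beta> * z k)])) =
        (\<lambda>l. \<alpha> * M (fill b x (hs[i := y])) l + \<beta> * M (fill b x (hs[i := z])) l)"
      using bounded_multilinearD(2)[OF M fs[OF hs(1,2)], of j y z \<alpha> \<beta>] hs b by simp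
  qed
qed

lemma superspace_add:
  assumes "x \<in> superspace" "y \<in> superspace"
  shows "(\<lambda>k. x k + y k) \<in> superspace"
proof -
  have "2 * (sqsum ext_weight x + sqsum ext_weight y) < \<infinity>"
    using assms[THEN sqsum_superspace] by (auto simp: ennreal_mult_less_top)
  then have "sqsum ext_weight (\<lambda>k. x k + y k) < \<infinity>"
    using sqsum_add[of ext_weight x y] by (auto intro: le_less_trans)
  then have "(\<lambda>k. x k + y k) \<in> ext_fock"
    using assms unfolding superspace_def ext_fock_def
    by (auto simp: weighted_l2_iff graded_proj_add fun_eq_iff)
  moreover have "length h = 1 \<and> (odd (length l) \<longleftrightarrow> odd_vec (hd h))" if "x (l, h) + y (l, h) \<noteq> 0" for l h
  proof -
    have "x (l, h) \<noteq> 0 \<or> y (l, h) \<noteq> 0" using that by auto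
    then show ?thesis using assms unfolding superspace_def by blast
  qed
  ultimately show ?thesis unfolding superspace_def by blast
qed

lemma sum_bool_lists_Suc:
  "(\<Sum>b | length b = Suc n. f b) = (\<Sum>b | length b = n. f (False # b)) + (\<Sum>b | length b = n. f (True # b))"
  for f :: "bool list \<Rightarrow> complex"
proof -
  let ?L = "\<lambda>n. {b :: bool list. length b = n}"
  have fin: "finite (?L n)"
    using finite_lists_length_eq[of "UNIV :: bool set" n] by simp
  have "?L (Suc n) = (#) False ` ?L n \<union> (#) True ` ?L n"
    by (auto simp: length_Suc_conv image_iff)
  moreover have "(#) False ` ?L n \<inter> (#) True ` ?L n = {}" by auto
  ultimately have "(\<Sum>b | length b = Suc n. f b) = sum f ((#) False ` ?L n) + sum f ((#) True ` ?L n)"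
    using fin by (simp add: sum.union_disjoint)
  then show ?thesis by (simp add: sum.reindex inj_on_def)
qed

text \<open>Expands one argument after the other, with those already chosen kept in
  \<open>pre\<close>. The sum runs over masks and not over binomial coefficients because the map
  need not be symmetric.\<close>

lemma super_multilinear_binomial:
  assumes M: "super_multilinear (length pre + m) M" and pre: "set pre \<subseteq> superspace"
    and x: "x \<in> superspace" and h: "h \<in> superspace"
  shows "M (pre @ replicate m (\<lambda>k. x k + h k)) l =
    (\<Sum>b | length b = m. M (pre @ map (\<lambda>c. if c then h else x) b) l)"
  using M pre
proof (induction m arbitrary: pre)
  case (Suc m)
  let ?y = "\<lambda>k. x k + h k"
  let ?xs = "pre @ x # replicate m ?y"
  have "set ?xs \<subseteq> superspace"
    using Suc.prems x superspace_add[OF x h] by (auto simp: in_set_replicate)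
  then have "M (?xs[length pre := (\<lambda>k. 1 * x k + 1 * h k)]) =
      (\<lambda>l. 1 * M (?xs[length pre := x]) l + 1 * M (?xs[length pre := h]) l)"
    using Suc.prems(1) x h by (intro bounded_multilinearD(2)) auto
  then have "M (pre @ replicate (Suc m) ?y) l =
      M ((pre @ [x]) @ replicate m ?y) l + M ((pre @ [h]) @ replicate m ?y) l"
    by simp
  then show ?case
    using Suc.IH[of "pre @ [x]"] Suc.IH[of "pre @ [h]"] Suc.prems x h
    by (simp add: sum_bool_lists_Suc)
qed simp

lemma phi_entire_analytic:
  fixes F :: "'h::graded_hilbert_space list \<Rightarrow> complex"
  assumes F: "finite_fock N F"
  shows "(phi F :: ('l::complex_hilbert_space, 'h) ext \<Rightarrow> 'l grass) \<in> superspace_functions"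
proof -
  define \<Psi> :: "('l, 'h) ext list \<Rightarrow> 'l grass" where
    "\<Psi> zs = family_pair (family_prod (map dual_coords zs)) (exp_coeffs F)" for zs
  have \<Psi>: "super_multilinear m \<Psi>" for m
    unfolding \<Psi>_def[abs_def]
    using F by (intro super_multilinear_family_pair l2sq_exp_coeffs) (simp add: finite_fock_def)
  have phi: "phi F z l = (\<Sum>m<N. \<Psi> (replicate m z) l)" if "z \<in> superspace" for z :: "('l, 'h) ext" and l
    using phi_finite_fock[OF that F] by (simp add: \<Psi>_def)
  define B where "B m n = {b. length b = m \<and> count_list b True = n}" for m n
  \<comment> \<open>The Taylor coefficient of order \<open>n\<close> at \<open>x\<close> collects,
    over all degrees \<open>m\<close>, the masks with exactly \<open>n\<close> entries
    \<open>True\<close>.\<close>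
  define M where "M x n hs = (\<lambda>l. \<Sum>m<N. \<Sum>b\<in>B m n. \<Psi> (fill b x hs) l)" for x n hs
  have M: "super_multilinear n (M x n)" if "x \<in> superspace" for x n
    unfolding M_def[abs_def]
    by (intro super_multilinear_sum super_multilinear_fill[OF \<Psi> that]) (auto simp: B_def)
  have M0: "phi F (\<lambda>i. x i + h i) l = (\<Sum>k<n. M x k (replicate k h) l)"
    if x: "x \<in> superspace" and h: "h \<in> superspace" and n: "N \<le> n" for x h :: "('l, 'h) ext" and n l
  proof -
    have "phi F (\<lambda>i. x i + h i) l =
        (\<Sum>m<N. \<Sum>b | length b = m. \<Psi> (fill b x (replicate (count_list b True) h)) l)"
      unfolding phi[OF superspace_add[OF x h]] fill_replicate
      using super_multilinear_binomial[of "[]", OF _ _ x h] \<Psi> by simp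
    also have "\<dots> = (\<Sum>m<N. \<Sum>k<n. \<Sum>b\<in>B m k. \<Psi> (fill b x (replicate k h)) l)"
    proof (rule sum.cong)
      fix m assume m: "m \<in> {..<N}"
      let ?L = "{b :: bool list. length b = m}"
      have fin: "finite ?L"
        using finite_lists_length_eq[of "UNIV :: bool set" m] by simp
      \<comment> \<open>The number of \<open>True\<close> is at most \<open>m\<close>, which is less
        than \<open>N\<close> and hence less than \<open>n\<close>: no mask is lost in the
        grouping.\<close>
      have sub: "(\<lambda>b. count_list b True) ` ?L \<subseteq> {..<n}"
        using m n count_le_length[of _ True] by (force intro: le_less_trans)
      show "(\<Sum>b\<in>?L. \<Psi> (fill b x (replicate (count_list b True) h)) l) =
          (\<Sum>k<n. \<Sum>b\<in>B m k. \<Psi> (fill b x (replicate k h)) l)"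
        by (subst sum.group[OF fin _ sub, symmetric]) (auto simp: B_def intro!: sum.cong)
    qed simp
    also have "\<dots> = (\<Sum>k<n. M x k (replicate k h) l)"
      unfolding M_def by (rule sum.swap)
    finally show ?thesis .
  qed
  have norm0: "grassmann_norm (\<lambda>_. 0 :: complex) = 0"
    by (simp add: grassmann_norm_def weighted_norm_def)
  show ?thesis
    unfolding superspace_functions_def entire_analytic_def
  proof (intro CollectI conjI ballI)
    fix x :: "('l, 'h) ext" assume x: "x \<in> superspace"
    have "phi F x = (\<lambda>l. \<Sum>m<N. \<Psi> (replicate m x) l)"
      by (rule ext) (rule phi[OF x])
    also have "\<dots> \<in> grassmann"
      using x by (intro grassmann_sum bounded_multilinearD(1)[OF \<Psi>]) auto
    finally show "phi F x \<in> grassmann" .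
    show "\<exists>r>0. \<exists>M. (\<forall>n. super_multilinear n (M n)) \<and>
      (\<forall>e>0. \<exists>N. \<forall>n\<ge>N. \<forall>h\<in>superspace. ext_norm h < r \<longrightarrow>
        grassmann_norm (\<lambda>j. phi F (\<lambda>i. x i + h i) j - (\<Sum>k<n. M k (replicate k h) j)) < e)"
    \<comment> \<open>The remainder is exactly 0 from order \<open>N\<close> on, so that the radius
      can be chosen at will.\<close>
    proof (intro exI[of _ "1 :: real"] exI[of _ "M x"] conjI allI impI)
      fix e :: real assume "0 < e"
      then show "\<exists>N. \<forall>n\<ge>N. \<forall>h\<in>superspace. ext_norm h < 1 \<longrightarrow>
        grassmann_norm (\<lambda>j. phi F (\<lambda>i. x i + h i) j - (\<Sum>k<n. M x k (replicate k h) j)) < e"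
        by (intro exI[of _ N]) (simp add: M0[OF x] norm0)
    qed (simp_all add: M[OF x])
  qed
qed

theorem theorem1:
  assumes infinite_dimensional:
    "\<And>B :: 'l::{complex_hilbert_space, second_countable_topology} set. finite B \<Longrightarrow> span B \<noteq> UNIV"
  shows "(\<forall>F\<in>S_fin. (phi F :: ('l, 'h::graded_hilbert_space) ext \<Rightarrow> 'l grass) \<in> superspace_functions) \<and>
    (\<forall>F\<in>S_fin. \<forall>G\<in>S_fin. \<forall>a b. \<forall>\<zeta>\<in>(superspace :: ('l, 'h) ext set).
       phi (\<lambda>w. a * F w + b * G w) \<zeta> = (\<lambda>l. a * phi F \<zeta> l + b * phi G \<zeta> l)) \<and>
    (\<forall>\<zeta>\<in>(superspace :: ('l, 'h) ext set). phi unit_tensor \<zeta> = unit_tensor) \<and>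
    (\<forall>F\<in>S_fin. \<forall>G\<in>S_fin. \<forall>\<zeta>\<in>(superspace :: ('l, 'h) ext set).
       phi (F \<odot> G) \<zeta> = phi F \<zeta> \<cdot>\<^sub>\<Lambda> phi G \<zeta>)"
proof (intro conjI ballI allI)
  fix F G :: "'h list \<Rightarrow> complex" and \<zeta> :: "('l, 'h) ext" and a b
  assume F: "F \<in> S_fin" and G: "G \<in> S_fin" and z: "\<zeta> \<in> superspace"
  obtain N M where "finite_fock N F" "finite_fock M G"
    using finite_fock_S_fin[OF F] finite_fock_S_fin[OF G] by metis
  then show "phi (\<lambda>w. a * F w + b * G w) \<zeta> = (\<lambda>l. a * phi F \<zeta> l + b * phi G \<zeta> l)"
    "phi (F \<odot> G) \<zeta> = phi F \<zeta> \<cdot>\<^sub>\<Lambda> phi G \<zeta>"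
    using phi_linear[OF z] phi_mult[OF z] by blast+
next
  fix F :: "'h list \<Rightarrow> complex" assume "F \<in> S_fin"
  then show "(phi F :: ('l, 'h) ext \<Rightarrow> 'l grass) \<in> superspace_functions"
    using phi_entire_analytic finite_fock_S_fin by metis
qed (rule phi_unit)

end
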